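(* Let $\Gamma:\ell_2^0(\ell_2^{3^n})\to\ell_2(\ell_2^{3^n})$ be the Enflo-Lindenstrauss-Pisier map, $\Gamma((x_n)_n)=(\Gamma_n(x_n))_n$, where $\Gamma_n:\ell_2^{3^n}\to\ell_2^{3^n}$ are the maps defined recursively in the context, and where $\ell_2(\ell_2^{3^n})$ is identified with $\ell_2$. Then $\Gamma\,\Gamma\sim0$ in $\operatorname{Ext}^2(\ell_2,\ell_2)$ (in the category of quasi Banach spaces).
   Context: The maps $\Gamma_n$. Let $\Gamma_1,P_1:\ell_2^3\to\ell_2^3$ be $$\Gamma_1(x,y,z)=\Big(x,y,\frac{x|y|}{(|x|^2+|y|^2)^{1/2}}\Big),\qquad P_1(x,y,z)=(x,y,0).$$ Writing elements of $\ell_2^{3^n}$ as triples $(x,y,z)$ with $x,y,z\in\ell_2^{3^{n-1}}$, define for $n\ge2$ $$\Gamma_n(x,y,z)=\Big(\Gamma_{n-1}(P_{n-1}x),\ \Gamma_{n-1}(P_{n-1}y),\ \frac{P_{n-1}(x)\,\|P_{n-1}(y)\|}{(\|P_{n-1}(x)\|^2+\|P_{n-1}(y)\|^2)^{1/2}}\Big),$$ $$P_n(x,y,z)=(P_{n-1}(x),P_{n-1}(y),0),$$ with the convention that a quotient with zero denominator is $0$. $\ell_2(\ell_2^{3^n})$ is the $\ell_2$-sum of the spaces $\ell_2^{3^n}$, $n\ge1$ (a copy of $\ell_2$), and $\ell_2^0(\ell_2^{3^n})$ is its dense subspace of finitely supported elements. The map $\Gamma$ is quasilinear (Enflo-Lindenstrauss-Pisier).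 Quasi Banach spaces are complete quasinormed spaces (quasinorm: homogeneous, vanishing only at $0$, with $\|x+y\|\le C(\|x\|+\|y\|)$ for some constant $C$); operators are bounded linear maps. A sequence is exact if the kernel of each operator equals the image of the preceding one. $\operatorname{Ext}^2(X,Y)$. Consider four-term exact sequences $\mathscr E:\ 0\to Y\to E_1\to E_2\to X\to0$ of quasi Banach spaces and operators. Write $\mathscr E\to\mathscr F$ if there are operators $u_1:E_1\to F_1$, $u_2:E_2\to F_2$ that, together with the identities of $Y$ and $X$, make the obvious diagram commute. $\operatorname{Ext}^2(X,Y)$ is the set of classes for the equivalence relation generated by $\to$; its zero element is the class of $0\to Y\xrightarrow{\mathbf I}Y\xrightarrow{0}X\xrightarrow{\mathbf I}X\to0$. A sequence is trivial if it is equivalent to this one. Quasilinear maps and splicing. A homogeneous map $\Phi$ between quasinormed spaces is quasilinear if $\|\Phi(x+y)-\Phi(x)-\Phi(y)\|\le Q(\|x\|+\|y\|)$ for some $Q$ and all $x,y$. If $X,Y$ are quasi Banach, $X_0$ is dense in $X$ and $\Phi:X_0\to Y$ is quasilinear, let $Z(\Phi)$ be the completion of $Y\times X_0$ with the quasinorm $\|(y,x)\|_\Phi=\|y-\Phi(x)\|+\|x\|$. The induced exact sequence is $0\to Y\xrightarrow{\imath}Z(\Phi)\xrightarrow{\pi}X\to0$, where $\imath(y)=(y,0)$ and $\pi$ extends $(y,x)\mapsto x$. For quasilinear $\Psi:X_0\to E$ and $\Phi:E_0\to Y$ ($X_0$, $E_0$ dense in $X$, $E$), $\Phi\,\Psi$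 denotes the four-term sequence $0\to Y\to Z(\Phi)\to Z(\Psi)\to X\to0$ whose middle arrow is the composition $Z(\Phi)\to E\to Z(\Psi)$ of the quotient map and the inclusion; $\Phi\,\Psi\sim0$ means that it is trivial in $\operatorname{Ext}^2(X,Y)$. *)

theory Defs
  imports "HOL-Analysis.Analysis"
begin

text \<open>
  Scalars range over an arbitrary type of sort \<open>{real_normed_field, banach}\<close>; up to isomorphism
  the only such fields are the real and the complex numbers. Vector spaces carry an explicit
  carrier, so that one can quantify over all spaces with underlying set in a given type; the
  operations are only meaningful on the carrier.
\<close>

record ('k, 'a) qspace =
  qcar :: "'a set"
  qzero :: 'a
  qadd :: "'a \<Rightarrow> 'a \<Rightarrow> 'a"
  qsmul :: "'k \<Rightarrow> 'a \<Rightarrow> 'a"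
  qnorm :: "'a \<Rightarrow> real"

definition qdiff :: "('k::real_normed_field, 'a) qspace \<Rightarrow> 'a \<Rightarrow> 'a \<Rightarrow> 'a" where
  "qdiff V x y = qadd V x (qsmul V (- 1) y)"

definition vspace :: "('k::real_normed_field, 'a) qspace \<Rightarrow> bool" where
  "vspace V \<longleftrightarrow>
     qzero V \<in> qcar V \<and>
     (\<forall>x\<in>qcar V. \<forall>y\<in>qcar V. qadd V x y \<in> qcar V) \<and>
     (\<forall>c. \<forall>x\<in>qcar V. qsmul V c x \<in> qcar V) \<and>
     (\<forall>x\<in>qcar V. \<forall>y\<in>qcar V. \<forall>z\<in>qcar V. qadd V (qadd V x y) z = qadd V x (qadd V y z)) \<and>
     (\<forall>x\<in>qcar V. \<forall>y\<in>qcar V. qadd V x y = qadd V y x) \<and>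
     (\<forall>x\<in>qcar V. qadd V (qzero V) x = x) \<and>
     (\<forall>x\<in>qcar V. qdiff V x x = qzero V) \<and>
     (\<forall>c. \<forall>x\<in>qcar V. \<forall>y\<in>qcar V. qsmul V c (qadd V x y) = qadd V (qsmul V c x) (qsmul V c y)) \<and>
     (\<forall>c d. \<forall>x\<in>qcar V. qsmul V (c + d) x = qadd V (qsmul V c x) (qsmul V d x)) \<and>
     (\<forall>c d. \<forall>x\<in>qcar V. qsmul V (c * d) x = qsmul V c (qsmul V d x)) \<and>
     (\<forall>x\<in>qcar V. qsmul V 1 x = x)"

definition quasinormed :: "('k::real_normed_field, 'a) qspace \<Rightarrow> bool" where
  "quasinormed V \<longleftrightarrow>
     vspace V \<and>
     (\<forall>x\<in>qcar V. 0 \<le> qnorm V x) \<and>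
     (\<forall>x\<in>qcar V. qnorm V x = 0 \<longleftrightarrow> x = qzero V) \<and>
     (\<forall>c. \<forall>x\<in>qcar V. qnorm V (qsmul V c x) = norm c * qnorm V x) \<and>
     (\<exists>C. \<forall>x\<in>qcar V. \<forall>y\<in>qcar V. qnorm V (qadd V x y) \<le> C * (qnorm V x + qnorm V y))"

definition qlim :: "('k::real_normed_field, 'a) qspace \<Rightarrow> (nat \<Rightarrow> 'a) \<Rightarrow> 'a \<Rightarrow> bool" where
  "qlim V s x \<longleftrightarrow> (\<lambda>n. qnorm V (qdiff V (s n) x)) \<longlonglongrightarrow> 0"

definition qCauchy :: "('k::real_normed_field, 'a) qspace \<Rightarrow> (nat \<Rightarrow> 'a) \<Rightarrow> bool" where
  "qCauchy V s \<longleftrightarrow>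
     range s \<subseteq> qcar V \<and>
     (\<forall>e>0. \<exists>N. \<forall>m\<ge>N. \<forall>n\<ge>N. qnorm V (qdiff V (s m) (s n)) < e)"

definition quasi_banach :: "('k::real_normed_field, 'a) qspace \<Rightarrow> bool" where
  "quasi_banach V \<longleftrightarrow>
     quasinormed V \<and> (\<forall>s. qCauchy V s \<longrightarrow> (\<exists>x\<in>qcar V. qlim V s x))"

definition qlinear :: "('k, 'a) qspace \<Rightarrow> ('k, 'b) qspace \<Rightarrow> ('a \<Rightarrow> 'b) \<Rightarrow> bool" where
  "qlinear V W f \<longleftrightarrow>
     f ` qcar V \<subseteq> qcar W \<and>
     (\<forall>x\<in>qcar V. \<forall>y\<in>qcar V. f (qadd V x y) = qadd W (f x) (f y)) \<and>
     (\<forall>c. \<forall>x\<in>qcar V. f (qsmul V c x) = qsmul W c (f x))"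

definition qoperator :: "('k, 'a) qspace \<Rightarrow> ('k, 'b) qspace \<Rightarrow> ('a \<Rightarrow> 'b) \<Rightarrow> bool" where
  "qoperator V W f \<longleftrightarrow>
     qlinear V W f \<and> (\<exists>C. \<forall>x\<in>qcar V. qnorm W (f x) \<le> C * qnorm V x)"

definition qiso :: "('k, 'a) qspace \<Rightarrow> ('k, 'b) qspace \<Rightarrow> ('a \<Rightarrow> 'b) \<Rightarrow> bool" where
  "qiso V W f \<longleftrightarrow>
     bij_betw f (qcar V) (qcar W) \<and> qoperator V W f \<and> qoperator W V (inv_into (qcar V) f)"

definition isometric_iso :: "('k, 'a) qspace \<Rightarrow> ('k, 'b) qspace \<Rightarrow> ('a \<Rightarrow> 'b) \<Rightarrow> bool" where
  "isometric_iso V W f \<longleftrightarrow>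
     bij_betw f (qcar V) (qcar W) \<and> qlinear V W f \<and> (\<forall>x\<in>qcar V. qnorm W (f x) = qnorm V x)"

definition qker :: "('k, 'a) qspace \<Rightarrow> ('k, 'b) qspace \<Rightarrow> ('a \<Rightarrow> 'b) \<Rightarrow> 'a set" where
  "qker V W f = {x \<in> qcar V. f x = qzero W}"

section \<open>Four-term exact sequences\<close>

text \<open>The data of \<open>0 \<rightarrow> Y \<rightarrow> E1 \<rightarrow> E2 \<rightarrow> X \<rightarrow> 0\<close> relative to fixed \<open>Y\<close> and \<open>X\<close>.\<close>

record ('k, 'y, 'a, 'b, 'x) four_term =
  E1 :: "('k, 'a) qspace"
  E2 :: "('k, 'b) qspace"
  arr_in :: "'y \<Rightarrow> 'a"
  arr_mid :: "'a \<Rightarrow> 'b"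
  arr_out :: "'b \<Rightarrow> 'x"

definition exact4 ::
  "('k::real_normed_field, 'y) qspace \<Rightarrow> ('k, 'x) qspace \<Rightarrow> ('k, 'y, 'a, 'b, 'x) four_term \<Rightarrow> bool"
where
  "exact4 Y X S \<longleftrightarrow>
     quasi_banach Y \<and> quasi_banach (E1 S) \<and> quasi_banach (E2 S) \<and> quasi_banach X \<and>
     qoperator Y (E1 S) (arr_in S) \<and>
     qoperator (E1 S) (E2 S) (arr_mid S) \<and>
     qoperator (E2 S) X (arr_out S) \<and>
     qker Y (E1 S) (arr_in S) = {qzero Y} \<and>
     qker (E1 S) (E2 S) (arr_mid S) = arr_in S ` qcar Y \<and>
     qker (E2 S) X (arr_out S) = arr_mid S ` qcar (E1 S) \<and>
     qcar X = arr_out S ` qcar (E2 S)"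

definition commutes4 ::
  "('k, 'y) qspace \<Rightarrow> ('k, 'y, 'a, 'b, 'x) four_term \<Rightarrow> ('k, 'y, 'c, 'd, 'x) four_term
    \<Rightarrow> ('a \<Rightarrow> 'c) \<Rightarrow> ('b \<Rightarrow> 'd) \<Rightarrow> bool"
where
  "commutes4 Y S T u1 u2 \<longleftrightarrow>
     (\<forall>y\<in>qcar Y. u1 (arr_in S y) = arr_in T y) \<and>
     (\<forall>e\<in>qcar (E1 S). u2 (arr_mid S e) = arr_mid T (u1 e)) \<and>
     (\<forall>e\<in>qcar (E2 S). arr_out T (u2 e) = arr_out S e)"

definition arrow4 ::
  "('k::real_normed_field, 'y) qspace \<Rightarrow> ('k, 'x) qspace
    \<Rightarrow> ('k, 'y, 'a, 'b, 'x) four_term \<Rightarrow> ('k, 'y, 'c, 'd, 'x) four_term \<Rightarrow> bool"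
where
  "arrow4 Y X S T \<longleftrightarrow>
     exact4 Y X S \<and> exact4 Y X T \<and>
     (\<exists>u1 u2. qoperator (E1 S) (E1 T) u1 \<and> qoperator (E2 S) (E2 T) u2 \<and> commutes4 Y S T u1 u2)"

definition iso4 ::
  "('k::real_normed_field, 'y) qspace \<Rightarrow> ('k, 'x) qspace
    \<Rightarrow> ('k, 'y, 'a, 'b, 'x) four_term \<Rightarrow> ('k, 'y, 'c, 'd, 'x) four_term \<Rightarrow> bool"
where
  "iso4 Y X S T \<longleftrightarrow>
     exact4 Y X S \<and> exact4 Y X T \<and>
     (\<exists>u1 u2. qiso (E1 S) (E1 T) u1 \<and> qiso (E2 S) (E2 T) u2 \<and> commutes4 Y S T u1 u2)"

text \<open>
  The equivalence relation defining \<open>Ext\<^sup>2(X,Y)\<close>, generated by \<open>arrow4\<close> on the exact sequences whose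
  middle spaces have their underlying sets in the type \<open>'u\<close>, which plays the role of the universe.
  Sequences living on other types are compared through isomorphic copies in \<open>'u\<close>.
\<close>

definition ext2_equiv ::
  "'u itself \<Rightarrow> ('k::real_normed_field, 'y) qspace \<Rightarrow> ('k, 'x) qspace
    \<Rightarrow> ('k, 'y, 'a, 'b, 'x) four_term \<Rightarrow> ('k, 'y, 'c, 'd, 'x) four_term \<Rightarrow> bool"
where
  "ext2_equiv u Y X S T \<longleftrightarrow>
     (\<exists>S' T' :: ('k, 'y, 'u, 'u, 'x) four_term.
        iso4 Y X S S' \<and> iso4 Y X T T' \<and> equivclp (arrow4 Y X) S' T')"

definition zero4 :: "('k, 'y) qspace \<Rightarrow> ('k, 'x) qspace \<Rightarrow> ('k, 'y, 'y, 'x, 'x) four_term" where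
  "zero4 Y X =
     \<lparr>E1 = Y, E2 = X, arr_in = (\<lambda>y. y), arr_mid = (\<lambda>_. qzero X), arr_out = (\<lambda>x. x)\<rparr>"

definition ext2_trivial ::
  "'u itself \<Rightarrow> ('k::real_normed_field, 'y) qspace \<Rightarrow> ('k, 'x) qspace
    \<Rightarrow> ('k, 'y, 'a, 'b, 'x) four_term \<Rightarrow> bool"
where
  "ext2_trivial u Y X S \<longleftrightarrow> ext2_equiv u Y X S (zero4 Y X)"

section \<open>Completion, twisted sums and splicing\<close>

text \<open>
  The completion is the space of Cauchy sequences modulo null sequences, with the quotient of the
  supremum quasinorm. Since a quasinorm need not be continuous, it need not extend by continuity;
  the quotient quasinorm restricts to an equivalent quasinorm on \<open>V\<close> (and to the given one if that
  is continuous).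
\<close>

definition cclass :: "('k::real_normed_field, 'a) qspace \<Rightarrow> (nat \<Rightarrow> 'a) \<Rightarrow> (nat \<Rightarrow> 'a) set" where
  "cclass V s = {t. qCauchy V t \<and> (\<lambda>n. qnorm V (qdiff V (s n) (t n))) \<longlonglongrightarrow> 0}"

definition crep :: "(nat \<Rightarrow> 'a) set \<Rightarrow> nat \<Rightarrow> 'a" where
  "crep A = (SOME s. s \<in> A)"

definition completion :: "('k::real_normed_field, 'a) qspace \<Rightarrow> ('k, (nat \<Rightarrow> 'a) set) qspace" where
  "completion V =
     \<lparr>qcar = cclass V ` {s. qCauchy V s},
      qzero = cclass V (\<lambda>_. qzero V),
      qadd = (\<lambda>A B. cclass V (\<lambda>n. qadd V (crep A n) (crep B n))),
      qsmul = (\<lambda>c A. cclass V (\<lambda>n. qsmul V c (crep A n))),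
      qnorm = (\<lambda>A. Inf {r. \<exists>s\<in>A. \<forall>n. qnorm V (s n) \<le> r})\<rparr>"

definition twisted ::
  "('k::real_normed_field, 'y) qspace \<Rightarrow> ('k, 'x) qspace \<Rightarrow> 'x set \<Rightarrow> ('x \<Rightarrow> 'y)
    \<Rightarrow> ('k, 'y \<times> 'x) qspace"
where
  "twisted Y X X0 \<Phi> =
     \<lparr>qcar = qcar Y \<times> X0,
      qzero = (qzero Y, qzero X),
      qadd = (\<lambda>(y, x) (y', x'). (qadd Y y y', qadd X x x')),
      qsmul = (\<lambda>c (y, x). (qsmul Y c y, qsmul X c x)),
      qnorm = (\<lambda>(y, x). qnorm Y (qdiff Y y (\<Phi> x)) + qnorm X x)\<rparr>"

definition Zsp ::
  "('k::real_normed_field, 'y) qspace \<Rightarrow> ('k, 'x) qspace \<Rightarrow> 'x set \<Rightarrow> ('x \<Rightarrow> 'y)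
    \<Rightarrow> ('k, (nat \<Rightarrow> 'y \<times> 'x) set) qspace"
where
  "Zsp Y X X0 \<Phi> = completion (twisted Y X X0 \<Phi>)"

definition Zinc ::
  "('k::real_normed_field, 'y) qspace \<Rightarrow> ('k, 'x) qspace \<Rightarrow> 'x set \<Rightarrow> ('x \<Rightarrow> 'y)
    \<Rightarrow> 'y \<Rightarrow> (nat \<Rightarrow> 'y \<times> 'x) set"
where
  "Zinc Y X X0 \<Phi> y = cclass (twisted Y X X0 \<Phi>) (\<lambda>_. (y, qzero X))"

definition Zproj :: "('k::real_normed_field, 'x) qspace \<Rightarrow> (nat \<Rightarrow> 'y \<times> 'x) set \<Rightarrow> 'x" where
  "Zproj X A = (THE x. x \<in> qcar X \<and> (\<forall>s\<in>A. qlim X (\<lambda>n. snd (s n)) x))"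

text \<open>The sequence \<open>\<Phi> \<Psi>\<close> for \<open>\<Psi> : X0 \<rightarrow> E\<close> and \<open>\<Phi> : E0 \<rightarrow> Y\<close>.\<close>

definition splice4 ::
  "('k::real_normed_field, 'y) qspace \<Rightarrow> ('k, 'e) qspace \<Rightarrow> ('k, 'x) qspace
    \<Rightarrow> 'e set \<Rightarrow> ('e \<Rightarrow> 'y) \<Rightarrow> 'x set \<Rightarrow> ('x \<Rightarrow> 'e)
    \<Rightarrow> ('k, 'y, (nat \<Rightarrow> 'y \<times> 'e) set, (nat \<Rightarrow> 'e \<times> 'x) set, 'x) four_term"
where
  "splice4 Y E X E0 \<Phi> X0 \<Psi> =
     \<lparr>E1 = Zsp Y E E0 \<Phi>,
      E2 = Zsp E X X0 \<Psi>,
      arr_in = Zinc Y E E0 \<Phi>,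
      arr_mid = (\<lambda>A. Zinc E X X0 \<Psi> (Zproj E A)),
      arr_out = Zproj X\<rparr>"

section \<open>The spaces and the Enflo--Lindenstrauss--Pisier map\<close>

definition l2 :: "('k::real_normed_field, nat \<Rightarrow> 'k) qspace" where
  "l2 =
     \<lparr>qcar = {x. summable (\<lambda>n. (norm (x n))\<^sup>2)},
      qzero = (\<lambda>_. 0),
      qadd = (\<lambda>x y n. x n + y n),
      qsmul = (\<lambda>c x n. c * x n),
      qnorm = (\<lambda>x. sqrt (\<Sum>n. (norm (x n))\<^sup>2))\<rparr>"

text \<open>
  A vector of \<open>\<ell>\<^sub>2\<^sup>N\<close> is a function on \<open>nat\<close> vanishing outside \<open>{..<N}\<close>. A vector of dimension \<open>3 * m\<close>
  is the triple of its consecutive blocks of length \<open>m\<close>.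
\<close>

definition fnorm :: "nat \<Rightarrow> (nat \<Rightarrow> 'k::real_normed_field) \<Rightarrow> real" where
  "fnorm N v = L2_set (\<lambda>i. norm (v i)) {..<N}"

definition triple :: "nat \<Rightarrow> (nat \<Rightarrow> 'k) \<Rightarrow> (nat \<Rightarrow> 'k) \<Rightarrow> (nat \<Rightarrow> 'k) \<Rightarrow> nat \<Rightarrow> 'k::zero" where
  "triple m x y z =
     (\<lambda>i. if i < m then x i else if i < 2 * m then y (i - m)
          else if i < 3 * m then z (i - 2 * m) else 0)"

definition block :: "nat \<Rightarrow> nat \<Rightarrow> (nat \<Rightarrow> 'k) \<Rightarrow> nat \<Rightarrow> 'k::zero" where
  "block m k v = (\<lambda>i. if i < m then v (k * m + i) else 0)"

text \<open>
  \<open>elp_P n\<close> and \<open>elp_G n\<close> are \<open>P\<^sub>n\<close> and \<open>\<Gamma>\<^sub>n\<close> for \<open>n \<ge> 1\<close>; the value at \<open>0\<close> is irrelevant. Division by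
  zero yields zero, as the definition of \<open>\<Gamma>\<^sub>n\<close> requires.
\<close>

fun elp_P :: "nat \<Rightarrow> (nat \<Rightarrow> 'k) \<Rightarrow> nat \<Rightarrow> 'k::real_normed_field" where
  "elp_P 0 v = v"
| "elp_P (Suc 0) v = triple 1 (\<lambda>_. v 0) (\<lambda>_. v 1) (\<lambda>_. 0)"
| "elp_P (Suc (Suc n)) v =
     (let m = 3 ^ Suc n
      in triple m (elp_P (Suc n) (block m 0 v)) (elp_P (Suc n) (block m 1 v)) (\<lambda>_. 0))"

fun elp_G :: "nat \<Rightarrow> (nat \<Rightarrow> 'k) \<Rightarrow> nat \<Rightarrow> 'k::real_normed_field" where
  "elp_G 0 v = v"
| "elp_G (Suc 0) v =
     triple 1 (\<lambda>_. v 0) (\<lambda>_. v 1)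
       (\<lambda>_. (norm (v 1) / sqrt ((norm (v 0))\<^sup>2 + (norm (v 1))\<^sup>2)) *\<^sub>R v 0)"
| "elp_G (Suc (Suc n)) v =
     (let m = 3 ^ Suc n;
          x = elp_P (Suc n) (block m 0 v);
          y = elp_P (Suc n) (block m 1 v)
      in triple m (elp_G (Suc n) x) (elp_G (Suc n) y)
           (\<lambda>i. (fnorm m y / sqrt ((fnorm m x)\<^sup>2 + (fnorm m y)\<^sup>2)) *\<^sub>R x i))"

text \<open>The \<open>\<ell>\<^sub>2\<close>-sum of the spaces \<open>\<ell>\<^sub>2\<^sup>N\<close> with \<open>N = 3\<^sup>n\<close>, \<open>n \<ge> 1\<close>; the component of index \<open>0\<close> is zero.\<close>

definition elp_space :: "('k::real_normed_field, nat \<Rightarrow> nat \<Rightarrow> 'k) qspace" where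
  "elp_space =
     \<lparr>qcar = {v. (\<forall>i. v 0 i = 0) \<and> (\<forall>n i. 3 ^ n \<le> i \<longrightarrow> v n i = 0) \<and>
                 summable (\<lambda>n. (fnorm (3 ^ n) (v n))\<^sup>2)},
      qzero = (\<lambda>_ _. 0),
      qadd = (\<lambda>v w n i. v n i + w n i),
      qsmul = (\<lambda>c v n i. c * v n i),
      qnorm = (\<lambda>v. sqrt (\<Sum>n. (fnorm (3 ^ n) (v n))\<^sup>2))\<rparr>"

definition elp_space0 :: "(nat \<Rightarrow> nat \<Rightarrow> 'k::real_normed_field) set" where
  "elp_space0 = {v \<in> qcar elp_space. finite {n. v n \<noteq> (\<lambda>_. 0)}}"

definition elp_map :: "(nat \<Rightarrow> nat \<Rightarrow> 'k) \<Rightarrow> nat \<Rightarrow> nat \<Rightarrow> 'k::real_normed_field" where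
  "elp_map v = (\<lambda>n. elp_G n (v n))"

text \<open>The map read in \<open>\<ell>\<^sub>2\<close> through an identification \<open>T\<close> of the \<open>\<ell>\<^sub>2\<close>-sum with \<open>\<ell>\<^sub>2\<close>.\<close>

definition elp_dom ::
  "((nat \<Rightarrow> nat \<Rightarrow> 'k) \<Rightarrow> nat \<Rightarrow> 'k) \<Rightarrow> (nat \<Rightarrow> 'k::real_normed_field) set"
where
  "elp_dom T = T ` elp_space0"

definition elp_l2 ::
  "((nat \<Rightarrow> nat \<Rightarrow> 'k) \<Rightarrow> nat \<Rightarrow> 'k) \<Rightarrow> (nat \<Rightarrow> 'k) \<Rightarrow> nat \<Rightarrow> 'k::real_normed_field"
where
  "elp_l2 T x = T (elp_map (inv_into (qcar elp_space) T x))"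

text \<open>Such an identification exists.\<close>

lemma elp_space_isometric_l2:
  "\<exists>T :: (nat \<Rightarrow> nat \<Rightarrow> 'k::real_normed_field) \<Rightarrow> nat \<Rightarrow> 'k. isometric_iso elp_space l2 T"
proof -
  define I where "I = (SIGMA n:{1..}. {..<(3::nat) ^ n})"
  define e where "e = from_nat_into I"
  have "countable I"
    by simp
  moreover have "infinite I"
  proof
    assume "finite I"
    moreover have "(\<lambda>n. (n, 0)) ` {1::nat..} \<subseteq> I"
      by (auto simp: I_def)
    ultimately have "finite ((\<lambda>n. (n, 0::nat)) ` {1::nat..})"
      using finite_subset by blast
    then have "finite {1::nat..}"
      by (rule finite_imageD) (auto simp: inj_on_def)
    then show False
      using infinite_Ici by blast
  qed
  ultimately have e: "bij_betw e UNIV I"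
    unfolding e_def by (rule bij_betw_from_nat_into)
  have key: "(\<lambda>k. g (e k)) sums S \<longleftrightarrow> (\<lambda>n. \<Sum>i<3 ^ n. g (n, i)) sums S"
    if g: "\<And>p. 0 \<le> g p" "\<And>i. g (0, i) = 0" for g :: "nat \<times> nat \<Rightarrow> real" and S
  proof -
    let ?b = "\<lambda>n. \<Sum>i<3 ^ n. g (n, i)"
    have hs: "((\<lambda>i. g (n, i)) has_sum ?b n) {..<3 ^ n}" for n
      by (simp add: has_sum_finite)
    have "(\<lambda>k. g (e k)) sums S \<longleftrightarrow> ((\<lambda>k. g (e k)) has_sum S) UNIV"
      using has_sum_imp_sums sums_nonneg_imp_has_sum[of "\<lambda>k. g (e k)"] g(1) by blast
    also have "\<dots> \<longleftrightarrow> (g has_sum S) I"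
      by (rule has_sum_reindex_bij_betw[OF e])
    also have "\<dots> \<longleftrightarrow> (?b has_sum S) {1..}"
    proof
      assume "(g has_sum S) I"
      then show "(?b has_sum S) {1..}"
        unfolding I_def by (rule has_sum_SigmaD) (rule hs)
    next
      assume b: "(?b has_sum S) {1..}"
      then have "g summable_on I"
        unfolding I_def using g hs
        by (intro summable_on_SigmaI[where g = ?b]) (auto simp: summable_on_def)
      then show "(g has_sum S) I"
        unfolding I_def using b hs by (intro has_sum_SigmaI[where g = ?b]) auto
    qed
    also have "\<dots> \<longleftrightarrow> (?b has_sum S) UNIV"
      using g by (intro has_sum_cong_neutral) (auto simp: not_le)
    also have "\<dots> \<longleftrightarrow> ?b sums S"
      using g by (auto intro: has_sum_imp_sums sums_nonneg_imp_has_sum sum_nonneg)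
    finally show ?thesis .
  qed
  define T :: "(nat \<Rightarrow> nat \<Rightarrow> 'k) \<Rightarrow> nat \<Rightarrow> 'k" where "T v = (\<lambda>k. case_prod v (e k))" for v
  have sums: "(\<lambda>k. (norm (T v k))\<^sup>2) sums S \<longleftrightarrow> (\<lambda>n. (fnorm (3 ^ n) (v n))\<^sup>2) sums S"
    if "\<And>i. v 0 i = 0" for v S
    using key[of "\<lambda>p. (norm (case_prod v p))\<^sup>2" S] that
    by (simp add: T_def fnorm_def L2_set_def sum_nonneg)
  have summ: "summable (\<lambda>k. (norm (T v k))\<^sup>2) \<longleftrightarrow> summable (\<lambda>n. (fnorm (3 ^ n) (v n))\<^sup>2)"
    "(\<Sum>k. (norm (T v k))\<^sup>2) = (\<Sum>n. (fnorm (3 ^ n) (v n))\<^sup>2)" if "\<And>i. v 0 i = 0" for v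
    using sums[of v, OF that] by (auto simp: summable_def suminf_def)
  have bij: "bij_betw T (qcar elp_space) (qcar l2)"
  proof (rule bij_betwI')
    fix v w :: "nat \<Rightarrow> nat \<Rightarrow> 'k"
    assume vw: "v \<in> qcar elp_space" "w \<in> qcar elp_space"
    show "T v = T w \<longleftrightarrow> v = w"
    proof
      assume T: "T v = T w"
      have "v n i = w n i" for n i
      proof (cases "(n, i) \<in> I")
        case True
        then obtain k where "e k = (n, i)"
          using e by (metis bij_betw_iff_bijections)
        then show ?thesis
          using fun_cong[OF T, of k] by (simp add: T_def)
      next
        case False
        then show ?thesis
          using vw by (cases "n = 0") (auto simp: I_def elp_space_def not_less)
      qed
      then show "v = w"
        by blast
    qed simp
  next
    fix v :: "nat \<Rightarrow> nat \<Rightarrow> 'k"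
    assume "v \<in> qcar elp_space"
    then show "T v \<in> qcar l2"
      using summ(1)[of v] by (simp add: elp_space_def l2_def)
  next
    fix x :: "nat \<Rightarrow> 'k"
    assume x: "x \<in> qcar l2"
    define v where "v n i = (if (n, i) \<in> I then x (inv_into UNIV e (n, i)) else 0)" for n i
    have "T v = x"
    proof
      fix k
      have "e k \<in> I"
        using e by (auto simp: bij_betw_def)
      moreover have "inv_into UNIV e (e k) = k"
        using e by (simp add: bij_betw_def)
      ultimately show "T v k = x k"
        by (cases "e k") (simp add: T_def v_def)
    qed
    moreover have "v 0 i = 0" "3 ^ n \<le> i \<Longrightarrow> v n i = 0" for n i
      by (auto simp: v_def I_def)
    ultimately show "\<exists>v\<in>qcar elp_space. x = T v"
      using x summ(1)[of v] by (intro bexI[of _ v]) (auto simp: elp_space_def l2_def)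
  qed
  have "isometric_iso elp_space l2 T"
    unfolding isometric_iso_def qlinear_def
  proof (intro conjI ballI allI)
    show "T ` qcar elp_space \<subseteq> qcar l2"
      using bij by (simp add: bij_betw_def)
    show "qnorm l2 (T v) = qnorm elp_space v" if "v \<in> qcar elp_space" for v
      using that summ(2)[of v] by (simp add: elp_space_def l2_def)
  qed (use bij in \<open>auto simp: elp_space_def l2_def T_def fun_eq_iff split: prod.splits\<close>)
  then show ?thesis
    by blast
qed

end

theory Submission
  imports Defs
begin

text \<open>
  Let \<open>P\<close> be the norm one projection with components \<open>P\<^sub>n\<close>. Then \<open>\<Gamma> P = \<Gamma>\<close>, because \<open>\<Gamma>\<^sub>n\<close> only sees
  \<open>P\<^sub>n\<close> of its argument, and \<open>P \<Gamma> = P\<close> by induction on \<open>n\<close>. Hence \<open>\<Gamma> \<Gamma> = (\<Gamma> P) \<Gamma> = \<Gamma> (P \<Gamma>)\<close> with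
  \<open>P \<Gamma>\<close> bounded and linear. Concretely, \<open>(e, x) \<mapsto> P e\<close> is an operator \<open>p\<close> on \<open>Z(\<Gamma>)\<close> that extends \<open>P\<close>
  along the inclusion of \<open>\<ell>\<^sub>2\<close>; the pullback of \<open>Z(\<Gamma>) \<rightarrow> \<ell>\<^sub>2\<close> along \<open>p\<close> is an extension of \<open>Z(\<Gamma>)\<close> by
  \<open>\<ell>\<^sub>2\<close> that restricts to \<open>\<Gamma> P = \<Gamma>\<close>, which kills the class of \<open>\<Gamma> \<Gamma>\<close>.

  Quasilinearity of \<open>\<Gamma>\<close> follows from the bound \<open>4 (r\<^sub>1 r\<^sub>2 + r\<^sub>1 r\<^sub>3 + r\<^sub>2 r\<^sub>3)\<close> for the square of the defect
  of \<open>\<Gamma>\<^sub>n\<close>, where \<open>r\<^sub>1, r\<^sub>2, r\<^sub>3\<close> are the norms of the two arguments and of their sum. Unlike a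
  multiple of \<open>(r\<^sub>1 + r\<^sub>2)\<^sup>2\<close>, this expression gains enough in passing from blocks to the whole vector
  to absorb the defect of the third component, so that the induction on \<open>n\<close> closes.
\<close>

section \<open>Quasinormed spaces\<close>

text \<open>The gain is a Cauchy-Schwarz deficit. If a vector has norms \<open>a\<close> and
  \<open>b\<close> on its two projected blocks and \<open>r\<close> is the length of
  \<open>(a, b)\<close>, then the coefficient of the third component is the second coordinate
  \<open>b / r\<close> of a plane unit vector. For two such nonzero vectors,
  \<open>r r' - a a' - b b'\<close> is \<open>r r' / 2\<close> times the squared distance of their
  unit vectors. So the variation of the coefficient costs no more than the products of norms gain
  when blocks are assembled, and the constant 4 does not grow with \<open>n\<close>. The two
  identities enter separately: \<open>\<Gamma> P = \<Gamma>\<close> lifts \<open>P\<close> to the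
  copy of \<open>Z(\<Gamma>)\<close> on the left, fixing the subspace, while boundedness of
  \<open>P \<Gamma>\<close> extends \<open>P\<close> to the copy on the right. The resulting zigzag
  has only two arrows, from the spliced and from the zero sequence into a common one. The relation
  is generated inside a type about which only an injection of the scalar sequences is known. Hence
  every space that occurs has to be coded by scalar sequences, and completions, whose elements are
  classes of sequences, are coded through chosen representatives.\<close>

lemma vspaceD:
  assumes "vspace V"
  shows vspace_zero: "qzero V \<in> qcar V"
    and vspace_add: "\<And>x y. x \<in> qcar V \<Longrightarrow> y \<in> qcar V \<Longrightarrow> qadd V x y \<in> qcar V"
    and vspace_smul: "\<And>c x. x \<in> qcar V \<Longrightarrow> qsmul V c x \<in> qcar V"
    and vspace_diff: "\<And>x y. x \<in> qcar V \<Longrightarrow> y \<in> qcar V \<Longrightarrow> qdiff V x y \<in> qcar V"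
    and vspace_assoc: "\<And>x y z. x \<in> qcar V \<Longrightarrow> y \<in> qcar V \<Longrightarrow> z \<in> qcar V \<Longrightarrow>
          qadd V (qadd V x y) z = qadd V x (qadd V y z)"
    and vspace_comm: "\<And>x y. x \<in> qcar V \<Longrightarrow> y \<in> qcar V \<Longrightarrow> qadd V x y = qadd V y x"
    and vspace_zero_left: "\<And>x. x \<in> qcar V \<Longrightarrow> qadd V (qzero V) x = x"
    and vspace_diff_self: "\<And>x. x \<in> qcar V \<Longrightarrow> qdiff V x x = qzero V"
    and vspace_smul_add: "\<And>c x y. x \<in> qcar V \<Longrightarrow> y \<in> qcar V \<Longrightarrow>
          qsmul V c (qadd V x y) = qadd V (qsmul V c x) (qsmul V c y)"
    and vspace_add_smul: "\<And>c d x. x \<in> qcar V \<Longrightarrow>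
          qsmul V (c + d) x = qadd V (qsmul V c x) (qsmul V d x)"
    and vspace_smul_smul: "\<And>c d x. x \<in> qcar V \<Longrightarrow> qsmul V (c * d) x = qsmul V c (qsmul V d x)"
    and vspace_one: "\<And>x. x \<in> qcar V \<Longrightarrow> qsmul V 1 x = x"
  using assms unfolding vspace_def by (auto simp: qdiff_def)

lemma vspace_zero_right: "vspace V \<Longrightarrow> x \<in> qcar V \<Longrightarrow> qadd V x (qzero V) = x"
  using vspace_comm vspace_zero vspace_zero_left by metis

lemma vspace_smul_0: "vspace V \<Longrightarrow> x \<in> qcar V \<Longrightarrow> qsmul V 0 x = qzero V"
  using vspace_add_smul[of V x 1 "- 1"] vspace_one[of V x] vspace_diff_self[of V x]
  by (simp add: qdiff_def)

lemma vspace_smul_zero: "vspace V \<Longrightarrow> qsmul V c (qzero V) = qzero V"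
  using vspace_smul_smul[of V "qzero V" c 0] vspace_smul_0[of V "qzero V"] vspace_zero[of V]
  by simp

lemma vspace_diff_zero: "vspace V \<Longrightarrow> x \<in> qcar V \<Longrightarrow> qdiff V x (qzero V) = x"
  by (simp add: qdiff_def vspace_smul_zero vspace_zero_right)

lemma vspace_left_comm:
  "vspace V \<Longrightarrow> x \<in> qcar V \<Longrightarrow> y \<in> qcar V \<Longrightarrow> z \<in> qcar V \<Longrightarrow>
    qadd V x (qadd V y z) = qadd V y (qadd V x z)"
  by (metis vspace_assoc vspace_comm)

lemma vspace_add_diff_cancel:
  assumes "vspace V" "x \<in> qcar V" "y \<in> qcar V"
  shows "qadd V y (qdiff V x y) = x" "qadd V (qdiff V x y) y = x"
proof -
  have "qadd V y (qdiff V x y) = qadd V x (qdiff V y y)"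
    using assms unfolding qdiff_def by (intro vspace_left_comm vspace_smul)
  then show *: "qadd V y (qdiff V x y) = x"
    using assms by (simp add: vspace_diff_self vspace_zero_right)
  show "qadd V (qdiff V x y) y = x"
    using * assms by (simp add: vspace_comm vspace_diff)
qed

lemma vspace_diff_eq_zero:
  assumes "vspace V" "x \<in> qcar V" "y \<in> qcar V"
  shows "qdiff V x y = qzero V \<longleftrightarrow> x = y"
  using vspace_add_diff_cancel(1)[OF assms] vspace_zero_right[OF assms(1,3)]
    vspace_diff_self[OF assms(1,2)] by metis

lemma vspace_add_diff_add:
  assumes "vspace V" "a \<in> qcar V" "b \<in> qcar V" "c \<in> qcar V" "d \<in> qcar V"
  shows "qdiff V (qadd V a b) (qadd V c d) = qadd V (qdiff V a c) (qdiff V b d)"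
  using assms by (simp add: qdiff_def vspace_smul_add vspace_assoc vspace_left_comm vspace_smul vspace_add)

lemma vspace_diff_split:
  assumes "vspace V" "x \<in> qcar V" "y \<in> qcar V" "z \<in> qcar V"
  shows "qdiff V x z = qadd V (qdiff V x y) (qdiff V y z)"
proof -
  have "qadd V (qdiff V x y) (qdiff V y z) = qadd V (qadd V (qdiff V x y) y) (qsmul V (- 1) z)"
    using assms unfolding qdiff_def[of V y z] by (simp add: vspace_assoc vspace_diff vspace_smul)
  then show ?thesis
    using assms by (simp add: vspace_add_diff_cancel) (simp add: qdiff_def)
qed

lemma vspace_smul_diff:
  assumes "vspace V" "x \<in> qcar V" "y \<in> qcar V"
  shows "qsmul V c (qdiff V x y) = qdiff V (qsmul V c x) (qsmul V c y)"
  using assms vspace_smul_smul[of V y c "- 1"] vspace_smul_smul[of V y "- 1" c]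
  by (simp add: qdiff_def vspace_smul_add vspace_smul)

lemma vspace_diff_swap:
  assumes "vspace V" "x \<in> qcar V" "y \<in> qcar V"
  shows "qdiff V y x = qsmul V (- 1) (qdiff V x y)"
  using assms vspace_smul_smul[of V y "- 1" "- 1"]
  by (simp add: qdiff_def vspace_smul_add vspace_smul vspace_one vspace_comm)

lemma vspace_diff_add_self:
  assumes "vspace V" "x \<in> qcar V" "y \<in> qcar V"
  shows "qdiff V (qadd V x y) x = y"
  using vspace_add_diff_add[of V x y x "qzero V"] assms
  by (simp add: vspace_zero vspace_zero_right vspace_diff_self vspace_diff_zero vspace_zero_left)

lemma vspace_diff_diff_self:
  assumes "vspace V" "x \<in> qcar V" "y \<in> qcar V"
  shows "qdiff V x (qdiff V x y) = y"
  using vspace_diff_add_self[of V "qdiff V x y" y] vspace_add_diff_cancel(2)[of V x y] assms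
  by (simp add: vspace_diff)

lemma quasinormedD:
  assumes "quasinormed V"
  shows quasinormed_vspace: "vspace V"
    and qnorm_nonneg: "\<And>x. x \<in> qcar V \<Longrightarrow> 0 \<le> qnorm V x"
    and qnorm_eq_0: "\<And>x. x \<in> qcar V \<Longrightarrow> qnorm V x = 0 \<longleftrightarrow> x = qzero V"
    and qnorm_smul: "\<And>c x. x \<in> qcar V \<Longrightarrow> qnorm V (qsmul V c x) = norm c * qnorm V x"
  using assms unfolding quasinormed_def by auto

lemma quasi_banach_quasinormed: "quasi_banach V \<Longrightarrow> quasinormed V"
  by (simp add: quasi_banach_def)

lemma quasi_banach_vspace: "quasi_banach V \<Longrightarrow> vspace V"
  by (simp add: quasi_banach_def quasinormed_def)

lemma quasi_banach_complete:
  assumes "quasi_banach V" "qCauchy V s"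
  obtains x where "x \<in> qcar V" "qlim V s x"
  using assms by (auto simp: quasi_banach_def)

text \<open>\<open>quasinormed\<close> only asserts some real constant. Choosing one that is at
  least 1 makes it positive, so that estimates can be multiplied and divided by it.\<close>

definition qmodulus :: "('k::real_normed_field, 'a) qspace \<Rightarrow> real" where
  "qmodulus V = (SOME C. 1 \<le> C \<and>
     (\<forall>x\<in>qcar V. \<forall>y\<in>qcar V. qnorm V (qadd V x y) \<le> C * (qnorm V x + qnorm V y)))"

lemma
  assumes "quasinormed V"
  shows qmodulus_ge_1: "1 \<le> qmodulus V"
    and qnorm_add_le: "\<And>x y. x \<in> qcar V \<Longrightarrow> y \<in> qcar V \<Longrightarrow>
          qnorm V (qadd V x y) \<le> qmodulus V * (qnorm V x + qnorm V y)"
proof -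
  obtain C where C: "\<forall>x\<in>qcar V. \<forall>y\<in>qcar V. qnorm V (qadd V x y) \<le> C * (qnorm V x + qnorm V y)"
    using assms unfolding quasinormed_def by blast
  have "C * (qnorm V x + qnorm V y) \<le> max 1 C * (qnorm V x + qnorm V y)"
    if "x \<in> qcar V" "y \<in> qcar V" for x y
    using that assms by (intro mult_right_mono add_nonneg_nonneg qnorm_nonneg) auto
  then have "\<exists>C. 1 \<le> C \<and>
     (\<forall>x\<in>qcar V. \<forall>y\<in>qcar V. qnorm V (qadd V x y) \<le> C * (qnorm V x + qnorm V y))"
    using C by (intro exI[of _ "max 1 C"]) (simp, meson order_trans)
  from someI_ex[OF this] show "1 \<le> qmodulus V"
    "\<And>x y. x \<in> qcar V \<Longrightarrow> y \<in> qcar V \<Longrightarrow> qnorm V (qadd V x y) \<le> qmodulus V * (qnorm V x + qnorm V y)"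
    unfolding qmodulus_def by auto
qed

lemma qmodulus_pos: "quasinormed V \<Longrightarrow> 0 < qmodulus V"
  using qmodulus_ge_1[of V] by simp

lemma qnorm_zero: "quasinormed V \<Longrightarrow> qnorm V (qzero V) = 0"
  by (simp add: qnorm_eq_0 quasinormed_vspace vspace_zero)

lemma qnorm_diff_nonneg:
  "quasinormed V \<Longrightarrow> x \<in> qcar V \<Longrightarrow> y \<in> qcar V \<Longrightarrow> 0 \<le> qnorm V (qdiff V x y)"
  by (simp add: qnorm_nonneg quasinormed_vspace vspace_diff)

lemma qnorm_diff_eq_0:
  "quasinormed V \<Longrightarrow> x \<in> qcar V \<Longrightarrow> y \<in> qcar V \<Longrightarrow> qnorm V (qdiff V x y) = 0 \<longleftrightarrow> x = y"
  by (simp add: qnorm_eq_0 quasinormed_vspace vspace_diff vspace_diff_eq_zero)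

lemma qnorm_diff_commute:
  "quasinormed V \<Longrightarrow> x \<in> qcar V \<Longrightarrow> y \<in> qcar V \<Longrightarrow> qnorm V (qdiff V x y) = qnorm V (qdiff V y x)"
  by (subst vspace_diff_swap) (auto simp: quasinormed_vspace vspace_diff qnorm_smul)

lemma qnorm_diff_triangle:
  assumes "quasinormed V" "x \<in> qcar V" "y \<in> qcar V" "z \<in> qcar V"
  shows "qnorm V (qdiff V x z) \<le> qmodulus V * (qnorm V (qdiff V x y) + qnorm V (qdiff V y z))"
  using assms by (subst vspace_diff_split[of V x y z])
    (auto intro!: qnorm_add_le simp: quasinormed_vspace vspace_diff)

lemma qnorm_le_diff:
  assumes "quasinormed V" "x \<in> qcar V" "y \<in> qcar V"
  shows "qnorm V x \<le> qmodulus V * (qnorm V (qdiff V x y) + qnorm V y)"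
  using qnorm_diff_triangle[OF assms vspace_zero[of V]] assms
  by (simp add: quasinormed_vspace vspace_diff_zero)

lemma qnorm_add_diff_add:
  assumes "quasinormed V" "a \<in> qcar V" "b \<in> qcar V" "c \<in> qcar V" "d \<in> qcar V"
  shows "qnorm V (qdiff V (qadd V a b) (qadd V c d))
    \<le> qmodulus V * (qnorm V (qdiff V a c) + qnorm V (qdiff V b d))"
  using assms by (subst vspace_add_diff_add)
    (auto intro!: qnorm_add_le simp: quasinormed_vspace vspace_diff)

lemma qnorm_smul_diff_smul:
  assumes "quasinormed V" "a \<in> qcar V" "b \<in> qcar V"
  shows "qnorm V (qdiff V (qsmul V c a) (qsmul V c b)) = norm c * qnorm V (qdiff V a b)"
  using assms by (simp add: vspace_smul_diff[symmetric] quasinormed_vspace vspace_diff qnorm_smul)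

text \<open>Homogeneity at the scalar 0 already gives \<open>qnorm V (qzero V) = 0\<close>, so only
  the converse has to be supplied.\<close>

lemma quasinormedI:
  fixes V :: "('k::real_normed_field, 'a) qspace"
  assumes "vspace V"
    and "\<And>x. x \<in> qcar V \<Longrightarrow> 0 \<le> qnorm V x"
    and "\<And>x. x \<in> qcar V \<Longrightarrow> qnorm V x = 0 \<Longrightarrow> x = qzero V"
    and "\<And>c x. x \<in> qcar V \<Longrightarrow> qnorm V (qsmul V c x) = norm c * qnorm V x"
    and "\<And>x y. x \<in> qcar V \<Longrightarrow> y \<in> qcar V \<Longrightarrow> qnorm V (qadd V x y) \<le> C * (qnorm V x + qnorm V y)"
  shows "quasinormed V"
proof -
  have "qnorm V (qzero V) = 0"
    using assms(4)[OF vspace_zero[OF assms(1)], of 0] vspace_smul_zero[OF assms(1), of 0] by simp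
  then show ?thesis
    unfolding quasinormed_def using assms by blast
qed

section \<open>Null families, limits and Cauchy sequences\<close>

lemma tendsto_0_quasi_triangle:
  fixes f g h :: "'a \<Rightarrow> real"
  assumes "(g \<longlongrightarrow> 0) F" "(h \<longlongrightarrow> 0) F"
    and "\<And>p. 0 \<le> f p" and "\<And>p. f p \<le> C * (g p + h p)"
  shows "(f \<longlongrightarrow> 0) F"
proof (rule tendsto_sandwich[where f = "\<lambda>_. 0"])
  show "((\<lambda>p. C * (g p + h p)) \<longlongrightarrow> 0) F"
    using tendsto_mult_right_zero[OF tendsto_add_zero[OF assms(1,2)]] .
qed (use assms in auto)

text \<open>As a single limit along a product filter, the Cauchy condition comes within reach of
  \<open>tendsto_0_quasi_triangle\<close>, which is stated for arbitrary filters for this purpose.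
  Stability of Cauchy sequences is then proved like stability of limits.\<close>

lemma qCauchy_iff_tendsto:
  assumes V: "quasinormed V"
  shows "qCauchy V s \<longleftrightarrow> range s \<subseteq> qcar V \<and>
    ((\<lambda>p. qnorm V (qdiff V (s (fst p)) (s (snd p)))) \<longlongrightarrow> 0) (sequentially \<times>\<^sub>F sequentially)"
proof (cases "range s \<subseteq> qcar V")
  case True
  then have [simp]: "\<bar>qnorm V (qdiff V (s m) (s n))\<bar> = qnorm V (qdiff V (s m) (s n))" for m n
    using qnorm_diff_nonneg[OF V, of "s m" "s n"] by (simp add: range_subsetD)
  have "qnorm V (qdiff V (s m) (s n)) = qnorm V (qdiff V (s n) (s m))" for m n
    using True by (intro qnorm_diff_commute V) auto
  then show ?thesis
    using True by (simp add: qCauchy_def tendsto_iff eventually_prod_sequentially)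
qed (simp add: qCauchy_def)

lemma qCauchy_in: "qCauchy V s \<Longrightarrow> s n \<in> qcar V"
  by (auto simp: qCauchy_def)

lemma qlim_unique:
  assumes V: "quasinormed V" and s: "\<And>n. s n \<in> qcar V" and x: "x \<in> qcar V" "y \<in> qcar V"
    and l: "qlim V s x" "qlim V s y"
  shows "x = y"
proof -
  have "(\<lambda>n::nat. qnorm V (qdiff V x y)) \<longlonglongrightarrow> 0"
    using l unfolding qlim_def
    by (rule tendsto_0_quasi_triangle[where C = "qmodulus V"])
      (use V s x qnorm_diff_triangle[OF V x(1) s x(2)] qnorm_diff_commute[OF V x(1) s] in
        \<open>auto simp: qnorm_diff_nonneg\<close>)
  then show ?thesis
    using V x by (simp add: LIMSEQ_const_iff qnorm_diff_eq_0)
qed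

lemma qlim_const: "quasinormed V \<Longrightarrow> x \<in> qcar V \<Longrightarrow> qlim V (\<lambda>_. x) x"
  by (simp add: qlim_def vspace_diff_self quasinormed_vspace qnorm_zero)

lemma qlim_add:
  assumes V: "quasinormed V" and "\<And>n. s n \<in> qcar V" "\<And>n. t n \<in> qcar V" "x \<in> qcar V" "y \<in> qcar V"
    and l: "qlim V s x" "qlim V t y"
  shows "qlim V (\<lambda>n. qadd V (s n) (t n)) (qadd V x y)"
  using l unfolding qlim_def
  by (rule tendsto_0_quasi_triangle[where C = "qmodulus V"])
    (use assms in \<open>auto intro!: qnorm_add_diff_add qnorm_diff_nonneg vspace_add simp: quasinormed_vspace\<close>)

lemma qlim_smul:
  assumes V: "quasinormed V" and "\<And>n. s n \<in> qcar V" "x \<in> qcar V" and l: "qlim V s x"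
  shows "qlim V (\<lambda>n. qsmul V c (s n)) (qsmul V c x)"
  using tendsto_mult_right_zero[OF l[unfolded qlim_def], of "norm c"] assms
  by (simp add: qlim_def qnorm_smul_diff_smul)

lemma qlim_equiv:
  assumes V: "quasinormed V" and "\<And>n. s n \<in> qcar V" "\<And>n. t n \<in> qcar V" "x \<in> qcar V"
    and l: "qlim V s x" "(\<lambda>n. qnorm V (qdiff V (t n) (s n))) \<longlonglongrightarrow> 0"
  shows "qlim V t x"
  using l(2) l(1)[unfolded qlim_def] unfolding qlim_def
  by (rule tendsto_0_quasi_triangle[where C = "qmodulus V"])
    (use assms in \<open>auto intro!: qnorm_diff_triangle qnorm_diff_nonneg\<close>)

lemma qlim_qCauchy:
  assumes V: "quasinormed V" and s: "\<And>n. s n \<in> qcar V" and x: "x \<in> qcar V" and l: "qlim V s x"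
  shows "qCauchy V s"
  unfolding qCauchy_iff_tendsto[OF V]
proof
  show "((\<lambda>p. qnorm V (qdiff V (s (fst p)) (s (snd p)))) \<longlongrightarrow> 0) (sequentially \<times>\<^sub>F sequentially)"
  proof (rule tendsto_0_quasi_triangle)
    show "((\<lambda>p. qnorm V (qdiff V (s (fst p)) x)) \<longlongrightarrow> 0) (sequentially \<times>\<^sub>F sequentially)"
      using l unfolding qlim_def by (rule filterlim_compose[OF _ filterlim_fst])
    show "((\<lambda>p. qnorm V (qdiff V x (s (snd p)))) \<longlongrightarrow> 0) (sequentially \<times>\<^sub>F sequentially)"
      using l unfolding qlim_def qnorm_diff_commute[OF V x s]
      by (rule filterlim_compose[OF _ filterlim_snd])
  qed (use V s x in \<open>auto intro: qnorm_diff_triangle qnorm_diff_nonneg\<close>)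
qed (use s in auto)

text \<open>A quasinorm is not continuous, so the limit may be larger by the modulus.\<close>

lemma qlim_qnorm_le:
  assumes V: "quasinormed V" and s: "\<And>n. s n \<in> qcar V" and x: "x \<in> qcar V" and l: "qlim V s x"
    and r: "\<And>n. qnorm V (s n) \<le> r"
  shows "qnorm V x \<le> qmodulus V * r"
proof (rule tendsto_lowerbound)
  show "(\<lambda>n. qmodulus V * (qnorm V (qdiff V (s n) x) + r)) \<longlonglongrightarrow> qmodulus V * r"
    using l unfolding qlim_def by (auto intro!: tendsto_eq_intros)
  have "qnorm V x \<le> qmodulus V * (qnorm V (qdiff V (s n) x) + r)" for n
    using qnorm_le_diff[OF V x s[of n]] qnorm_diff_commute[OF V x s[of n]] r[of n] qmodulus_pos[OF V]
    by (smt (verit) mult_left_mono)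
  then show "\<forall>\<^sub>F n in sequentially. qnorm V x \<le> qmodulus V * (qnorm V (qdiff V (s n) x) + r)"
    by simp
qed simp

lemma qCauchy_add:
  assumes V: "quasinormed V" and s: "qCauchy V s" "qCauchy V t"
  shows "qCauchy V (\<lambda>n. qadd V (s n) (t n))"
  unfolding qCauchy_iff_tendsto[OF V]
proof
  note in_V = qCauchy_in[OF s(1)] qCauchy_in[OF s(2)]
  show "range (\<lambda>n. qadd V (s n) (t n)) \<subseteq> qcar V"
    using in_V V by (auto intro: vspace_add simp: quasinormed_vspace)
  show "((\<lambda>p. qnorm V (qdiff V (qadd V (s (fst p)) (t (fst p))) (qadd V (s (snd p)) (t (snd p)))))
      \<longlongrightarrow> 0) (sequentially \<times>\<^sub>F sequentially)"
    using s[unfolded qCauchy_iff_tendsto[OF V], THEN conjunct2]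
    by (rule tendsto_0_quasi_triangle[where C = "qmodulus V"])
      (use in_V V in \<open>auto intro!: qnorm_add_diff_add qnorm_diff_nonneg vspace_add simp: quasinormed_vspace\<close>)
qed

lemma qCauchy_smul:
  assumes V: "quasinormed V" and s: "qCauchy V s"
  shows "qCauchy V (\<lambda>n. qsmul V c (s n))"
  using tendsto_mult_right_zero[OF s[unfolded qCauchy_iff_tendsto[OF V], THEN conjunct2], of "norm c"]
    qCauchy_in[OF s] V
  unfolding qCauchy_iff_tendsto[OF V]
  by (auto simp: qnorm_smul_diff_smul intro: vspace_smul quasinormed_vspace)

lemma qCauchy_equiv:
  assumes V: "quasinormed V" and s: "qCauchy V s" and t: "\<And>n. t n \<in> qcar V"
    and st: "(\<lambda>n. qnorm V (qdiff V (t n) (s n))) \<longlonglongrightarrow> 0"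
  shows "qCauchy V t"
  unfolding qCauchy_iff_tendsto[OF V]
proof
  note in_V = qCauchy_in[OF s] t
  have 1: "((\<lambda>p. qnorm V (qdiff V (t (fst p)) (s (fst p)))) \<longlongrightarrow> 0) (sequentially \<times>\<^sub>F sequentially)"
    using st by (rule filterlim_compose[OF _ filterlim_fst])
  have 2: "((\<lambda>p. qnorm V (qdiff V (s (snd p)) (t (snd p)))) \<longlongrightarrow> 0) (sequentially \<times>\<^sub>F sequentially)"
    using st unfolding qnorm_diff_commute[OF V in_V(1,2)]
    by (rule filterlim_compose[OF _ filterlim_snd])
  have 3: "((\<lambda>p. qnorm V (qdiff V (s (fst p)) (t (snd p)))) \<longlongrightarrow> 0) (sequentially \<times>\<^sub>F sequentially)"
    using s[unfolded qCauchy_iff_tendsto[OF V], THEN conjunct2] 2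
    by (rule tendsto_0_quasi_triangle[where C = "qmodulus V"])
      (use in_V V in \<open>auto intro!: qnorm_diff_triangle qnorm_diff_nonneg\<close>)
  show "((\<lambda>p. qnorm V (qdiff V (t (fst p)) (t (snd p)))) \<longlongrightarrow> 0) (sequentially \<times>\<^sub>F sequentially)"
    using 1 3
    by (rule tendsto_0_quasi_triangle[where C = "qmodulus V"])
      (use in_V V in \<open>auto intro!: qnorm_diff_triangle qnorm_diff_nonneg\<close>)
qed (use t in auto)

lemma qCauchy_const: "quasinormed V \<Longrightarrow> x \<in> qcar V \<Longrightarrow> qCauchy V (\<lambda>_. x)"
  by (rule qlim_qCauchy[OF _ _ _ qlim_const])

section \<open>Operators\<close>

lemma qlinearD:
  assumes "qlinear V W f"
  shows qlinear_in: "\<And>x. x \<in> qcar V \<Longrightarrow> f x \<in> qcar W"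
    and qlinear_add: "\<And>x y. x \<in> qcar V \<Longrightarrow> y \<in> qcar V \<Longrightarrow> f (qadd V x y) = qadd W (f x) (f y)"
    and qlinear_smul: "\<And>c x. x \<in> qcar V \<Longrightarrow> f (qsmul V c x) = qsmul W c (f x)"
  using assms unfolding qlinear_def by auto

lemma qlinear_diff:
  assumes "qlinear V W f" "vspace V" "x \<in> qcar V" "y \<in> qcar V"
  shows "f (qdiff V x y) = qdiff W (f x) (f y)"
  using assms by (simp add: qdiff_def qlinear_add qlinear_smul vspace_smul)

lemma qlinear_zero:
  assumes "qlinear V W f" "vspace V" "vspace W"
  shows "f (qzero V) = qzero W"
  using qlinear_smul[OF assms(1) vspace_zero[OF assms(2)], of 0] vspace_smul_zero[OF assms(2)]
    vspace_smul_0[OF assms(3) qlinear_in[OF assms(1) vspace_zero[OF assms(2)]]] by simp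

lemma qoperator_qlinear: "qoperator V W f \<Longrightarrow> qlinear V W f"
  by (simp add: qoperator_def)

lemmas qoperator_in = qlinear_in[OF qoperator_qlinear]

lemma qoperator_bound:
  assumes "qoperator V W f" "quasinormed V"
  obtains C where "0 \<le> C" "\<And>x. x \<in> qcar V \<Longrightarrow> qnorm W (f x) \<le> C * qnorm V x"
proof -
  obtain C where C: "\<forall>x\<in>qcar V. qnorm W (f x) \<le> C * qnorm V x"
    using assms unfolding qoperator_def by blast
  have "qnorm W (f x) \<le> max 0 C * qnorm V x" if "x \<in> qcar V" for x
    using C that qnorm_nonneg[OF assms(2) that] by (smt (verit) mult_right_mono)
  then show ?thesis
    using that[of "max 0 C"] by auto
qed

lemma qoperatorI:
  assumes "\<And>x. x \<in> qcar V \<Longrightarrow> f x \<in> qcar W"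
    and "\<And>x y. x \<in> qcar V \<Longrightarrow> y \<in> qcar V \<Longrightarrow> f (qadd V x y) = qadd W (f x) (f y)"
    and "\<And>c x. x \<in> qcar V \<Longrightarrow> f (qsmul V c x) = qsmul W c (f x)"
    and "\<And>x. x \<in> qcar V \<Longrightarrow> qnorm W (f x) \<le> C * qnorm V x"
  shows "qoperator V W f"
  using assms unfolding qoperator_def qlinear_def by blast

lemma qoperator_comp:
  assumes f: "qoperator V W f" and g: "qoperator W U g" and "quasinormed V" "quasinormed W"
  shows "qoperator V U (\<lambda>x. g (f x))"
proof -
  obtain A where A: "0 \<le> A" "\<And>x. x \<in> qcar V \<Longrightarrow> qnorm W (f x) \<le> A * qnorm V x"
    using qoperator_bound[OF f] assms by blast
  obtain B where B: "0 \<le> B" "\<And>x. x \<in> qcar W \<Longrightarrow> qnorm U (g x) \<le> B * qnorm W x"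
    using qoperator_bound[OF g] assms by blast
  show ?thesis
  proof (rule qoperatorI)
    fix x assume x: "x \<in> qcar V"
    have "qnorm U (g (f x)) \<le> B * qnorm W (f x)"
      using B x f by (simp add: qoperator_in)
    also have "\<dots> \<le> B * (A * qnorm V x)"
      using A B x by (simp add: mult_left_mono)
    finally show "qnorm U (g (f x)) \<le> (B * A) * qnorm V x"
      by (simp add: mult.assoc)
  qed (use f g in \<open>auto simp: qoperator_def qlinear_def image_subset_iff\<close>)
qed

lemma qoperator_id: "qoperator V V (\<lambda>x. x)"
  by (rule qoperatorI[where C = 1]) auto

lemma qoperator_zero:
  assumes "quasinormed V" "quasinormed W"
  shows "qoperator V W (\<lambda>_. qzero W)"
  by (rule qoperatorI[where C = 0])
    (use assms in \<open>auto simp: quasinormed_vspace vspace_zero vspace_zero_left vspace_smul_zero qnorm_zero\<close>)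

text \<open>The arbitrary filter lets one argument give both the preservation of limits and the
  preservation of Cauchy sequences.\<close>

lemma qoperator_tendsto_0:
  assumes V: "quasinormed V" "quasinormed W" and f: "qoperator V W f"
    and s: "\<And>p. s p \<in> qcar V" "\<And>p. t p \<in> qcar V"
    and l: "((\<lambda>p. qnorm V (qdiff V (s p) (t p))) \<longlongrightarrow> 0) F"
  shows "((\<lambda>p. qnorm W (qdiff W (f (s p)) (f (t p)))) \<longlongrightarrow> 0) F"
proof -
  obtain C where C: "0 \<le> C" "\<And>x. x \<in> qcar V \<Longrightarrow> qnorm W (f x) \<le> C * qnorm V x"
    using qoperator_bound[OF f V(1)] by blast
  have "qnorm W (qdiff W (f (s p)) (f (t p))) \<le> C * (qnorm V (qdiff V (s p) (t p)) + 0)" for p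
    using C(2)[of "qdiff V (s p) (t p)"] s f V
      qlinear_diff[OF qoperator_qlinear[OF f] quasinormed_vspace[OF V(1)] s(1)[of p] s(2)[of p]]
    by (simp add: quasinormed_vspace vspace_diff)
  from l tendsto_const[of 0] _ this show ?thesis
    by (rule tendsto_0_quasi_triangle)
      (use V s in \<open>auto intro!: qnorm_diff_nonneg qoperator_in[OF f]\<close>)
qed

lemma qoperator_qlim:
  assumes "quasinormed V" "quasinormed W" "qoperator V W f"
    and "\<And>n. s n \<in> qcar V" "x \<in> qcar V" "qlim V s x"
  shows "qlim W (\<lambda>n. f (s n)) (f x)"
  unfolding qlim_def
  by (rule qoperator_tendsto_0[OF assms(1-4) _ assms(6)[unfolded qlim_def]]) (rule assms(5))

lemma qoperator_qCauchy:
  assumes V: "quasinormed V" "quasinormed W" "qoperator V W f" and s: "qCauchy V s"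
  shows "qCauchy W (\<lambda>n. f (s n))"
  unfolding qCauchy_iff_tendsto[OF V(2)]
proof
  show "((\<lambda>p. qnorm W (qdiff W (f (s (fst p))) (f (s (snd p))))) \<longlongrightarrow> 0)
      (sequentially \<times>\<^sub>F sequentially)"
    using s[unfolded qCauchy_iff_tendsto[OF V(1)], THEN conjunct2]
    by (rule qoperator_tendsto_0[OF V qCauchy_in[OF s] qCauchy_in[OF s]])
qed (use qCauchy_in[OF s] qoperator_in[OF V(3)] in blast)

section \<open>Completions\<close>

lemma cclass_self: "quasinormed V \<Longrightarrow> qCauchy V s \<Longrightarrow> s \<in> cclass V s"
  by (simp add: cclass_def qCauchy_in vspace_diff_self quasinormed_vspace qnorm_zero)

lemma cclass_eqI:
  assumes V: "quasinormed V" and s: "qCauchy V s" "qCauchy V t"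
    and st: "(\<lambda>n. qnorm V (qdiff V (s n) (t n))) \<longlonglongrightarrow> 0"
  shows "cclass V s = cclass V t"
proof -
  have *: "cclass V s \<subseteq> cclass V t"
    if s: "qCauchy V s" "qCauchy V t" and st: "(\<lambda>n. qnorm V (qdiff V (t n) (s n))) \<longlonglongrightarrow> 0" for s t
  proof
    fix u assume u: "u \<in> cclass V s"
    then have u_in: "qCauchy V u" and su: "(\<lambda>n. qnorm V (qdiff V (s n) (u n))) \<longlonglongrightarrow> 0"
      by (auto simp: cclass_def)
    from st su have "(\<lambda>n. qnorm V (qdiff V (t n) (u n))) \<longlonglongrightarrow> 0"
      by (rule tendsto_0_quasi_triangle[where C = "qmodulus V"])
        (use V qCauchy_in[OF u_in] qCauchy_in[OF s(1)] qCauchy_in[OF s(2)] in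
          \<open>auto intro!: qnorm_diff_triangle qnorm_diff_nonneg\<close>)
    with u_in show "u \<in> cclass V t"
      by (simp add: cclass_def)
  qed
  have "(\<lambda>n. qnorm V (qdiff V (t n) (s n))) \<longlonglongrightarrow> 0"
    using st qnorm_diff_commute[OF V qCauchy_in[OF s(1)] qCauchy_in[OF s(2)]] by simp
  then show ?thesis
    using *[OF s] *[OF s(2,1) st] by blast
qed

lemma cclass_eq_iff:
  assumes V: "quasinormed V" and s: "qCauchy V s" "qCauchy V t"
  shows "cclass V s = cclass V t \<longleftrightarrow> (\<lambda>n. qnorm V (qdiff V (s n) (t n))) \<longlonglongrightarrow> 0"
proof
  assume "cclass V s = cclass V t"
  then have "t \<in> cclass V s"
    using cclass_self[OF V s(2)] by simp
  then show "(\<lambda>n. qnorm V (qdiff V (s n) (t n))) \<longlonglongrightarrow> 0"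
    by (simp add: cclass_def)
qed (rule cclass_eqI[OF assms])

lemma cclass_in: "qCauchy V s \<Longrightarrow> cclass V s \<in> qcar (completion V)"
  by (simp add: completion_def)

lemma completion_mem:
  assumes V: "quasinormed V" and A: "A \<in> qcar (completion V)" and s: "s \<in> A"
  shows "qCauchy V s" "A = cclass V s"
proof -
  obtain t where t: "qCauchy V t" "A = cclass V t"
    using A by (auto simp: completion_def)
  with s show "qCauchy V s"
    by (simp add: cclass_def)
  with s t show "A = cclass V s"
    using cclass_eqI[OF V t(1), of s] by (simp add: cclass_def)
qed

lemma crep_in:
  assumes "quasinormed V" "A \<in> qcar (completion V)"
  shows "crep A \<in> A"
proof -
  obtain s where "s \<in> A"
    using assms cclass_self[OF assms(1)] by (auto simp: completion_def)
  then show ?thesis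
    unfolding crep_def by (rule someI[of "\<lambda>s. s \<in> A"])
qed

lemma completion_cases:
  assumes "quasinormed V" "A \<in> qcar (completion V)"
  obtains s where "qCauchy V s" "A = cclass V s"
  using completion_mem[OF assms crep_in[OF assms]] by blast

text \<open>The definition adds the representatives picked by \<open>crep\<close>; any other choice
  changes the sum by a null sequence. Computations can therefore be made with arbitrary
  representatives.\<close>

lemma completion_add:
  assumes V: "quasinormed V" and s: "qCauchy V s" "qCauchy V t"
  shows "qadd (completion V) (cclass V s) (cclass V t) = cclass V (\<lambda>n. qadd V (s n) (t n))"
proof -
  let ?s = "crep (cclass V s)" and ?t = "crep (cclass V t)"
  note r = completion_mem(1)[OF V cclass_in[OF s(1)] crep_in[OF V cclass_in[OF s(1)]]]
    completion_mem(1)[OF V cclass_in[OF s(2)] crep_in[OF V cclass_in[OF s(2)]]]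
  have null: "(\<lambda>n. qnorm V (qdiff V (s n) (?s n))) \<longlonglongrightarrow> 0" "(\<lambda>n. qnorm V (qdiff V (t n) (?t n))) \<longlonglongrightarrow> 0"
    using crep_in[OF V cclass_in[OF s(1)]] crep_in[OF V cclass_in[OF s(2)]] by (auto simp: cclass_def)
  have "(\<lambda>n. qnorm V (qdiff V (qadd V (s n) (t n)) (qadd V (?s n) (?t n)))) \<longlonglongrightarrow> 0"
    using null by (rule tendsto_0_quasi_triangle[where C = "qmodulus V"])
      (use V qCauchy_in[OF s(1)] qCauchy_in[OF s(2)] qCauchy_in[OF r(1)] qCauchy_in[OF r(2)] in
        \<open>auto intro!: qnorm_add_diff_add qnorm_diff_nonneg vspace_add simp: quasinormed_vspace\<close>)
  from cclass_eqI[OF V qCauchy_add[OF V s] qCauchy_add[OF V r] this] show ?thesis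
    by (simp add: completion_def)
qed

lemma completion_smul:
  assumes V: "quasinormed V" and s: "qCauchy V s"
  shows "qsmul (completion V) c (cclass V s) = cclass V (\<lambda>n. qsmul V c (s n))"
proof -
  let ?s = "crep (cclass V s)"
  note r = completion_mem(1)[OF V cclass_in[OF s] crep_in[OF V cclass_in[OF s]]]
  have null: "(\<lambda>n. qnorm V (qdiff V (s n) (?s n))) \<longlonglongrightarrow> 0"
    using crep_in[OF V cclass_in[OF s]] by (auto simp: cclass_def)
  have "(\<lambda>n. qnorm V (qdiff V (qsmul V c (s n)) (qsmul V c (?s n)))) \<longlonglongrightarrow> 0"
    using tendsto_mult_right_zero[OF null, of "norm c"]
    by (simp add: qnorm_smul_diff_smul[OF V qCauchy_in[OF s] qCauchy_in[OF r]])
  from cclass_eqI[OF V qCauchy_smul[OF V s] qCauchy_smul[OF V r] this] show ?thesis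
    by (simp add: completion_def)
qed

lemma completion_diff:
  assumes V: "quasinormed V" and s: "qCauchy V s" "qCauchy V t"
  shows "qdiff (completion V) (cclass V s) (cclass V t) = cclass V (\<lambda>n. qdiff V (s n) (t n))"
  by (simp add: qdiff_def completion_add completion_smul qCauchy_smul V s)

lemma completion_zero: "qzero (completion V) = cclass V (\<lambda>_. qzero V)"
  by (simp add: completion_def)

text \<open>Each axiom is checked on representatives, where it holds termwise.\<close>

lemma completion_vspace:
  assumes V: "quasinormed V"
  shows "vspace (completion V)"
proof -
  note W = quasinormed_vspace[OF V]
  note in_V = qCauchy_in vspace_add[OF W] vspace_smul[OF W]
  note reps = completion_cases[OF V]
  note eqs = completion_add[OF V] completion_smul[OF V] completion_diff[OF V] completion_zero
    qCauchy_add[OF V] qCauchy_smul[OF V] qCauchy_const[OF V vspace_zero[OF W]] cclass_in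
  note laws = vspace_zero_left[OF W] vspace_diff_self[OF W] vspace_smul_add[OF W]
    vspace_add_smul[OF W] vspace_smul_smul[OF W] vspace_one[OF W]
  show ?thesis
    unfolding vspace_def
  proof (intro conjI ballI allI)
    show "qzero (completion V) \<in> qcar (completion V)"
      by (simp add: eqs)
    fix A assume A: "A \<in> qcar (completion V)"
    obtain s where s: "qCauchy V s" "A = cclass V s"
      using A by (rule reps)
    show "qadd (completion V) (qzero (completion V)) A = A"
      "qdiff (completion V) A A = qzero (completion V)" "qsmul (completion V) 1 A = A"
      using s(1) by (simp_all add: s(2) eqs laws in_V)
    show "qsmul (completion V) c A \<in> qcar (completion V)"
      "qsmul (completion V) (c + d) A = qadd (completion V) (qsmul (completion V) c A) (qsmul (completion V) d A)"
      "qsmul (completion V) (c * d) A = qsmul (completion V) c (qsmul (completion V) d A)" for c d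
      using s(1) by (simp_all add: s(2) eqs laws in_V)
    fix B assume B: "B \<in> qcar (completion V)"
    obtain t where t: "qCauchy V t" "B = cclass V t"
      using B by (rule reps)
    show "qadd (completion V) A B \<in> qcar (completion V)"
      "qadd (completion V) A B = qadd (completion V) B A"
      using s(1) t(1) by (simp_all add: s(2) t(2) eqs in_V vspace_comm[OF W])
    show "qsmul (completion V) c (qadd (completion V) A B)
        = qadd (completion V) (qsmul (completion V) c A) (qsmul (completion V) c B)" for c
      using s(1) t(1) by (simp_all add: s(2) t(2) eqs in_V laws)
    fix C assume C: "C \<in> qcar (completion V)"
    obtain u where u: "qCauchy V u" "C = cclass V u"
      using C by (rule reps)
    show "qadd (completion V) (qadd (completion V) A B) C = qadd (completion V) A (qadd (completion V) B C)"
      using s(1) t(1) u(1) by (simp_all add: s(2) t(2) u(2) eqs in_V vspace_assoc[OF W])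
  qed
qed

section \<open>The quotient quasinorm of the completion\<close>

lemma qCauchy_shift:
  assumes V: "quasinormed V" and s: "qCauchy V s"
  shows "(\<lambda>n. s (n + N)) \<in> cclass V s"
proof -
  have "((\<lambda>p. qnorm V (qdiff V (s (fst p)) (s (snd p)))) \<longlongrightarrow> 0) (sequentially \<times>\<^sub>F sequentially)"
    using s qCauchy_iff_tendsto[OF V] by blast
  moreover have "filterlim (\<lambda>n. (n, n + N)) (sequentially \<times>\<^sub>F sequentially) sequentially"
    by (intro filterlim_Pair filterlim_ident filterlim_add_const_nat_at_top)
  ultimately have "((\<lambda>n. qnorm V (qdiff V (s n) (s (n + N)))) \<longlongrightarrow> 0) sequentially"
    using filterlim_compose by fastforce
  moreover have "qCauchy V (\<lambda>n. s (n + N))"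
    using s unfolding qCauchy_def by (auto) (meson trans_le_add1)
  ultimately show ?thesis
    by (simp add: cclass_def)
qed

lemma qCauchy_bounded:
  assumes V: "quasinormed V" and s: "qCauchy V s"
  obtains r where "\<forall>\<^sub>F n in sequentially. qnorm V (s n) \<le> r"
proof -
  obtain N where N: "\<forall>m\<ge>N. \<forall>n\<ge>N. qnorm V (qdiff V (s m) (s n)) < 1"
    using s unfolding qCauchy_def by (meson zero_less_one)
  have "qnorm V (s n) \<le> qmodulus V * (1 + qnorm V (s N))" if "n \<ge> N" for n
  proof -
    have "qnorm V (s n) \<le> qmodulus V * (qnorm V (qdiff V (s n) (s N)) + qnorm V (s N))"
      by (intro qnorm_le_diff V qCauchy_in[OF s])
    also have "\<dots> \<le> qmodulus V * (1 + qnorm V (s N))"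
      using N that qmodulus_pos[OF V] by (intro mult_left_mono) (auto intro: less_imp_le)
    finally show ?thesis .
  qed
  then show ?thesis
    using that by (auto simp: eventually_sequentially)
qed

text \<open>The real \<open>Inf\<close> obeys its usual laws only on nonempty sets that are bounded
  below; both conditions are secured here.\<close>

lemma completion_qnorm_set:
  assumes V: "quasinormed V" and A: "A \<in> qcar (completion V)"
  shows "{r. \<exists>s\<in>A. \<forall>n. qnorm V (s n) \<le> r} \<noteq> {}"
    and "\<And>r. r \<in> {r. \<exists>s\<in>A. \<forall>n. qnorm V (s n) \<le> r} \<Longrightarrow> 0 \<le> r"
proof -
  obtain s where s: "qCauchy V s" "A = cclass V s"
    using completion_cases[OF V A] .
  obtain r where "\<forall>\<^sub>F n in sequentially. qnorm V (s n) \<le> r"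
    using qCauchy_bounded[OF V s(1)] .
  then obtain N where N: "\<And>n. n \<ge> N \<Longrightarrow> qnorm V (s n) \<le> r"
    by (auto simp: eventually_sequentially)
  then have "\<exists>t\<in>A. \<forall>n. qnorm V (t n) \<le> r"
    using qCauchy_shift[OF V s(1), of N] s(2) by (meson le_add2)
  then show "{r. \<exists>s\<in>A. \<forall>n. qnorm V (s n) \<le> r} \<noteq> {}"
    by blast
  fix r assume "r \<in> {r. \<exists>s\<in>A. \<forall>n. qnorm V (s n) \<le> r}"
  then obtain t where "t \<in> A" "\<forall>n. qnorm V (t n) \<le> r"
    by blast
  then show "0 \<le> r"
    using qnorm_nonneg[OF V qCauchy_in[OF completion_mem(1)[OF V A], of t 0]]
    by (meson order_trans)
qed

lemma completion_qnorm_le: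
  assumes V: "quasinormed V" and s: "qCauchy V s" and r: "\<forall>\<^sub>F n in sequentially. qnorm V (s n) \<le> r"
  shows "qnorm (completion V) (cclass V s) \<le> r"
proof -
  obtain N where N: "\<And>n. n \<ge> N \<Longrightarrow> qnorm V (s n) \<le> r"
    using r by (auto simp: eventually_sequentially)
  \<comment> \<open>The infimum ranges over bounds valid at every index. Dropping the terms before
    \<open>N\<close> stays in the class and turns the eventual bound into such a bound.\<close>
  have "\<exists>t\<in>cclass V s. \<forall>n. qnorm V (t n) \<le> r"
    using qCauchy_shift[OF V s, of N] N by (meson le_add2)
  then have "Inf {r. \<exists>t\<in>cclass V s. \<forall>n. qnorm V (t n) \<le> r} \<le> r"
    using completion_qnorm_set(2)[OF V cclass_in[OF s]] by (intro cInf_lower bdd_belowI[of _ 0]) auto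
  then show ?thesis
    by (simp add: completion_def)
qed

lemma completion_qnorm_nonneg:
  assumes "quasinormed V" "A \<in> qcar (completion V)"
  shows "0 \<le> qnorm (completion V) A"
  using cInf_greatest[OF completion_qnorm_set[OF assms]] by (simp add: completion_def)

lemma completion_qnorm_approx:
  assumes "quasinormed V" "A \<in> qcar (completion V)" "qnorm (completion V) A < r"
  obtains s where "s \<in> A" "\<And>n. qnorm V (s n) \<le> r"
proof -
  have "Inf {r. \<exists>s\<in>A. \<forall>n. qnorm V (s n) \<le> r} < r"
    using assms(3) by (simp add: completion_def)
  from cInf_lessD[OF completion_qnorm_set(1)[OF assms(1,2)] this]
  obtain q s where q: "q < r" "s \<in> A" "\<And>n. qnorm V (s n) \<le> q"
    by blast
  show ?thesis
    by (rule that[OF q(2)]) (use q(1,3) in \<open>auto intro: order_trans less_imp_le\<close>)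
qed

text \<open>Some representative \<open>t\<close> is bounded by \<open>r\<close> throughout, and
  \<open>s\<close> eventually differs from it by less than \<open>r\<close>; the quasi triangle
  inequality turns \<open>r + r\<close> into the stated bound. Thus a small class has eventually
  small terms in every representative.\<close>

lemma completion_qnorm_eventually:
  assumes V: "quasinormed V" and s: "qCauchy V s" and r: "qnorm (completion V) (cclass V s) < r"
  shows "\<forall>\<^sub>F n in sequentially. qnorm V (s n) \<le> 2 * qmodulus V * r"
proof -
  obtain t where t: "t \<in> cclass V s" "\<And>n. qnorm V (t n) \<le> r"
    using completion_qnorm_approx[OF V cclass_in[OF s] r] by blast
  note t_in = completion_mem(1)[OF V cclass_in[OF s] t(1)]
  have "0 < r"
    using completion_qnorm_nonneg[OF V cclass_in[OF s]] r by simp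
  moreover have "(\<lambda>n. qnorm V (qdiff V (s n) (t n))) \<longlonglongrightarrow> 0"
    using t(1) by (simp add: cclass_def)
  ultimately have "\<forall>\<^sub>F n in sequentially. qnorm V (qdiff V (s n) (t n)) < r"
    using order_tendstoD(2) by blast
  then show ?thesis
  proof eventually_elim
    case (elim n)
    have "qnorm V (s n) \<le> qmodulus V * (qnorm V (qdiff V (s n) (t n)) + qnorm V (t n))"
      by (intro qnorm_le_diff V qCauchy_in[OF s] qCauchy_in[OF t_in])
    also have "\<dots> \<le> qmodulus V * (r + r)"
      using elim t(2)[of n] qmodulus_pos[OF V] by (intro mult_left_mono add_mono) auto
    finally show ?case
      by simp
  qed
qed

lemma completion_quasinormed:
  assumes V: "quasinormed V"
  shows "quasinormed (completion V)"
proof (rule quasinormedI)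
  let ?N = "qnorm (completion V)"
  note C = completion_vspace[OF V]
  show "vspace (completion V)"
    by (rule C)
  show "0 \<le> ?N A" if "A \<in> qcar (completion V)" for A
    using completion_qnorm_nonneg[OF V that] .
  show "A = qzero (completion V)" if A: "A \<in> qcar (completion V)" and N: "?N A = 0" for A
  proof -
    obtain s where s: "qCauchy V s" "A = cclass V s"
      using completion_cases[OF V A] .
    have "(\<lambda>n. qnorm V (s n)) \<longlonglongrightarrow> 0"
    proof (rule order_tendstoI)
      fix e :: real assume "e > 0"
      then have "\<forall>\<^sub>F n in sequentially. qnorm V (s n) \<le> 2 * qmodulus V * (e / (4 * qmodulus V))"
        using s N qmodulus_pos[OF V] by (intro completion_qnorm_eventually[OF V]) auto
      then show "\<forall>\<^sub>F n in sequentially. qnorm V (s n) < e"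
        by eventually_elim (use \<open>e > 0\<close> qmodulus_pos[OF V] in auto)
    next
      fix a :: real assume "a < 0"
      then show "\<forall>\<^sub>F n in sequentially. a < qnorm V (s n)"
        by (intro always_eventually allI less_le_trans[OF _ qnorm_nonneg[OF V qCauchy_in[OF s(1)]]])
    qed
    then show ?thesis
      unfolding s(2) completion_zero
      by (intro cclass_eqI V s(1) qCauchy_const vspace_zero quasinormed_vspace)
        (simp add: vspace_diff_zero[OF quasinormed_vspace[OF V] qCauchy_in[OF s(1)]])
  qed
  \<comment> \<open>One inequality is enough for homogeneity: for nonzero \<open>c\<close> the other
    one is this inequality applied to the inverse scalar.\<close>
  have le: "?N (qsmul (completion V) c A) \<le> norm c * ?N A" if A: "A \<in> qcar (completion V)" for c A
  proof (rule field_le_epsilon)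
    fix e :: real assume "e > 0"
    define d where "d = e / (norm c + 1)"
    have d: "d > 0" "norm c * d \<le> e"
      using \<open>e > 0\<close> by (auto simp: d_def field_simps add_pos_nonneg)
    obtain s where s: "s \<in> A" "\<And>n. qnorm V (s n) \<le> ?N A + d"
      using completion_qnorm_approx[OF V A, of "?N A + d"] d by auto
    note s' = completion_mem[OF V A s(1)]
    have "?N (qsmul (completion V) c A) \<le> norm c * (?N A + d)"
      unfolding s'(2) completion_smul[OF V s'(1)]
      by (intro completion_qnorm_le[OF V qCauchy_smul[OF V s'(1)]] always_eventually allI)
        (use s(2) in \<open>simp add: s'(2)[symmetric] qnorm_smul[OF V qCauchy_in[OF s'(1)]] mult_left_mono\<close>)
    then show "?N (qsmul (completion V) c A) \<le> norm c * ?N A + e"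
      using d by (simp add: distrib_left)
  qed
  show "?N (qsmul (completion V) c A) = norm c * ?N A" if A: "A \<in> qcar (completion V)" for c A
  proof (cases "c = 0")
    case True
    then show ?thesis
      using le[OF A, of 0] completion_qnorm_nonneg[OF V vspace_smul[OF C A, of 0]] by simp
  next
    case False
    have "?N A = ?N (qsmul (completion V) (inverse c) (qsmul (completion V) c A))"
      using False vspace_smul_smul[OF C A, of "inverse c" c] by (simp add: vspace_one[OF C A])
    also have "\<dots> \<le> norm (inverse c) * ?N (qsmul (completion V) c A)"
      by (rule le[OF vspace_smul[OF C A]])
    finally have "norm c * ?N A \<le> ?N (qsmul (completion V) c A)"
      using False by (simp add: norm_inverse inverse_eq_divide norm_divide pos_le_divide_eq mult.commute)
    then show ?thesis
      using le[OF A, of c] by simp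
  qed
  show "?N (qadd (completion V) A B) \<le> qmodulus V * (?N A + ?N B)"
    if A: "A \<in> qcar (completion V)" and B: "B \<in> qcar (completion V)" for A B
  proof (rule field_le_epsilon)
    fix e :: real assume "e > 0"
    define d where "d = e / (2 * qmodulus V)"
    have d: "d > 0" "qmodulus V * (d + d) = e"
      using \<open>e > 0\<close> qmodulus_pos[OF V] by (auto simp: d_def)
    obtain s where s: "s \<in> A" "\<And>n. qnorm V (s n) \<le> ?N A + d"
      using completion_qnorm_approx[OF V A, of "?N A + d"] d by auto
    obtain t where t: "t \<in> B" "\<And>n. qnorm V (t n) \<le> ?N B + d"
      using completion_qnorm_approx[OF V B, of "?N B + d"] d by auto
    note s' = completion_mem[OF V A s(1)] and t' = completion_mem[OF V B t(1)]
    have "qnorm V (qadd V (s n) (t n)) \<le> qmodulus V * ((?N A + d) + (?N B + d))" for n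
    proof -
      have "qnorm V (qadd V (s n) (t n)) \<le> qmodulus V * (qnorm V (s n) + qnorm V (t n))"
        by (intro qnorm_add_le V qCauchy_in[OF s'(1)] qCauchy_in[OF t'(1)])
      also have "\<dots> \<le> qmodulus V * ((?N A + d) + (?N B + d))"
        using s t qmodulus_pos[OF V] by (intro mult_left_mono add_mono) auto
      finally show ?thesis .
    qed
    then have "?N (cclass V (\<lambda>n. qadd V (s n) (t n))) \<le> qmodulus V * ((?N A + d) + (?N B + d))"
      by (intro completion_qnorm_le[OF V qCauchy_add[OF V s'(1) t'(1)]] always_eventually allI)
    also have "\<dots> = qmodulus V * (?N A + ?N B) + qmodulus V * (d + d)"
      by (simp add: algebra_simps)
    finally show "?N (qadd (completion V) A B) \<le> qmodulus V * (?N A + ?N B) + e"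
      using completion_add[OF V s'(1) t'(1)] s'(2) t'(2) d by simp
  qed
qed

section \<open>Density of the original space and completeness\<close>

definition cemb :: "('k::real_normed_field, 'a) qspace \<Rightarrow> 'a \<Rightarrow> (nat \<Rightarrow> 'a) set" where
  "cemb V v = cclass V (\<lambda>_. v)"

lemma cemb_qoperator:
  assumes V: "quasinormed V"
  shows "qoperator V (completion V) (cemb V)"
  unfolding cemb_def
  by (rule qoperatorI[where C = 1])
    (use V in \<open>auto simp: cclass_in qCauchy_const completion_add completion_smul intro!: completion_qnorm_le\<close>)

lemma cemb_qlim:
  assumes V: "quasinormed V" and s: "qCauchy V s"
  shows "qlim (completion V) (\<lambda>n. cemb V (s n)) (cclass V s)"
  unfolding qlim_def
proof (rule order_tendstoI)
  note s_in = qCauchy_in[OF s]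
  have diff: "qdiff (completion V) (cemb V (s n)) (cclass V s) = cclass V (\<lambda>i. qdiff V (s n) (s i))" for n
    unfolding cemb_def by (intro completion_diff V qCauchy_const s s_in)
  have cauchy: "qCauchy V (\<lambda>i. qdiff V (s n) (s i))" for n
    unfolding qdiff_def by (intro qCauchy_add qCauchy_smul V qCauchy_const s s_in)
  fix e :: real assume "e > 0"
  then obtain N where N: "\<forall>m\<ge>N. \<forall>n\<ge>N. qnorm V (qdiff V (s m) (s n)) < e / 2"
    using s unfolding qCauchy_def by (meson half_gt_zero)
  have "qnorm (completion V) (qdiff (completion V) (cemb V (s n)) (cclass V s)) < e" if "n \<ge> N" for n
  proof -
    have "qnorm (completion V) (cclass V (\<lambda>i. qdiff V (s n) (s i))) \<le> e / 2"
      using N that by (intro completion_qnorm_le V cauchy) (auto simp: eventually_sequentially intro!: less_imp_le)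
    then show ?thesis
      using \<open>e > 0\<close> unfolding diff by simp
  qed
  then show "\<forall>\<^sub>F n in sequentially. qnorm (completion V) (qdiff (completion V) (cemb V (s n)) (cclass V s)) < e"
    by (auto simp: eventually_sequentially)
next
  fix a :: real assume "a < 0"
  then show "\<forall>\<^sub>F n in sequentially. a < qnorm (completion V) (qdiff (completion V) (cemb V (s n)) (cclass V s))"
    by (intro always_eventually allI less_le_trans[OF _ qnorm_diff_nonneg] completion_quasinormed V
        qoperator_in[OF cemb_qoperator] cclass_in s qCauchy_in[OF s])
qed

text \<open>Together with \<open>cemb_qoperator\<close> this makes \<open>cemb V\<close> an
  isomorphism onto its image. The strict bound by \<open>r\<close> accounts for an infimum that need
  not be attained.\<close>

lemma cemb_qnorm_le:
  assumes V: "quasinormed V" and v: "v \<in> qcar V" and r: "qnorm (completion V) (cemb V v) < r"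
  shows "qnorm V v \<le> 2 * qmodulus V * r"
  using completion_qnorm_eventually[OF V qCauchy_const[OF V v]] r by (simp add: cemb_def)

text \<open>Approximate the \<open>k\<close>-th class within \<open>1 / (k + 1)\<close> by an
  embedded vector \<open>t k\<close>. These vectors form a Cauchy sequence of \<open>V\<close>,
  because the embedding is an isomorphism onto its image, and the class of \<open>t\<close> is the
  limit.\<close>

lemma completion_quasi_banach:
  assumes V: "quasinormed V"
  shows "quasi_banach (completion V)"
  unfolding quasi_banach_def
proof (intro conjI allI impI)
  let ?C = "completion V"
  note C = completion_quasinormed[OF V]
  show "quasinormed ?C"
    by (rule C)
  fix A assume A: "qCauchy ?C A"
  note A_in = qCauchy_in[OF A]
  have "\<exists>v\<in>qcar V. qnorm ?C (qdiff ?C (cemb V v) (A k)) < inverse (real (Suc k))" for k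
  proof -
    obtain s where s: "qCauchy V s" "A k = cclass V s"
      using completion_cases[OF V A_in] .
    have "\<forall>\<^sub>F n in sequentially. qnorm ?C (qdiff ?C (cemb V (s n)) (A k)) < inverse (real (Suc k))"
      using cemb_qlim[OF V s(1)] unfolding qlim_def s(2)[symmetric]
      by (rule order_tendstoD(2)) simp
    then show ?thesis
      using qCauchy_in[OF s(1)] by (meson eventually_sequentially order_refl)
  qed
  then obtain t where t_in: "\<And>k. t k \<in> qcar V"
    and t: "\<And>k. qnorm ?C (qdiff ?C (cemb V (t k)) (A k)) < inverse (real (Suc k))"
    by metis
  note e_in = qoperator_in[OF cemb_qoperator[OF V] t_in]
  have null: "(\<lambda>k. qnorm ?C (qdiff ?C (cemb V (t k)) (A k))) \<longlonglongrightarrow> 0"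
    by (rule tendsto_sandwich[OF _ _ tendsto_const LIMSEQ_inverse_real_of_nat])
      (use t qnorm_diff_nonneg[OF C e_in A_in] in \<open>auto intro!: always_eventually less_imp_le\<close>)
  have cauchy: "qCauchy ?C (\<lambda>k. cemb V (t k))"
    by (rule qCauchy_equiv[OF C A e_in null])
  have t_cauchy: "qCauchy V t"
    unfolding qCauchy_def
  proof (intro conjI allI impI)
    fix e :: real assume "e > 0"
    \<comment> \<open>\<open>cemb_qnorm_le\<close> multiplies the bound by
      \<open>2 * qmodulus V\<close>, which leaves \<open>e / 2\<close>.\<close>
    then have "0 < e / (4 * qmodulus V)"
      using qmodulus_pos[OF V] by simp
    then obtain N where N: "\<And>m n. m \<ge> N \<Longrightarrow> n \<ge> N \<Longrightarrow>
        qnorm ?C (qdiff ?C (cemb V (t m)) (cemb V (t n))) < e / (4 * qmodulus V)"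
      using cauchy unfolding qCauchy_def by meson
    have "qnorm V (qdiff V (t m) (t n)) < e" if "m \<ge> N" "n \<ge> N" for m n
    proof -
      have "qnorm ?C (cemb V (qdiff V (t m) (t n))) < e / (4 * qmodulus V)"
        using N[OF that] qlinear_diff[OF qoperator_qlinear[OF cemb_qoperator[OF V]]
            quasinormed_vspace[OF V] t_in t_in] by simp
      from cemb_qnorm_le[OF V vspace_diff[OF quasinormed_vspace[OF V] t_in t_in] this]
      show ?thesis
        using \<open>e > 0\<close> qmodulus_pos[OF V] by auto
    qed
    then show "\<exists>N. \<forall>m\<ge>N. \<forall>n\<ge>N. qnorm V (qdiff V (t m) (t n)) < e"
      by blast
  qed (use t_in in blast)
  have "(\<lambda>k. qnorm ?C (qdiff ?C (A k) (cemb V (t k)))) \<longlonglongrightarrow> 0"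
    using null qnorm_diff_commute[OF C e_in A_in] by simp
  from qlim_equiv[OF C e_in A_in cclass_in[OF t_cauchy] cemb_qlim[OF V t_cauchy] this]
  show "\<exists>x\<in>qcar ?C. qlim ?C A x"
    using cclass_in[OF t_cauchy] by blast
qed

text \<open>Extension of an operator to the completion by continuity. The shape is that of
  \<open>Zproj\<close>, so that \<open>Zproj X\<close> is the instance at
  \<open>snd\<close>.\<close>

definition clift :: "('k::real_normed_field, 'b) qspace \<Rightarrow> ('a \<Rightarrow> 'b) \<Rightarrow> (nat \<Rightarrow> 'a) set \<Rightarrow> 'b" where
  "clift W f A = (THE x. x \<in> qcar W \<and> (\<forall>s\<in>A. qlim W (\<lambda>n. f (s n)) x))"

text \<open>Equivalent representatives have images with null difference, so the limit found along
  \<open>crep A\<close> serves all of \<open>A\<close>.\<close>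

lemma clift_props:
  assumes V: "quasinormed V" and W: "quasi_banach W" and f: "qoperator V W f"
    and A: "A \<in> qcar (completion V)"
  shows clift_in: "clift W f A \<in> qcar W"
    and clift_qlim: "\<And>s. s \<in> A \<Longrightarrow> qlim W (\<lambda>n. f (s n)) (clift W f A)"
    and clift_eqI: "\<And>s x. s \<in> A \<Longrightarrow> x \<in> qcar W \<Longrightarrow> qlim W (\<lambda>n. f (s n)) x \<Longrightarrow> clift W f A = x"
proof -
  note W' = quasi_banach_quasinormed[OF W]
  have f_in: "f (s n) \<in> qcar W" if "s \<in> A" for s n
    by (intro qoperator_in[OF f] qCauchy_in completion_mem(1)[OF V A that])
  have "\<exists>!x. x \<in> qcar W \<and> (\<forall>s\<in>A. qlim W (\<lambda>n. f (s n)) x)"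
  proof -
    have s: "crep A \<in> A"
      by (rule crep_in[OF V A])
    note s' = completion_mem[OF V A s]
    obtain x where x: "x \<in> qcar W" "qlim W (\<lambda>n. f (crep A n)) x"
      using quasi_banach_complete[OF W qoperator_qCauchy[OF V W' f s'(1)]] .
    have "qlim W (\<lambda>n. f (t n)) x" if t: "t \<in> A" for t
    proof (rule qlim_equiv[OF W' f_in[OF s] f_in[OF t] x])
      note t' = completion_mem[OF V A t]
      have "(\<lambda>n. qnorm V (qdiff V (t n) (crep A n))) \<longlonglongrightarrow> 0"
        using s t' by (simp add: cclass_def)
      then show "(\<lambda>n. qnorm W (qdiff W (f (t n)) (f (crep A n)))) \<longlonglongrightarrow> 0"
        by (rule qoperator_tendsto_0[OF V W' f qCauchy_in[OF t'(1)] qCauchy_in[OF s'(1)]])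
    qed
    then show ?thesis
      using x qlim_unique[OF W' f_in[OF s]] s by (intro ex1I[of _ x]) auto
  qed
  from theI'[OF this] show *: "clift W f A \<in> qcar W"
    "\<And>s. s \<in> A \<Longrightarrow> qlim W (\<lambda>n. f (s n)) (clift W f A)"
    unfolding clift_def by auto
  show "clift W f A = x" if "s \<in> A" "x \<in> qcar W" "qlim W (\<lambda>n. f (s n)) x" for s x
    using qlim_unique[OF W' f_in[OF that(1)] *(1) that(2) *(2)[OF that(1)] that(3)] .
qed

lemma clift_cemb:
  assumes V: "quasinormed V" and W: "quasi_banach W" and f: "qoperator V W f" and v: "v \<in> qcar V"
  shows "clift W f (cemb V v) = f v"
  unfolding cemb_def
  by (rule clift_eqI[OF V W f cclass_in[OF qCauchy_const[OF V v]] cclass_self[OF V qCauchy_const[OF V v]]])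
    (auto intro: qoperator_in[OF f v] qlim_const quasi_banach_quasinormed W)

lemma clift_qoperator:
  assumes V: "quasinormed V" and W: "quasi_banach W" and f: "qoperator V W f"
  shows "qoperator (completion V) W (clift W f)"
proof -
  note W' = quasi_banach_quasinormed[OF W]
  note L = clift_in[OF V W f] and lim = clift_qlim[OF V W f]
  note f_in = qoperator_in[OF f]
  obtain K where K: "0 \<le> K" "\<And>x. x \<in> qcar V \<Longrightarrow> qnorm W (f x) \<le> K * qnorm V x"
    using qoperator_bound[OF f V] by blast
  show ?thesis
  proof (rule qoperatorI)
    show "clift W f A \<in> qcar W" if "A \<in> qcar (completion V)" for A
      using L[OF that] .
  next
    fix A B assume A: "A \<in> qcar (completion V)" and B: "B \<in> qcar (completion V)"
    note a = completion_mem[OF V A crep_in[OF V A]] and b = completion_mem[OF V B crep_in[OF V B]]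
    let ?s = "\<lambda>n. qadd V (crep A n) (crep B n)"
    have AB: "qadd (completion V) A B = cclass V ?s"
      using completion_add[OF V a(1) b(1)] a(2) b(2) by simp
    have "qlim W (\<lambda>n. f (?s n)) (qadd W (clift W f A) (clift W f B))"
      using qlim_add[OF W' _ _ L[OF A] L[OF B] lim[OF A crep_in[OF V A]] lim[OF B crep_in[OF V B]]]
        qlinear_add[OF qoperator_qlinear[OF f] qCauchy_in[OF a(1)] qCauchy_in[OF b(1)]]
        f_in[OF qCauchy_in[OF a(1)]] f_in[OF qCauchy_in[OF b(1)]] by simp
    then show "clift W f (qadd (completion V) A B) = qadd W (clift W f A) (clift W f B)"
      unfolding AB
      by (intro clift_eqI[OF V W f _ cclass_self] cclass_in qCauchy_add V a(1) b(1)
          vspace_add quasi_banach_vspace W L A B)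
  next
    fix c A assume A: "A \<in> qcar (completion V)"
    note a = completion_mem[OF V A crep_in[OF V A]]
    let ?s = "\<lambda>n. qsmul V c (crep A n)"
    have cA: "qsmul (completion V) c A = cclass V ?s"
      using completion_smul[OF V a(1)] a(2) by simp
    have "qlim W (\<lambda>n. f (?s n)) (qsmul W c (clift W f A))"
      using qlim_smul[OF W' _ L[OF A] lim[OF A crep_in[OF V A]]]
        qlinear_smul[OF qoperator_qlinear[OF f] qCauchy_in[OF a(1)]]
        f_in[OF qCauchy_in[OF a(1)]] by simp
    then show "clift W f (qsmul (completion V) c A) = qsmul W c (clift W f A)"
      unfolding cA
      by (intro clift_eqI[OF V W f _ cclass_self] cclass_in qCauchy_smul V a(1)
          vspace_smul quasi_banach_vspace W L A)
  next
    fix A assume A: "A \<in> qcar (completion V)"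
    \<comment> \<open>For \<open>r\<close> above the quasinorm of \<open>A\<close>, some
      representative is bounded by \<open>r\<close> throughout, and the passage to the limit costs
      one factor \<open>qmodulus W\<close>. Afterwards \<open>r\<close> decreases to the
      quasinorm.\<close>
    have "qnorm W (clift W f A) \<le> qmodulus W * (K * r)" if r: "qnorm (completion V) A < r" for r
    proof -
      obtain s where s: "s \<in> A" "\<And>n. qnorm V (s n) \<le> r"
        using completion_qnorm_approx[OF V A r] by blast
      note s_in = qCauchy_in[OF completion_mem(1)[OF V A s(1)]]
      have "qnorm W (f (s n)) \<le> K * r" for n
        using K(2)[OF s_in] mult_left_mono[OF s(2) K(1)] order_trans by blast
      then show ?thesis
        by (rule qlim_qnorm_le[OF W' f_in[OF s_in] L[OF A] lim[OF A s(1)]])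
    qed
    moreover have "((\<lambda>r. qmodulus W * (K * r)) \<longlongrightarrow> qmodulus W * (K * qnorm (completion V) A))
        (at_right (qnorm (completion V) A))"
      by (intro tendsto_intros)
    ultimately show "qnorm W (clift W f A) \<le> (qmodulus W * K) * qnorm (completion V) A"
      by (auto intro!: tendsto_lowerbound[where F = "at_right (qnorm (completion V) A)"]
          simp: mult.assoc eventually_at_right_less eventually_at_filter)
  qed
qed

section \<open>Twisted sums\<close>

text \<open>Every use of the quasi triangle inequality costs a factor \<open>K = qmodulus V\<close>,
  so increments have to decay faster than the powers of \<open>1 / K\<close>. At the ratio
  \<open>r = 1 / (2 K)\<close> the bound \<open>2 K M r^n\<close> reproduces itself:
  \<open>K (2 K M r^(n+1) + M r^n) = 2 K M r^n\<close>, independently of the number of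
  increments.\<close>

lemma qCauchy_geometric:
  assumes V: "quasinormed V" and w: "\<And>n. w n \<in> qcar V"
    and d: "\<And>n. qnorm V (qdiff V (w (Suc n)) (w n)) \<le> M * (1 / (2 * qmodulus V)) ^ n"
  shows "qCauchy V w"
proof -
  let ?K = "qmodulus V"
  define r where "r = 1 / (2 * ?K)"
  have K: "1 \<le> ?K" "0 < ?K"
    using qmodulus_ge_1[OF V] qmodulus_pos[OF V] .
  have r: "0 < r" "r < 1" "2 * ?K * r = 1"
    using K by (auto simp: r_def)
  have bound: "qnorm V (qdiff V (w (n + p)) (w n)) \<le> 2 * ?K * M * r ^ n" for n p
  proof (induction p arbitrary: n)
    case 0
    have "0 \<le> M"
      using d[of 0] qnorm_diff_nonneg[OF V w[of 1] w[of 0]] by simp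
    then show ?case
      using K r by (simp add: vspace_diff_self[OF quasinormed_vspace[OF V] w] qnorm_zero[OF V])
  next
    case (Suc p)
    have "qnorm V (qdiff V (w (n + Suc p)) (w n))
        \<le> ?K * (qnorm V (qdiff V (w (Suc n + p)) (w (Suc n))) + qnorm V (qdiff V (w (Suc n)) (w n)))"
      using qnorm_diff_triangle[OF V w[of "Suc n + p"] w[of "Suc n"] w[of n]] by simp
    also have "\<dots> \<le> ?K * (2 * ?K * M * r ^ Suc n + M * r ^ n)"
      using K Suc.IH[of "Suc n"] d[of n] unfolding r_def by (intro mult_left_mono add_mono) auto
    also have "2 * ?K * M * r ^ Suc n = (2 * ?K * r) * (M * r ^ n)"
      by simp
    finally show ?case
      unfolding r(3) by (simp add: algebra_simps)
  qed
  show ?thesis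
    unfolding qCauchy_def
  proof (intro conjI allI impI)
    fix e :: real assume "e > 0"
    \<comment> \<open>Both terms are compared with \<open>w N\<close> at the price
      \<open>2 * ?K * M * r ^ N\<close> each, and one more factor \<open>?K\<close> joins the two
      estimates.\<close>
    have "(\<lambda>n. 4 * ?K\<^sup>2 * M * r ^ n) \<longlonglongrightarrow> 4 * ?K\<^sup>2 * M * 0"
      using r by (intro tendsto_intros LIMSEQ_power_zero) auto
    then have "\<forall>\<^sub>F n in sequentially. 4 * ?K\<^sup>2 * M * r ^ n < e"
      using order_tendstoD(2)[of _ 0] \<open>e > 0\<close> by simp
    then obtain N where N: "4 * ?K\<^sup>2 * M * r ^ N < e"
      by (auto simp: eventually_sequentially)
    have "qnorm V (qdiff V (w m) (w n)) < e" if "m \<ge> N" "n \<ge> N" for m n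
    proof -
      have *: "qnorm V (qdiff V (w k) (w N)) \<le> 2 * ?K * M * r ^ N" if "k \<ge> N" for k
        using bound[of N "k - N"] that by simp
      have "qnorm V (qdiff V (w m) (w n)) \<le> ?K * (qnorm V (qdiff V (w m) (w N)) + qnorm V (qdiff V (w n) (w N)))"
        using qnorm_diff_triangle[OF V w[of m] w[of N] w[of n]] qnorm_diff_commute[OF V w[of n] w[of N]] by simp
      also have "\<dots> \<le> ?K * (2 * ?K * M * r ^ N + 2 * ?K * M * r ^ N)"
        using K that by (intro mult_left_mono add_mono *) auto
      also have "\<dots> = 4 * ?K\<^sup>2 * M * r ^ N"
        by (simp add: power2_eq_square)
      finally show ?thesis
        using N by simp
    qed
    then show "\<exists>N. \<forall>m\<ge>N. \<forall>n\<ge>N. qnorm V (qdiff V (w m) (w n)) < e"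
      by blast
  qed (use w in blast)
qed

lemma twisted_simps [simp]:
  "qcar (twisted Y X X0 \<Phi>) = qcar Y \<times> X0"
  "qzero (twisted Y X X0 \<Phi>) = (qzero Y, qzero X)"
  "qadd (twisted Y X X0 \<Phi>) p q = (qadd Y (fst p) (fst q), qadd X (snd p) (snd q))"
  "qsmul (twisted Y X X0 \<Phi>) c p = (qsmul Y c (fst p), qsmul X c (snd p))"
  "qdiff (twisted Y X X0 \<Phi>) p q = (qdiff Y (fst p) (fst q), qdiff X (snd p) (snd q))"
  "qnorm (twisted Y X X0 \<Phi>) p = qnorm Y (qdiff Y (fst p) (\<Phi> (snd p))) + qnorm X (snd p)"
  by (simp_all add: twisted_def qdiff_def split: prod.splits)

text \<open>The setting in which \<open>Zsp\<close>, \<open>Zinc\<close> and \<open>Zproj\<close>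
  form a short exact sequence. Quasilinearity makes the twisted sum quasinormed, and density of
  \<open>X0\<close> makes the projection onto \<open>X\<close> surjective.\<close>

locale twisted_sum =
  fixes Y :: "('k::real_normed_field, 'y) qspace" and X :: "('k, 'x) qspace"
    and X0 :: "'x set" and \<Phi> :: "'x \<Rightarrow> 'y"
  assumes Y: "quasi_banach Y" and X: "quasi_banach X"
    and X0_sub: "X0 \<subseteq> qcar X" and X0_zero: "qzero X \<in> X0"
    and X0_add: "\<And>x y. x \<in> X0 \<Longrightarrow> y \<in> X0 \<Longrightarrow> qadd X x y \<in> X0"
    and X0_smul: "\<And>c x. x \<in> X0 \<Longrightarrow> qsmul X c x \<in> X0"
    and X0_dense: "\<And>x. x \<in> qcar X \<Longrightarrow> \<exists>s. range s \<subseteq> X0 \<and> qlim X s x"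
    and \<Phi>_in: "\<And>x. x \<in> X0 \<Longrightarrow> \<Phi> x \<in> qcar Y"
    and \<Phi>_smul: "\<And>c x. x \<in> X0 \<Longrightarrow> \<Phi> (qsmul X c x) = qsmul Y c (\<Phi> x)"
    and \<Phi>_quasilinear: "\<exists>Q. \<forall>x\<in>X0. \<forall>y\<in>X0.
          qnorm Y (qdiff Y (\<Phi> (qadd X x y)) (qadd Y (\<Phi> x) (\<Phi> y))) \<le> Q * (qnorm X x + qnorm X y)"
begin

abbreviation "V \<equiv> twisted Y X X0 \<Phi>"
abbreviation "Z \<equiv> Zsp Y X X0 \<Phi>"
abbreviation "inc \<equiv> Zinc Y X X0 \<Phi>"

lemmas qn_Y = quasi_banach_quasinormed[OF Y] and vs_Y = quasi_banach_vspace[OF Y]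
lemmas qn_X = quasi_banach_quasinormed[OF X] and vs_X = quasi_banach_vspace[OF X]

lemma X0_in: "x \<in> X0 \<Longrightarrow> x \<in> qcar X"
  using X0_sub by blast

lemma X0_diff: "x \<in> X0 \<Longrightarrow> y \<in> X0 \<Longrightarrow> qdiff X x y \<in> X0"
  by (simp add: qdiff_def X0_add X0_smul)

lemma \<Phi>_zero: "\<Phi> (qzero X) = qzero Y"
  using \<Phi>_smul[OF X0_zero, of 0] vspace_smul_0[OF vs_Y \<Phi>_in[OF X0_zero]] vspace_smul_zero[OF vs_X, of 0]
  by simp

lemma twisted_quasinormed: "quasinormed V"
proof -
  obtain Q where Q: "\<forall>x\<in>X0. \<forall>y\<in>X0.
      qnorm Y (qdiff Y (\<Phi> (qadd X x y)) (qadd Y (\<Phi> x) (\<Phi> y))) \<le> Q * (qnorm X x + qnorm X y)"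
    using \<Phi>_quasilinear by blast
  let ?C = "qmodulus Y" and ?D = "qmodulus X"
  \<comment> \<open>The summands pay for two uses of the quasi triangle inequality in
    \<open>Y\<close>, for the defect of \<open>\<Phi>\<close> and for the addition in
    \<open>X\<close>. The absolute value is there because \<open>Q\<close> may be negative.\<close>
  define K where "K = ?C * ?C + ?C * \<bar>Q\<bar> + ?D"
  have C: "1 \<le> ?C" "0 < ?C" and D: "0 < ?D"
    using qmodulus_ge_1[OF qn_Y] qmodulus_pos[OF qn_Y] qmodulus_pos[OF qn_X] .
  show ?thesis
  proof (rule quasinormedI)
    show "vspace V"
      unfolding vspace_def
      by (auto simp: vspace_zero[OF vs_Y] X0_zero vspace_add[OF vs_Y] X0_add vspace_smul[OF vs_Y] X0_smul
          vspace_assoc[OF vs_Y] vspace_assoc[OF vs_X] vspace_zero_left[OF vs_Y] vspace_zero_left[OF vs_X]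
          vspace_diff_self[OF vs_Y] vspace_diff_self[OF vs_X] vspace_smul_add[OF vs_Y] vspace_smul_add[OF vs_X]
          vspace_add_smul[OF vs_Y] vspace_add_smul[OF vs_X] vspace_smul_smul[OF vs_Y] vspace_smul_smul[OF vs_X]
          vspace_one[OF vs_Y] vspace_one[OF vs_X] X0_in intro: vspace_comm[OF vs_Y] vspace_comm[OF vs_X])
  next
    fix p assume p: "p \<in> qcar V"
    then obtain y x where [simp]: "p = (y, x)" and y: "y \<in> qcar Y" and x: "x \<in> X0"
      by auto
    have nn: "0 \<le> qnorm Y (qdiff Y y (\<Phi> x))" "0 \<le> qnorm X x"
      using y x by (simp_all add: qnorm_diff_nonneg[OF qn_Y] \<Phi>_in qnorm_nonneg[OF qn_X] X0_in)
    then show "0 \<le> qnorm V p"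
      by simp
    show "p = qzero V" if "qnorm V p = 0"
    proof -
      have "qnorm Y (qdiff Y y (\<Phi> x)) = 0" "qnorm X x = 0"
        using that nn by simp_all
      then show ?thesis
        using y x by (simp add: qnorm_diff_eq_0[OF qn_Y] qnorm_eq_0[OF qn_X] X0_in \<Phi>_in \<Phi>_zero)
    qed
    show "qnorm V (qsmul V c p) = norm c * qnorm V p" for c
      using y x by (simp add: \<Phi>_smul qnorm_smul_diff_smul[OF qn_Y] \<Phi>_in qnorm_smul[OF qn_X] X0_in distrib_left)
    fix p' assume p': "p' \<in> qcar V"
    then obtain y' x' where [simp]: "p' = (y', x')" and y': "y' \<in> qcar Y" and x': "x' \<in> X0"
      by auto
    have nn': "0 \<le> qnorm Y (qdiff Y y' (\<Phi> x'))" "0 \<le> qnorm X x'"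
      using y' x' by (simp_all add: qnorm_diff_nonneg[OF qn_Y] \<Phi>_in qnorm_nonneg[OF qn_X] X0_in)
    note F = \<Phi>_in[OF x] \<Phi>_in[OF x'] \<Phi>_in[OF X0_add[OF x x']]
    let ?a = "qnorm Y (qdiff Y y (\<Phi> x))" and ?a' = "qnorm Y (qdiff Y y' (\<Phi> x'))"
      and ?b = "qnorm X x" and ?b' = "qnorm X x'"
    have "qnorm Y (qdiff Y (qadd Y (\<Phi> x) (\<Phi> x')) (\<Phi> (qadd X x x'))) \<le> Q * (?b + ?b')"
      using Q x x' qnorm_diff_commute[OF qn_Y vspace_add[OF vs_Y F(1,2)] F(3)] by simp
    also have "\<dots> \<le> \<bar>Q\<bar> * (?b + ?b')"
      using nn nn' by (intro mult_right_mono) auto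
    finally have "qnorm Y (qdiff Y (qadd Y y y') (\<Phi> (qadd X x x')))
        \<le> ?C * (?C * (?a + ?a') + \<bar>Q\<bar> * (?b + ?b'))"
      using qnorm_diff_triangle[OF qn_Y vspace_add[OF vs_Y y y'] vspace_add[OF vs_Y F(1,2)] F(3)]
        qnorm_add_diff_add[OF qn_Y y y' F(1,2)] C
      by (smt (verit) mult_left_mono)
    moreover have "qnorm X (qadd X x x') \<le> ?D * (?b + ?b')"
      by (intro qnorm_add_le[OF qn_X] X0_in x x')
    ultimately have "qnorm V (qadd V p p')
        \<le> ?C * (?C * (?a + ?a') + \<bar>Q\<bar> * (?b + ?b')) + ?D * (?b + ?b')"
      by simp
    also have "\<dots> = ?C * ?C * (?a + ?a') + (?C * \<bar>Q\<bar> + ?D) * (?b + ?b')"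
      by (simp add: algebra_simps)
    also have "\<dots> \<le> K * (?a + ?a') + K * (?b + ?b')"
      using C D nn nn' unfolding K_def by (intro add_mono mult_right_mono) auto
    also have "\<dots> = K * (qnorm V p + qnorm V p')"
      by (simp add: algebra_simps)
    finally show "qnorm V (qadd V p p') \<le> K * (qnorm V p + qnorm V p')" .
  qed
qed

lemma Zsp_quasi_banach: "quasi_banach Z"
  unfolding Zsp_def by (rule completion_quasi_banach[OF twisted_quasinormed])

lemmas qn_Z = quasi_banach_quasinormed[OF Zsp_quasi_banach]
lemmas vs_Z = quasi_banach_vspace[OF Zsp_quasi_banach]

lemma pair_qoperator: "qoperator Y V (\<lambda>y. (y, qzero X))"
  by (rule qoperatorI[where C = 1])
    (auto simp: X0_zero vspace_zero_left[OF vs_X] vspace_zero[OF vs_X] vspace_smul_zero[OF vs_X] \<Phi>_zero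
      vspace_diff_zero[OF vs_Y] qnorm_zero[OF qn_X])

lemma snd_qoperator: "qoperator V X snd"
  by (rule qoperatorI[where C = 1]) (auto simp: X0_in qnorm_diff_nonneg[OF qn_Y] \<Phi>_in)

lemma Zinc_cemb: "inc y = cemb V (y, qzero X)"
  by (simp add: Zinc_def cemb_def)

lemma Zproj_clift: "Zproj X = clift X snd"
  by (simp add: fun_eq_iff Zproj_def clift_def)

lemma Zinc_qoperator: "qoperator Y Z inc"
  using qoperator_comp[OF pair_qoperator cemb_qoperator[OF twisted_quasinormed] qn_Y twisted_quasinormed]
  by (simp add: Zinc_cemb Zsp_def qoperator_def qlinear_def image_subset_iff)

lemma Zproj_qoperator: "qoperator Z X (Zproj X)"
  unfolding Zproj_clift Zsp_def by (rule clift_qoperator[OF twisted_quasinormed X snd_qoperator])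

lemma Zinc_eq_zero_iff:
  assumes y: "y \<in> qcar Y"
  shows "inc y = qzero Z \<longleftrightarrow> y = qzero Y"
proof
  assume "inc y = qzero Z"
  then have "cclass V (\<lambda>_. (y, qzero X)) = cclass V (\<lambda>_. qzero V)"
    by (simp add: Zinc_def Zsp_def completion_zero)
  then have "(\<lambda>n::nat. qnorm V (qdiff V (y, qzero X) (qzero V))) \<longlonglongrightarrow> 0"
    using cclass_eq_iff[OF twisted_quasinormed qCauchy_const qCauchy_const, OF twisted_quasinormed _ twisted_quasinormed]
      y X0_zero vspace_zero[OF vs_Y] by fastforce
  then show "y = qzero Y"
    using y by (simp add: LIMSEQ_const_iff vspace_diff_zero[OF vs_Y] \<Phi>_zero vspace_diff_zero[OF vs_X]
        vspace_zero[OF vs_X] qnorm_zero[OF qn_X] qnorm_eq_0[OF qn_Y])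
qed (use qlinear_zero[OF qoperator_qlinear[OF Zinc_qoperator] vs_Y vs_Z] in simp)

lemma Zproj_inc: "y \<in> qcar Y \<Longrightarrow> Zproj X (inc y) = qzero X"
  unfolding Zproj_clift Zinc_cemb
  by (subst clift_cemb[OF twisted_quasinormed X snd_qoperator]) (auto simp: X0_zero)

text \<open>If \<open>(y, x)\<close> runs through a representative with \<open>x\<close> tending to
  0, replace it by \<open>(y - \<Phi> x, 0)\<close>. The difference \<open>(\<Phi> x, x)\<close> has
  quasinorm exactly that of \<open>x\<close>, so the class is unchanged, and it now comes from a
  Cauchy sequence of \<open>Y\<close>.\<close>

lemma Zproj_kernel: "qker Z X (Zproj X) = inc ` qcar Y"
proof
  show "inc ` qcar Y \<subseteq> qker Z X (Zproj X)"
    using Zproj_inc qoperator_in[OF Zinc_qoperator] by (auto simp: qker_def)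
  show "qker Z X (Zproj X) \<subseteq> inc ` qcar Y"
  proof
    fix A assume "A \<in> qker Z X (Zproj X)"
    then have A: "A \<in> qcar (completion V)" and A0: "clift X snd A = qzero X"
      by (auto simp: qker_def Zproj_clift Zsp_def)
    obtain s where s: "qCauchy V s" "A = cclass V s"
      using completion_cases[OF twisted_quasinormed A] .
    define y x where "y n = fst (s n)" and "x n = snd (s n)" for n
    have y: "y n \<in> qcar Y" and x: "x n \<in> X0" and s_eq: "s n = (y n, x n)" for n
      using qCauchy_in[OF s(1), of n] by (auto simp: y_def x_def)
    have "qlim X (\<lambda>n. snd (s n)) (qzero X)"
      using clift_qlim[OF twisted_quasinormed X snd_qoperator A, of s] A0 s
        cclass_self[OF twisted_quasinormed s(1)] by simp
    then have x0: "(\<lambda>n. qnorm X (x n)) \<longlonglongrightarrow> 0"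
      using X0_in[OF x] by (simp add: qlim_def s_eq vspace_diff_zero[OF vs_X])
    define t where "t n = qdiff Y (y n) (\<Phi> (x n))" for n
    have t: "t n \<in> qcar Y" for n
      using y x by (simp add: t_def vspace_diff[OF vs_Y] \<Phi>_in)
    have "(\<lambda>n. qnorm V (qdiff V (s n) (t n, qzero X))) \<longlonglongrightarrow> 0"
      using x0 y x by (simp add: s_eq t_def vspace_diff_diff_self[OF vs_Y] \<Phi>_in X0_in
          vspace_diff_zero[OF vs_X] vspace_diff_self[OF vs_Y] qnorm_zero[OF qn_Y])
    then have st: "(\<lambda>n. qnorm V (qdiff V (t n, qzero X) (s n))) \<longlonglongrightarrow> 0"
      using qnorm_diff_commute[OF twisted_quasinormed qCauchy_in[OF s(1)], of "(t n, qzero X)" n for n] t X0_zero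
      by simp
    have t_cauchy: "qCauchy V (\<lambda>n. (t n, qzero X))"
      by (rule qCauchy_equiv[OF twisted_quasinormed s(1) _ st]) (use t X0_zero in auto)
    then have "qCauchy Y t"
      using t unfolding qCauchy_def
      by (simp add: vspace_diff_self[OF vs_X] vspace_zero[OF vs_X] \<Phi>_zero vspace_diff_zero[OF vs_Y]
          vspace_diff[OF vs_Y] qnorm_zero[OF qn_X] image_subset_iff)
    then obtain l where l: "l \<in> qcar Y" "qlim Y t l"
      using quasi_banach_complete[OF Y] by blast
    have tl: "(\<lambda>n. qnorm V (qdiff V (t n, qzero X) (l, qzero X))) \<longlonglongrightarrow> 0"
      using l t by (simp add: qlim_def vspace_diff_self[OF vs_X] vspace_zero[OF vs_X] \<Phi>_zero
          vspace_diff_zero[OF vs_Y] vspace_diff[OF vs_Y] qnorm_zero[OF qn_X])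
    have l_cauchy: "qCauchy V (\<lambda>_. (l, qzero X))"
      using l X0_zero by (intro qCauchy_const twisted_quasinormed) auto
    have "A = inc l"
      unfolding s(2) Zinc_def
      using cclass_eqI[OF twisted_quasinormed t_cauchy s(1) st]
        cclass_eqI[OF twisted_quasinormed t_cauchy l_cauchy tl] by simp
    with l show "A \<in> inc ` qcar Y"
      by blast
  qed
qed

text \<open>Summing \<open>\<Phi>\<close> over the increments of a rapidly convergent sequence lifts that sequence to a
  Cauchy sequence of the twisted sum.\<close>

lemma Zproj_surj: "Zproj X ` qcar Z = qcar X"
proof
  show "Zproj X ` qcar Z \<subseteq> qcar X"
    using qoperator_in[OF Zproj_qoperator] by blast
  show "qcar X \<subseteq> Zproj X ` qcar Z"
  proof
    fix x assume x: "x \<in> qcar X"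
    \<comment> \<open>The ratio that \<open>qCauchy_geometric\<close> demands in the twisted sum; by
      density, \<open>x\<close> can be approximated at this rate.\<close>
    define r where "r = 1 / (2 * qmodulus V)"
    have r: "0 < r" "r < 1"
      using qmodulus_ge_1[OF twisted_quasinormed] by (auto simp: r_def)
    have "\<exists>t\<in>X0. qnorm X (qdiff X t x) < r ^ n" for n
    proof -
      obtain s where s: "range s \<subseteq> X0" "qlim X s x"
        using X0_dense[OF x] by blast
      have "\<forall>\<^sub>F k in sequentially. qnorm X (qdiff X (s k) x) < r ^ n"
        using s(2) r unfolding qlim_def by (intro order_tendstoD(2)) auto
      then show ?thesis
        using s(1) by (auto simp: eventually_sequentially)
    qed
    then obtain t where t: "\<And>n. t n \<in> X0" and tx: "\<And>n. qnorm X (qdiff X (t n) x) < r ^ n"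
      by metis
    define d where "d n = qdiff X (t (Suc n)) (t n)" for n
    \<comment> \<open>The first coordinate accumulates the values \<open>\<Phi> (d n)\<close>, so
      the increments of \<open>w\<close> are \<open>(\<Phi> (d n), d n)\<close>, whose quasinorm is
      just that of \<open>d n\<close>.\<close>
    define w where "w = rec_nat (qzero Y, t 0) (\<lambda>n p. (qadd Y (fst p) (\<Phi> (d n)), t (Suc n)))"
    have w_0: "w 0 = (qzero Y, t 0)" and w_Suc: "w (Suc n) = (qadd Y (fst (w n)) (\<Phi> (d n)), t (Suc n))" for n
      by (simp_all add: w_def)
    have d: "d n \<in> X0" for n
      by (simp add: d_def X0_diff t)
    have snd_w: "snd (w n) = t n" for n
      by (cases n) (simp_all add: w_0 w_Suc)
    have fst_w: "fst (w n) \<in> qcar Y" for n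
      by (induction n) (simp_all add: w_0 w_Suc vspace_zero[OF vs_Y] vspace_add[OF vs_Y] \<Phi>_in d)
    have w: "w n \<in> qcar V" for n
      using fst_w[of n] t[of n] by (simp add: mem_Times_iff snd_w)
    have "qnorm V (qdiff V (w (Suc n)) (w n)) \<le> 2 * qmodulus X * (1 / (2 * qmodulus V)) ^ n" for n
    proof -
      have "qnorm V (qdiff V (w (Suc n)) (w n)) = qnorm X (d n)"
        using fst_w[of n] d[of n]
        by (simp add: w_Suc snd_w vspace_diff_add_self[OF vs_Y] \<Phi>_in d_def[symmetric]
            vspace_diff_self[OF vs_Y] qnorm_zero[OF qn_Y])
      also have "\<dots> \<le> qmodulus X * (qnorm X (qdiff X (t (Suc n)) x) + qnorm X (qdiff X (t n) x))"
        using qnorm_diff_triangle[OF qn_X X0_in[OF t[of "Suc n"]] x X0_in[OF t[of n]]]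
          qnorm_diff_commute[OF qn_X x X0_in[OF t[of n]]] by (simp add: d_def)
      also have "\<dots> \<le> qmodulus X * (r ^ n + r ^ n)"
        using tx[of n] tx[of "Suc n"] r power_Suc_le_self[of r n] qmodulus_pos[OF qn_X]
        by (intro mult_left_mono add_mono) (auto intro!: less_imp_le elim!: order.strict_trans2 simp: mult_left_le_one_le)
      finally show ?thesis
        by (simp add: r_def)
    qed
    then have w_cauchy: "qCauchy V w"
      by (rule qCauchy_geometric[OF twisted_quasinormed w])
    have "(\<lambda>n. qnorm X (qdiff X (t n) x)) \<longlonglongrightarrow> 0"
    proof (rule tendsto_sandwich[OF _ _ tendsto_const])
      show "(\<lambda>n. r ^ n) \<longlonglongrightarrow> 0"
        using r by (intro LIMSEQ_power_zero) auto
    qed (use tx qnorm_diff_nonneg[OF qn_X X0_in[OF t] x] in \<open>auto intro!: always_eventually less_imp_le\<close>)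
    then have "qlim X (\<lambda>n. snd (w n)) x"
      by (simp add: qlim_def snd_w)
    then have "Zproj X (cclass V w) = x"
      unfolding Zproj_clift
      by (intro clift_eqI[OF twisted_quasinormed X snd_qoperator _ cclass_self] cclass_in w_cauchy
          twisted_quasinormed x)
    moreover have "cclass V w \<in> qcar Z"
      by (simp add: Zsp_def cclass_in w_cauchy)
    ultimately show "x \<in> Zproj X ` qcar Z"
      by blast
  qed
qed

end

text \<open>Exactness survives the composition at \<open>E\<close>: the inclusion of
  \<open>E\<close> is injective and so keeps the kernel of the projection, while the projection is
  onto and so keeps the image of the inclusion.\<close>

lemma splice4_exact:
  assumes "twisted_sum Y E E0 \<Phi>" "twisted_sum E X X0 \<Psi>"
  shows "exact4 Y X (splice4 Y E X E0 \<Phi> X0 \<Psi>)"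
proof -
  interpret A: twisted_sum Y E E0 \<Phi> by fact
  interpret B: twisted_sum E X X0 \<Psi> by fact
  have "qker A.Z B.Z (\<lambda>a. B.inc (Zproj E a)) = qker A.Z E (Zproj E)"
    using B.Zinc_eq_zero_iff qoperator_in[OF A.Zproj_qoperator] by (auto simp: qker_def)
  moreover have "qker Y A.Z A.inc = {qzero Y}"
    using A.Zinc_eq_zero_iff vspace_zero[OF A.vs_Y] by (auto simp: qker_def)
  moreover have "(\<lambda>a. B.inc (Zproj E a)) ` qcar A.Z = B.inc ` qcar E"
    using A.Zproj_surj by (metis image_image)
  ultimately show ?thesis
    unfolding exact4_def splice4_def
    using A.Y A.Zsp_quasi_banach B.Zsp_quasi_banach B.X A.Zinc_qoperator B.Zproj_qoperator
      A.Zproj_kernel B.Zproj_kernel B.Zproj_surj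
      qoperator_comp[OF A.Zproj_qoperator B.Zinc_qoperator A.qn_Z A.qn_X]
    by simp
qed

section \<open>Pullbacks\<close>

text \<open>Used over zero maps for a direct sum, and over the quotient map of
  \<open>Z(\<Phi>)\<close> for the extension pulled back to \<open>Z(\<Psi>)\<close>.\<close>

definition qpullback ::
  "('k, 'a) qspace \<Rightarrow> ('k, 'b) qspace \<Rightarrow> ('a \<Rightarrow> 'e) \<Rightarrow> ('b \<Rightarrow> 'e) \<Rightarrow> ('k, 'a \<times> 'b) qspace" where
  "qpullback A B f g =
     \<lparr>qcar = {p. fst p \<in> qcar A \<and> snd p \<in> qcar B \<and> f (fst p) = g (snd p)},
      qzero = (qzero A, qzero B),
      qadd = (\<lambda>p q. (qadd A (fst p) (fst q), qadd B (snd p) (snd q))),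
      qsmul = (\<lambda>c p. (qsmul A c (fst p), qsmul B c (snd p))),
      qnorm = (\<lambda>p. qnorm A (fst p) + qnorm B (snd p))\<rparr>"

lemma qpullback_simps [simp]:
  "qcar (qpullback A B f g) = {p. fst p \<in> qcar A \<and> snd p \<in> qcar B \<and> f (fst p) = g (snd p)}"
  "qzero (qpullback A B f g) = (qzero A, qzero B)"
  "qadd (qpullback A B f g) p q = (qadd A (fst p) (fst q), qadd B (snd p) (snd q))"
  "qsmul (qpullback A B f g) c p = (qsmul A c (fst p), qsmul B c (snd p))"
  "qnorm (qpullback A B f g) p = qnorm A (fst p) + qnorm B (snd p)"
  by (simp_all add: qpullback_def)

lemma qpullback_diff [simp]:
  "qdiff (qpullback A B f g) p q = (qdiff A (fst p) (fst q), qdiff B (snd p) (snd q))"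
  by (simp add: qdiff_def)

lemma qpullback_quasinormed:
  assumes A: "quasinormed A" and B: "quasinormed B" and E: "quasinormed E"
    and f: "qoperator A E f" and g: "qoperator B E g"
  shows "quasinormed (qpullback A B f g)"
proof (rule quasinormedI)
  note a = quasinormed_vspace[OF A] and b = quasinormed_vspace[OF B]
  note fl = qoperator_qlinear[OF f] and gl = qoperator_qlinear[OF g]
  show "vspace (qpullback A B f g)"
    unfolding vspace_def
    by (auto simp: vspace_zero[OF a] vspace_zero[OF b] vspace_add[OF a] vspace_add[OF b]
        vspace_smul[OF a] vspace_smul[OF b] vspace_assoc[OF a] vspace_assoc[OF b]
        vspace_zero_left[OF a] vspace_zero_left[OF b] vspace_diff_self[OF a] vspace_diff_self[OF b]
        vspace_smul_add[OF a] vspace_smul_add[OF b] vspace_add_smul[OF a] vspace_add_smul[OF b]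
        vspace_smul_smul[OF a] vspace_smul_smul[OF b] vspace_one[OF a] vspace_one[OF b]
        qlinear_zero[OF fl a quasinormed_vspace[OF E]] qlinear_zero[OF gl b quasinormed_vspace[OF E]]
        qlinear_add[OF fl] qlinear_add[OF gl] qlinear_smul[OF fl] qlinear_smul[OF gl]
        intro: vspace_comm[OF a] vspace_comm[OF b])
  show "0 \<le> qnorm (qpullback A B f g) p" if "p \<in> qcar (qpullback A B f g)" for p
    using that by (simp add: qnorm_nonneg[OF A] qnorm_nonneg[OF B])
  show "p = qzero (qpullback A B f g)"
    if "p \<in> qcar (qpullback A B f g)" "qnorm (qpullback A B f g) p = 0" for p
    using that qnorm_nonneg[OF A, of "fst p"] qnorm_nonneg[OF B, of "snd p"]
    by (auto simp: prod_eq_iff qnorm_eq_0[OF A, symmetric] qnorm_eq_0[OF B, symmetric])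
  show "qnorm (qpullback A B f g) (qsmul (qpullback A B f g) c p) = norm c * qnorm (qpullback A B f g) p"
    if "p \<in> qcar (qpullback A B f g)" for c p
    using that by (simp add: qnorm_smul[OF A] qnorm_smul[OF B] distrib_left)
  show "qnorm (qpullback A B f g) (qadd (qpullback A B f g) p q)
      \<le> (qmodulus A + qmodulus B) * (qnorm (qpullback A B f g) p + qnorm (qpullback A B f g) q)"
    if "p \<in> qcar (qpullback A B f g)" "q \<in> qcar (qpullback A B f g)" for p q
  proof -
    have in_AB: "fst p \<in> qcar A" "fst q \<in> qcar A" "snd p \<in> qcar B" "snd q \<in> qcar B"
      using that by auto
    have "0 \<le> qmodulus B * (qnorm A (fst p) + qnorm A (fst q))"
      "0 \<le> qmodulus A * (qnorm B (snd p) + qnorm B (snd q))"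
      using in_AB qmodulus_pos[OF A] qmodulus_pos[OF B]
      by (auto intro!: mult_nonneg_nonneg add_nonneg_nonneg qnorm_nonneg[OF A] qnorm_nonneg[OF B])
    then show ?thesis
      using qnorm_add_le[OF A in_AB(1,2)] qnorm_add_le[OF B in_AB(3,4)] by (simp add: algebra_simps)
  qed
qed

lemma
  assumes A: "quasinormed A" and B: "quasinormed B"
  shows qpullback_fst: "qoperator (qpullback A B f g) A fst"
    and qpullback_snd: "qoperator (qpullback A B f g) B snd"
  by (auto intro!: qoperatorI[where C = 1] simp: qnorm_nonneg[OF A] qnorm_nonneg[OF B])

lemma qpullback_Pair:
  assumes V: "quasinormed V" and a: "qoperator V A a" and b: "qoperator V B b"
    and eq: "\<And>v. v \<in> qcar V \<Longrightarrow> f (a v) = g (b v)"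
  shows "qoperator V (qpullback A B f g) (\<lambda>v. (a v, b v))"
proof -
  obtain C where C: "\<And>v. v \<in> qcar V \<Longrightarrow> qnorm A (a v) \<le> C * qnorm V v"
    using qoperator_bound[OF a V] by blast
  obtain D where D: "\<And>v. v \<in> qcar V \<Longrightarrow> qnorm B (b v) \<le> D * qnorm V v"
    using qoperator_bound[OF b V] by blast
  note al = qoperator_qlinear[OF a] and bl = qoperator_qlinear[OF b]
  show ?thesis
  proof (rule qoperatorI)
    show "qnorm (qpullback A B f g) (a v, b v) \<le> (C + D) * qnorm V v" if "v \<in> qcar V" for v
      using C[OF that] D[OF that] by (simp add: distrib_right)
  qed (simp_all add: eq qlinear_in[OF al] qlinear_in[OF bl] qlinear_add[OF al] qlinear_add[OF bl]
      qlinear_smul[OF al] qlinear_smul[OF bl])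
qed

text \<open>The defining equation passes to coordinatewise limits: \<open>f\<close> and
  \<open>g\<close> agree along the sequence, and limits in \<open>E\<close> are unique.\<close>

lemma qpullback_quasi_banach:
  assumes A: "quasi_banach A" and B: "quasi_banach B" and E: "quasinormed E"
    and f: "qoperator A E f" and g: "qoperator B E g"
  shows "quasi_banach (qpullback A B f g)"
proof -
  note qA = quasi_banach_quasinormed[OF A] and qB = quasi_banach_quasinormed[OF B]
  let ?W = "qpullback A B f g"
  note W = qpullback_quasinormed[OF qA qB E f g]
  have "\<exists>x\<in>qcar ?W. qlim ?W s x" if s: "qCauchy ?W s" for s
  proof -
    have s_in: "fst (s n) \<in> qcar A" "snd (s n) \<in> qcar B" "f (fst (s n)) = g (snd (s n))" for n
      using qCauchy_in[OF s, of n] by auto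
    obtain a where a: "a \<in> qcar A" "qlim A (\<lambda>n. fst (s n)) a"
      using quasi_banach_complete[OF A qoperator_qCauchy[OF W qA qpullback_fst[OF qA qB] s]] by blast
    obtain b where b: "b \<in> qcar B" "qlim B (\<lambda>n. snd (s n)) b"
      using quasi_banach_complete[OF B qoperator_qCauchy[OF W qB qpullback_snd[OF qA qB] s]] by blast
    have "qlim E (\<lambda>n. g (snd (s n))) (f a)"
      using qoperator_qlim[OF qA E f s_in(1) a] by (simp add: s_in(3))
    then have "f a = g b"
      by (rule qlim_unique[OF E qoperator_in[OF g s_in(2)] qoperator_in[OF f a(1)]
            qoperator_in[OF g b(1)] _ qoperator_qlim[OF qB E g s_in(2) b]])
    moreover have "qlim ?W s (a, b)"
      using tendsto_add[OF a(2)[unfolded qlim_def] b(2)[unfolded qlim_def]] by (simp add: qlim_def)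
    ultimately show ?thesis
      using a(1) b(1) by (intro bexI[of _ "(a, b)"]) auto
  qed
  with W show ?thesis
    by (simp add: quasi_banach_def)
qed

section \<open>Equivalence of four-term sequences\<close>

lemma exact4D:
  assumes "exact4 Y X S"
  shows "quasi_banach Y" "quasi_banach (E1 S)" "quasi_banach (E2 S)" "quasi_banach X"
    "qoperator Y (E1 S) (arr_in S)" "qoperator (E1 S) (E2 S) (arr_mid S)" "qoperator (E2 S) X (arr_out S)"
    "qker Y (E1 S) (arr_in S) = {qzero Y}" "qker (E1 S) (E2 S) (arr_mid S) = arr_in S ` qcar Y"
    "qker (E2 S) X (arr_out S) = arr_mid S ` qcar (E1 S)" "qcar X = arr_out S ` qcar (E2 S)"
  using assms unfolding exact4_def by auto

lemma zero4_exact: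
  assumes "quasi_banach Y" "quasi_banach X"
  shows "exact4 Y X (zero4 Y X)"
  using assms vspace_zero[OF quasi_banach_vspace[OF assms(1)]] vspace_zero[OF quasi_banach_vspace[OF assms(2)]]
  by (auto simp: exact4_def zero4_def qoperator_id quasi_banach_quasinormed qker_def intro!: qoperator_zero)

lemma arrow4_trans:
  assumes "arrow4 Y X S T" "arrow4 Y X T U"
  shows "arrow4 Y X S U"
proof -
  obtain u1 u2 where u: "qoperator (E1 S) (E1 T) u1" "qoperator (E2 S) (E2 T) u2" "commutes4 Y S T u1 u2"
    using assms(1) unfolding arrow4_def by blast
  obtain v1 v2 where v: "qoperator (E1 T) (E1 U) v1" "qoperator (E2 T) (E2 U) v2" "commutes4 Y T U v1 v2"
    using assms(2) unfolding arrow4_def by blast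
  have S: "exact4 Y X S" and T: "exact4 Y X T" and U: "exact4 Y X U"
    using assms by (auto simp: arrow4_def)
  note qn = exact4D(2,3)[OF S, THEN quasi_banach_quasinormed] exact4D(2,3)[OF T, THEN quasi_banach_quasinormed]
  have "qoperator (E1 S) (E1 U) (\<lambda>x. v1 (u1 x))" "qoperator (E2 S) (E2 U) (\<lambda>x. v2 (u2 x))"
    using qoperator_comp[OF u(1) v(1)] qoperator_comp[OF u(2) v(2)] qn by blast+
  moreover have "commutes4 Y S U (\<lambda>x. v1 (u1 x)) (\<lambda>x. v2 (u2 x))"
    using u(3) v(3) qoperator_in[OF u(1)] qoperator_in[OF u(2)] by (simp add: commutes4_def)
  ultimately show ?thesis
    using S U unfolding arrow4_def by blast
qed

lemma iso4_arrow4: "iso4 Y X S T \<Longrightarrow> arrow4 Y X S T"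
  unfolding iso4_def arrow4_def qiso_def by blast

text \<open>\<open>ext2_equiv\<close> supplies isomorphisms from a sequence to its copy; an arrow
  that starts at the copy requires their inverses.\<close>

lemma iso4_arrow4_inverse:
  assumes "iso4 Y X S T"
  shows "arrow4 Y X T S"
proof -
  obtain u1 u2 where u: "qiso (E1 S) (E1 T) u1" "qiso (E2 S) (E2 T) u2" "commutes4 Y S T u1 u2"
    and S: "exact4 Y X S" and T: "exact4 Y X T"
    using assms unfolding iso4_def by blast
  let ?v1 = "inv_into (qcar (E1 S)) u1" and ?v2 = "inv_into (qcar (E2 S)) u2"
  have b: "bij_betw u1 (qcar (E1 S)) (qcar (E1 T))" "bij_betw u2 (qcar (E2 S)) (qcar (E2 T))"
    using u by (auto simp: qiso_def)
  have v1: "?v1 (u1 e) = e" if "e \<in> qcar (E1 S)" for e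
    using b(1) that by (simp add: bij_betw_def)
  have v2: "?v2 (u2 e) = e" if "e \<in> qcar (E2 S)" for e
    using b(2) that by (simp add: bij_betw_def)
  have e1: "qcar (E1 T) = u1 ` qcar (E1 S)" and e2: "qcar (E2 T) = u2 ` qcar (E2 S)"
    using b by (auto simp: bij_betw_def)
  have "commutes4 Y T S ?v1 ?v2"
    unfolding commutes4_def e1 e2
  proof (intro conjI ballI)
    show "?v1 (arr_in T y) = arr_in S y" if "y \<in> qcar Y" for y
      using u(3) v1[of "arr_in S y"] that qoperator_in[OF exact4D(5)[OF S]] by (simp add: commutes4_def)
    show "?v2 (arr_mid T e) = arr_mid S (?v1 e)" if "e \<in> u1 ` qcar (E1 S)" for e
      using u(3) v1 v2 that qoperator_in[OF exact4D(6)[OF S]] by (force simp: commutes4_def)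
    show "arr_out S (?v2 e) = arr_out T e" if "e \<in> u2 ` qcar (E2 S)" for e
      using u(3) v2 that by (force simp: commutes4_def)
  qed
  then show ?thesis
    using S T u unfolding arrow4_def qiso_def by blast
qed

text \<open>Transport of structure into the universe type. The operations pass through
  \<open>inv_into (qcar V) h\<close>, so injectivity of \<open>h\<close> matters on the carrier
  only.\<close>

definition qcopy :: "('a \<Rightarrow> 'u) \<Rightarrow> ('k, 'a) qspace \<Rightarrow> ('k, 'u) qspace" where
  "qcopy h V =
     (let g = inv_into (qcar V) h
      in \<lparr>qcar = h ` qcar V, qzero = h (qzero V), qadd = (\<lambda>a b. h (qadd V (g a) (g b))),
          qsmul = (\<lambda>c a. h (qsmul V c (g a))), qnorm = (\<lambda>a. qnorm V (g a))\<rparr>)"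

lemma qcopy_simps:
  assumes "inj_on h (qcar V)"
  shows "qcar (qcopy h V) = h ` qcar V" "qzero (qcopy h V) = h (qzero V)"
    "x \<in> qcar V \<Longrightarrow> y \<in> qcar V \<Longrightarrow> qadd (qcopy h V) (h x) (h y) = h (qadd V x y)"
    "x \<in> qcar V \<Longrightarrow> qsmul (qcopy h V) c (h x) = h (qsmul V c x)"
    "x \<in> qcar V \<Longrightarrow> qnorm (qcopy h V) (h x) = qnorm V x"
  using assms by (simp_all add: qcopy_def Let_def)

lemma qcopy_quasi_banach:
  assumes h: "inj_on h (qcar V)" and V: "quasi_banach V"
  shows "quasi_banach (qcopy h V)"
proof -
  note v = quasi_banach_vspace[OF V] and qn = quasi_banach_quasinormed[OF V]
  note c = qcopy_simps[OF h]
  have d: "qdiff (qcopy h V) (h x) (h y) = h (qdiff V x y)" if "x \<in> qcar V" "y \<in> qcar V" for x y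
    using that by (simp add: qdiff_def c vspace_smul[OF v])
  have W: "quasinormed (qcopy h V)"
  proof (rule quasinormedI[where C = "qmodulus V"])
    show "vspace (qcopy h V)"
      unfolding vspace_def c(1,2)
      by (auto simp: c(3-) d vspace_zero[OF v] vspace_add[OF v] vspace_smul[OF v] vspace_assoc[OF v]
          vspace_zero_left[OF v] vspace_diff_self[OF v] vspace_smul_add[OF v] vspace_add_smul[OF v]
          vspace_smul_smul[OF v] vspace_one[OF v] intro: arg_cong[where f = h] vspace_comm[OF v])
  qed (auto simp: c qnorm_nonneg[OF qn] qnorm_eq_0[OF qn] qnorm_smul[OF qn] vspace_smul[OF v]
      vspace_add[OF v] intro!: qnorm_add_le[OF qn])
  have "\<exists>x\<in>qcar (qcopy h V). qlim (qcopy h V) s x" if s: "qCauchy (qcopy h V) s" for s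
  proof -
    have "\<exists>x. x \<in> qcar V \<and> s n = h x" for n
      using qCauchy_in[OF s, of n] by (auto simp: c)
    then obtain t where t: "\<And>n. t n \<in> qcar V" "\<And>n. s n = h (t n)"
      by metis
    have "qCauchy V t"
      using s t unfolding qCauchy_def by (auto simp: d c vspace_diff[OF v])
    then obtain x where x: "x \<in> qcar V" "qlim V t x"
      using quasi_banach_complete[OF V] by blast
    then have "qlim (qcopy h V) s (h x)"
      using t by (simp add: qlim_def d c vspace_diff[OF v])
    then show ?thesis
      using x by (auto simp: c)
  qed
  with W show ?thesis
    by (simp add: quasi_banach_def)
qed

lemma
  assumes h: "inj_on h (qcar V)" and V: "vspace V"
  shows qcopy_to: "qoperator V (qcopy h V) h"
    and qcopy_from: "qoperator (qcopy h V) V (inv_into (qcar V) h)"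
    and qcopy_qiso: "qiso V (qcopy h V) h"
proof -
  note c = qcopy_simps[OF h]
  show 1: "qoperator V (qcopy h V) h"
    by (rule qoperatorI[where C = 1]) (auto simp: c)
  show 2: "qoperator (qcopy h V) V (inv_into (qcar V) h)"
    by (rule qoperatorI[where C = 1]) (use h V in \<open>auto simp: c vspace_add vspace_smul\<close>)
  show "qiso V (qcopy h V) h"
    using 1 2 h by (simp add: qiso_def bij_betw_def c)
qed

text \<open>Only the middle spaces are transported. The ends \<open>Y\<close> and \<open>X\<close>
  stay on their own types, so the copy has the identities at both ends, as \<open>iso4\<close>
  demands.\<close>

lemma exact4_copy:
  fixes S :: "('k::real_normed_field, 'y, 'a, 'b, 'x) four_term" and h1 :: "'a \<Rightarrow> 'u" and h2 :: "'b \<Rightarrow> 'u"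
  assumes S: "exact4 Y X S" and h1: "inj_on h1 (qcar (E1 S))" and h2: "inj_on h2 (qcar (E2 S))"
  shows "\<exists>S' :: ('k, 'y, 'u, 'u, 'x) four_term. iso4 Y X S S'"
proof -
  let ?g1 = "inv_into (qcar (E1 S)) h1" and ?g2 = "inv_into (qcar (E2 S)) h2"
  define S' :: "('k, 'y, 'u, 'u, 'x) four_term" where
    "S' = \<lparr>E1 = qcopy h1 (E1 S), E2 = qcopy h2 (E2 S), arr_in = (\<lambda>y. h1 (arr_in S y)),
           arr_mid = (\<lambda>e. h2 (arr_mid S (?g1 e))), arr_out = (\<lambda>e. arr_out S (?g2 e))\<rparr>"
  note D = exact4D[OF S]
  note vs = quasi_banach_vspace[OF D(2)] quasi_banach_vspace[OF D(3)]
  note qn = D(1-4)[THEN quasi_banach_quasinormed]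
  note qb = qcopy_quasi_banach[OF h1 D(2)] qcopy_quasi_banach[OF h2 D(3)]
  note qn' = qb[THEN quasi_banach_quasinormed]
  note op = qcopy_to[OF h1 vs(1)] qcopy_from[OF h1 vs(1)] qcopy_to[OF h2 vs(2)] qcopy_from[OF h2 vs(2)]
  note c1 = qcopy_simps[OF h1] and c2 = qcopy_simps[OF h2]
  have g1: "?g1 (h1 e) = e" if "e \<in> qcar (E1 S)" for e
    using h1 that by simp
  have g2: "?g2 (h2 e) = e" if "e \<in> qcar (E2 S)" for e
    using h2 that by simp
  have i1: "h1 e = h1 (qzero (E1 S)) \<longleftrightarrow> e = qzero (E1 S)" if "e \<in> qcar (E1 S)" for e
    using h1 that vspace_zero[OF vs(1)] by (auto simp: inj_on_def)
  have i2: "h2 e = h2 (qzero (E2 S)) \<longleftrightarrow> e = qzero (E2 S)" if "e \<in> qcar (E2 S)" for e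
    using h2 that vspace_zero[OF vs(2)] by (auto simp: inj_on_def)
  have "exact4 Y X S'"
    unfolding exact4_def
  proof (intro conjI)
    show "qoperator Y (E1 S') (arr_in S')"
      using qoperator_comp[OF D(5) op(1) qn(1,2)] by (simp add: S'_def)
    show "qoperator (E1 S') (E2 S') (arr_mid S')"
      using qoperator_comp[OF qoperator_comp[OF op(2) D(6) qn'(1) qn(2)] op(3) qn'(1) qn(3)]
      by (simp add: S'_def)
    show "qoperator (E2 S') X (arr_out S')"
      using qoperator_comp[OF op(4) D(7) qn'(2) qn(3)] by (simp add: S'_def)
    show "qker Y (E1 S') (arr_in S') = {qzero Y}"
      using D(8) i1 qoperator_in[OF D(5)] by (auto simp: qker_def S'_def c1)
    have "qker (E1 S') (E2 S') (arr_mid S') = h1 ` qker (E1 S) (E2 S) (arr_mid S)"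
      using i2 qoperator_in[OF D(6)] g1 by (auto simp: qker_def S'_def c1 c2)
    then show "qker (E1 S') (E2 S') (arr_mid S') = arr_in S' ` qcar Y"
      by (simp add: D(9) S'_def image_image)
    have "qker (E2 S') X (arr_out S') = h2 ` qker (E2 S) X (arr_out S)"
      using g2 by (auto simp: qker_def S'_def c2)
    moreover have "arr_mid S' ` qcar (E1 S') = h2 ` arr_mid S ` qcar (E1 S)"
      by (simp add: S'_def c1 image_image g1 cong: image_cong)
    ultimately show "qker (E2 S') X (arr_out S') = arr_mid S' ` qcar (E1 S')"
      by (simp add: D(10))
    have "arr_out S' ` qcar (E2 S') = arr_out S ` qcar (E2 S)"
      by (simp add: S'_def c2 image_image g2 cong: image_cong)
    then show "qcar X = arr_out S' ` qcar (E2 S')"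
      using D(11) by simp
  qed (use D qb in \<open>auto simp: S'_def\<close>)
  moreover have "commutes4 Y S S' h1 h2"
    using g1 g2 by (simp add: commutes4_def S'_def)
  moreover have "qiso (E1 S) (E1 S') h1" "qiso (E2 S) (E2 S') h2"
    using qcopy_qiso[OF h1 vs(1)] qcopy_qiso[OF h2 vs(2)] by (simp_all add: S'_def)
  ultimately show ?thesis
    using S unfolding iso4_def by blast
qed

text \<open>Two arrows into a common \<open>R\<close> already form a zigzag. It has to run inside
  \<open>'u\<close>, where \<open>S\<close>, \<open>R\<close> and the zero sequence each have two
  middle spaces to embed; hence the six injections.\<close>

lemma ext2_trivialI:
  fixes S :: "('k::real_normed_field, 'y, 'a, 'b, 'x) four_term" and R :: "('k, 'y, 'c, 'd, 'x) four_term"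
    and h1 :: "'a \<Rightarrow> 'u" and h2 :: "'b \<Rightarrow> 'u" and h3 :: "'c \<Rightarrow> 'u" and h4 :: "'d \<Rightarrow> 'u"
    and h5 :: "'y \<Rightarrow> 'u" and h6 :: "'x \<Rightarrow> 'u"
  assumes SR: "arrow4 Y X S R" and ZR: "arrow4 Y X (zero4 Y X) R"
    and "inj_on h1 (qcar (E1 S))" "inj_on h2 (qcar (E2 S))" "inj_on h3 (qcar (E1 R))"
    and "inj_on h4 (qcar (E2 R))" "inj_on h5 (qcar Y)" "inj_on h6 (qcar X)"
  shows "ext2_trivial TYPE('u) Y X S"
proof -
  have ex: "exact4 Y X S" "exact4 Y X R" "exact4 Y X (zero4 Y X)"
    using SR ZR by (auto simp: arrow4_def)
  obtain S' :: "('k, 'y, 'u, 'u, 'x) four_term" where S': "iso4 Y X S S'"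
    using exact4_copy[OF ex(1)] assms by blast
  obtain R' :: "('k, 'y, 'u, 'u, 'x) four_term" where R': "iso4 Y X R R'"
    using exact4_copy[OF ex(2)] assms by blast
  obtain O' :: "('k, 'y, 'u, 'u, 'x) four_term" where O': "iso4 Y X (zero4 Y X) O'"
    using exact4_copy[OF ex(3), of h5 h6] assms by (auto simp: zero4_def)
  have "arrow4 Y X S' R'"
    by (rule arrow4_trans[OF iso4_arrow4_inverse[OF S'] arrow4_trans[OF SR iso4_arrow4[OF R']]])
  moreover have "arrow4 Y X O' R'"
    by (rule arrow4_trans[OF iso4_arrow4_inverse[OF O'] arrow4_trans[OF ZR iso4_arrow4[OF R']]])
  ultimately have "equivclp (arrow4 Y X) S' O'"
    by (meson equivclp_sym equivclp_trans r_into_equivclp)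
  then show ?thesis
    unfolding ext2_trivial_def ext2_equiv_def using S' O' by blast
qed

text \<open>If the extension \<open>0 \<rightarrow> Y \<rightarrow> E1 \<rightarrow> E1/Y \<rightarrow> 0\<close> extends along the inclusion \<open>E1/Y \<rightarrow> E2\<close> to an extension
  \<open>0 \<rightarrow> Y \<rightarrow> W \<rightarrow> E2 \<rightarrow> 0\<close>, then both the sequence and the zero sequence map to
  \<open>0 \<rightarrow> Y \<rightarrow> W \<rightarrow> E2 \<oplus> X \<rightarrow> X \<rightarrow> 0\<close>. The direct sum is a pullback over zero maps.\<close>

definition extended4 where
  "extended4 X S W k \<rho> =
     \<lparr>E1 = W, E2 = qpullback (E2 S) X (\<lambda>_. qzero X) (\<lambda>_. qzero X), arr_in = (\<lambda>y. k (arr_in S y)),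
      arr_mid = (\<lambda>w. (\<rho> w, qzero X)), arr_out = snd\<rparr>"

lemma extended4_arrows:
  fixes Y :: "('k::real_normed_field, 'y) qspace"
  assumes S: "exact4 Y X S" and W: "quasi_banach W"
    and k: "qoperator (E1 S) W k" and \<rho>: "qoperator W (E2 S) \<rho>"
    and \<rho>_surj: "\<rho> ` qcar W = qcar (E2 S)"
    and \<rho>_k: "\<And>e. e \<in> qcar (E1 S) \<Longrightarrow> \<rho> (k e) = arr_mid S e"
    and \<rho>_ker: "qker W (E2 S) \<rho> = (\<lambda>y. k (arr_in S y)) ` qcar Y"
    and k_inj: "qker Y W (\<lambda>y. k (arr_in S y)) = {qzero Y}"
  shows "arrow4 Y X S (extended4 X S W k \<rho>)" "arrow4 Y X (zero4 Y X) (extended4 X S W k \<rho>)"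
proof -
  note D = exact4D[OF S]
  note qn = D(1-4)[THEN quasi_banach_quasinormed] and qW = quasi_banach_quasinormed[OF W]
  note vs = D(1-4)[THEN quasi_banach_vspace]
  define F where "F = qpullback (E2 S) X (\<lambda>_. qzero X) (\<lambda>_. qzero X)"
  have F: "quasi_banach F"
    unfolding F_def using qn by (intro qpullback_quasi_banach[where E = X] D qoperator_zero)
  define R where "R = extended4 X S W k \<rho>"
  have R: "E1 R = W" "E2 R = F" "arr_in R = (\<lambda>y. k (arr_in S y))" "arr_mid R = (\<lambda>w. (\<rho> w, qzero X))"
    "arr_out R = snd"
    by (simp_all add: R_def extended4_def F_def)
  have ki: "qoperator Y W (\<lambda>y. k (arr_in S y))"
    by (rule qoperator_comp[OF D(5) k qn(1,2)])
  have ex: "exact4 Y X R"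
    unfolding exact4_def R
  proof (intro conjI D F W ki k_inj)
    show "qoperator W F (\<lambda>w. (\<rho> w, qzero X))"
      unfolding F_def by (intro qpullback_Pair qW \<rho> qoperator_zero qn refl)
    show "qoperator F X snd"
      unfolding F_def by (intro qpullback_snd qn)
    have "qker W F (\<lambda>w. (\<rho> w, qzero X)) = qker W (E2 S) \<rho>"
      by (auto simp: qker_def F_def)
    then show "qker W F (\<lambda>w. (\<rho> w, qzero X)) = (\<lambda>y. k (arr_in S y)) ` qcar Y"
      using \<rho>_ker by simp
    have "(\<lambda>w. (\<rho> w, qzero X)) ` qcar W = (\<lambda>e. (e, qzero X)) ` qcar (E2 S)"
      unfolding \<rho>_surj[symmetric] image_image ..
    then show "qker F X snd = (\<lambda>w. (\<rho> w, qzero X)) ` qcar W"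
      using vspace_zero[OF vs(4)] by (auto simp: qker_def F_def)
    show "qcar X = snd ` qcar F"
      using vspace_zero[OF vs(3)] by (auto simp: F_def image_def Bex_def)
  qed
  \<comment> \<open>The second component makes the projection to \<open>X\<close> restrict to
    \<open>arr_out S\<close>. It vanishes on the range of \<open>arr_mid S\<close> by exactness, so
    the middle square commutes with an \<open>arr_mid\<close> that has second component
    zero.\<close>
  have "qoperator (E2 S) F (\<lambda>e. (e, arr_out S e))"
    unfolding F_def by (intro qpullback_Pair qn qoperator_id D refl)
  moreover have "commutes4 Y S R k (\<lambda>e. (e, arr_out S e))"
    using D(10) \<rho>_k by (auto simp: commutes4_def R qker_def)
  ultimately show "arrow4 Y X S (extended4 X S W k \<rho>)"
    using ex S k unfolding arrow4_def R_def[symmetric] R(1,2) by blast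
  have "qoperator X F (\<lambda>x. (qzero (E2 S), x))"
    unfolding F_def by (intro qpullback_Pair qn qoperator_id qoperator_zero refl)
  \<comment> \<open>The middle arrow of the zero sequence is zero, so its middle square asks that
    \<open>Y\<close> die in \<open>E2 S\<close>.\<close>
  moreover have "\<rho> (k (arr_in S y)) = qzero (E2 S)" if "y \<in> qcar Y" for y
    using that \<rho>_ker by (auto simp: qker_def)
  then have "commutes4 Y (zero4 Y X) R (\<lambda>y. k (arr_in S y)) (\<lambda>x. (qzero (E2 S), x))"
    by (auto simp: commutes4_def R zero4_def)
  ultimately show "arrow4 Y X (zero4 Y X) (extended4 X S W k \<rho>)"
    using ex zero4_exact[OF D(1,4)] ki unfolding arrow4_def R_def[symmetric] R(1,2)
    by (auto simp: zero4_def)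
qed

section \<open>A triviality criterion for spliced sequences\<close>

text \<open>Invariance of \<open>\<Phi>\<close> under \<open>P\<close> makes
  \<open>(y, e) \<mapsto> (y, P e)\<close> bounded, which gives an operator \<open>\<theta>\<close>
  on \<open>Z(\<Phi>)\<close> over \<open>P\<close> that fixes \<open>Y\<close>. Writing
  \<open>P e = P (e - \<Psi> x) + L x\<close> bounds \<open>(e, x) \<mapsto> P e\<close>, which
  extends \<open>P\<close> to an operator \<open>pt\<close> on \<open>Z(\<Psi>)\<close>. The
  inclusion of \<open>qcar W\<close> in a product is recorded for the encoding of \<open>W\<close>
  in the universe.\<close>

lemma splice4_arrows:
  fixes Y :: "('k::real_normed_field, 'y) qspace"
  assumes \<Phi>: "twisted_sum Y E E0 \<Phi>" and \<Psi>: "twisted_sum E X X0 \<Psi>"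
    and P: "qoperator E E P" and P0: "\<And>e. e \<in> E0 \<Longrightarrow> P e \<in> E0" and \<Phi>P: "\<And>e. e \<in> E0 \<Longrightarrow> \<Phi> (P e) = \<Phi> e"
    and L: "qoperator X E L" and P\<Psi>: "\<And>x. x \<in> X0 \<Longrightarrow> P (\<Psi> x) = L x"
  defines "S \<equiv> splice4 Y E X E0 \<Phi> X0 \<Psi>"
  obtains W :: "('k, (nat \<Rightarrow> 'y \<times> 'e) set \<times> (nat \<Rightarrow> 'e \<times> 'x) set) qspace" and k \<rho>
  where "qcar W \<subseteq> qcar (E1 S) \<times> qcar (E2 S)"
    and "arrow4 Y X S (extended4 X S W k \<rho>)" "arrow4 Y X (zero4 Y X) (extended4 X S W k \<rho>)"
proof -
  interpret A: twisted_sum Y E E0 \<Phi> by fact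
  interpret B: twisted_sum E X X0 \<Psi> by fact
  let ?q = "Zproj E"
  note qE = A.qn_X and vE = A.vs_X
  obtain K where K: "0 \<le> K" "\<And>e. e \<in> qcar E \<Longrightarrow> qnorm E (P e) \<le> K * qnorm E e"
    using qoperator_bound[OF P qE] by blast
  obtain M where M: "0 \<le> M" "\<And>x. x \<in> qcar X \<Longrightarrow> qnorm E (L x) \<le> M * qnorm X x"
    using qoperator_bound[OF L B.qn_X] by blast
  have Pl: "qlinear E E P"
    by (rule qoperator_qlinear[OF P])
  have P_zero: "P (qzero E) = qzero E"
    by (rule qlinear_zero[OF Pl vE vE])
  define \<theta>0 where "\<theta>0 p = (fst p, P (snd p))" for p :: "'y \<times> 'e"
  have \<theta>0: "qoperator A.V A.V \<theta>0"
  proof (rule qoperatorI)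
    fix p assume "p \<in> qcar A.V"
    then have p: "fst p \<in> qcar Y" "snd p \<in> E0" "snd p \<in> qcar E"
      by (auto simp: A.X0_in)
    let ?a = "qnorm Y (qdiff Y (fst p) (\<Phi> (snd p)))" and ?b = "qnorm E (snd p)"
    have nn: "0 \<le> K * ?a" "0 \<le> ?b"
      using K(1) p by (auto intro!: mult_nonneg_nonneg qnorm_diff_nonneg A.qn_Y A.\<Phi>_in qnorm_nonneg[OF qE])
    have "qnorm A.V (\<theta>0 p) = ?a + qnorm E (P (snd p))"
      using p by (simp add: \<theta>0_def \<Phi>P)
    also have "\<dots> \<le> (1 + K) * (?a + ?b)"
      using K(2)[OF p(3)] nn by (simp add: algebra_simps)
    finally show "qnorm A.V (\<theta>0 p) \<le> (1 + K) * qnorm A.V p"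
      by simp
  qed (auto simp: \<theta>0_def P0 qlinear_add[OF Pl] qlinear_smul[OF Pl] A.X0_in)
  define \<theta> where "\<theta> = clift A.Z (\<lambda>p. cemb A.V (\<theta>0 p))"
  have e\<theta>0: "qoperator A.V A.Z (\<lambda>p. cemb A.V (\<theta>0 p))"
    unfolding Zsp_def
    by (rule qoperator_comp[OF \<theta>0 cemb_qoperator]) (rule A.twisted_quasinormed)+
  have \<theta>: "qoperator A.Z A.Z \<theta>"
    using clift_qoperator[OF A.twisted_quasinormed A.Zsp_quasi_banach e\<theta>0] by (simp add: \<theta>_def Zsp_def)
  have \<theta>_inc: "\<theta> (A.inc y) = A.inc y" if "y \<in> qcar Y" for y
    using clift_cemb[OF A.twisted_quasinormed A.Zsp_quasi_banach e\<theta>0, of "(y, qzero E)"] that A.X0_zero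
    by (simp add: \<theta>_def A.Zinc_cemb \<theta>0_def P_zero)
  \<comment> \<open>Both sides are the limit of \<open>P (snd (s n))\<close> along a representative
    \<open>s\<close> of \<open>a\<close>.\<close>
  have q\<theta>: "?q (\<theta> a) = P (?q a)" if a: "a \<in> qcar A.Z" for a
  proof -
    have a': "a \<in> qcar (completion A.V)"
      using a by (simp add: Zsp_def)
    obtain s where s: "s \<in> a" "qCauchy A.V s"
      using crep_in[OF A.twisted_quasinormed a'] completion_mem(1)[OF A.twisted_quasinormed a'] by blast
    note s_in = qCauchy_in[OF s(2)]
    have snd_in: "snd (s n) \<in> E0" for n
      using s_in[of n] by auto
    have e_in: "cemb A.V (\<theta>0 (s n)) \<in> qcar A.Z" for n
      by (rule qoperator_in[OF e\<theta>0 s_in])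
    have "qlim A.Z (\<lambda>n. cemb A.V (\<theta>0 (s n))) (\<theta> a)"
      unfolding \<theta>_def by (rule clift_qlim[OF A.twisted_quasinormed A.Zsp_quasi_banach e\<theta>0 a' s(1)])
    from qoperator_qlim[OF A.qn_Z qE A.Zproj_qoperator e_in qoperator_in[OF \<theta> a] this]
    have 1: "qlim E (\<lambda>n. P (snd (s n))) (?q (\<theta> a))"
      unfolding A.Zproj_clift clift_cemb[OF A.twisted_quasinormed A.X A.snd_qoperator qoperator_in[OF \<theta>0 s_in]]
      by (simp add: \<theta>0_def)
    have "qlim E (\<lambda>n. snd (s n)) (?q a)"
      unfolding A.Zproj_clift by (rule clift_qlim[OF A.twisted_quasinormed A.X A.snd_qoperator a' s(1)])
    from qoperator_qlim[OF qE qE P A.X0_in[OF snd_in] qoperator_in[OF A.Zproj_qoperator a] this]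
    have 2: "qlim E (\<lambda>n. P (snd (s n))) (P (?q a))" .
    show ?thesis
      by (rule qlim_unique[OF qE _ _ _ 1 2])
        (auto intro: qoperator_in[OF P] A.X0_in snd_in qoperator_in[OF A.Zproj_qoperator] qoperator_in[OF \<theta>] a)
  qed
  define p0 where "p0 = (\<lambda>p :: 'e \<times> 'x. P (fst p))"
  have p0: "qoperator B.V E p0"
  proof (rule qoperatorI)
    fix p assume "p \<in> qcar B.V"
    then have p: "fst p \<in> qcar E" "snd p \<in> X0" "snd p \<in> qcar X" "\<Psi> (snd p) \<in> qcar E"
      by (auto simp: B.X0_in B.\<Phi>_in)
    let ?a = "qnorm E (qdiff E (fst p) (\<Psi> (snd p)))" and ?b = "qnorm X (snd p)" and ?C = "qmodulus E"
    have C: "0 < ?C"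
      by (rule qmodulus_pos[OF qE])
    have nn: "0 \<le> M * ?a" "0 \<le> K * ?b"
      using K(1) M(1) p by (auto intro!: mult_nonneg_nonneg qnorm_diff_nonneg qE qnorm_nonneg[OF B.qn_X])
    have "qnorm E (qdiff E (P (fst p)) (P (\<Psi> (snd p)))) \<le> K * ?a"
      using K(2)[OF vspace_diff[OF vE p(1,4)]] qlinear_diff[OF Pl vE p(1,4)] by simp
    moreover have "qnorm E (P (\<Psi> (snd p))) \<le> M * ?b"
      using M(2)[OF p(3)] P\<Psi>[OF p(2)] by simp
    ultimately have "qnorm E (P (fst p)) \<le> ?C * (K * ?a + M * ?b)"
      using qnorm_le_diff[OF qE qoperator_in[OF P p(1)] qoperator_in[OF P p(4)]] C
      by (smt (verit) mult_left_mono)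
    also have "\<dots> \<le> ?C * ((K + M) * (?a + ?b))"
      using C nn by (intro mult_left_mono) (auto simp: algebra_simps)
    finally show "qnorm E (p0 p) \<le> (?C * (K + M)) * qnorm B.V p"
      by (simp add: mult.assoc p0_def)
  qed (auto simp: p0_def qlinear_in[OF Pl] qlinear_add[OF Pl] qlinear_smul[OF Pl])
  define pt where "pt = clift E p0"
  have pt: "qoperator B.Z E pt"
    using clift_qoperator[OF B.twisted_quasinormed B.Y p0] by (simp add: pt_def Zsp_def)
  have pt_inc: "pt (B.inc e) = P e" if "e \<in> qcar E" for e
    using clift_cemb[OF B.twisted_quasinormed B.Y p0, of "(e, qzero X)"] that B.X0_zero
    by (simp add: pt_def B.Zinc_cemb p0_def)
  \<comment> \<open>The extension of \<open>Z(\<Psi>)\<close> by \<open>Y\<close>: the quotient map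
    of \<open>Z(\<Phi>)\<close> pulled back along \<open>pt\<close>.\<close>
  define W where "W = qpullback A.Z B.Z ?q pt"
  have W: "quasi_banach W"
    unfolding W_def
    by (intro qpullback_quasi_banach[where E = E] A.Zsp_quasi_banach B.Zsp_quasi_banach qE A.Zproj_qoperator pt)
  \<comment> \<open>The second component is dictated by the middle arrow of the splice. The first
    must then lie over \<open>pt (B.inc (?q a)) = P (?q a)\<close>, which \<open>\<theta> a\<close>
    does by \<open>q\<theta>\<close>.\<close>
  define k where "k a = (\<theta> a, B.inc (?q a))" for a
  have iq: "qoperator A.Z B.Z (\<lambda>a. B.inc (?q a))"
    by (rule qoperator_comp[OF A.Zproj_qoperator B.Zinc_qoperator A.qn_Z qE])
  have k: "qoperator A.Z W k"
    unfolding W_def k_def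
    by (intro qpullback_Pair A.qn_Z \<theta> iq) (simp add: q\<theta> pt_inc qoperator_in[OF A.Zproj_qoperator])
  have \<rho>: "qoperator W B.Z snd"
    unfolding W_def by (intro qpullback_snd A.qn_Z B.qn_Z)
  have S: "E1 S = A.Z" "E2 S = B.Z" "arr_in S = A.inc" "arr_mid S = (\<lambda>a. B.inc (?q a))"
    by (simp_all add: S_def splice4_def)
  have k_inc: "k (A.inc y) = (A.inc y, qzero B.Z)" if "y \<in> qcar Y" for y
    using that by (simp add: k_def \<theta>_inc A.Zproj_inc B.Zinc_eq_zero_iff vspace_zero[OF vE])
  have pt_zero: "pt (qzero B.Z) = qzero E"
    by (rule qlinear_zero[OF qoperator_qlinear[OF pt] B.vs_Z vE])
  have "snd ` qcar W = qcar B.Z"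
  proof
    show "qcar B.Z \<subseteq> snd ` qcar W"
    proof
      fix b assume b: "b \<in> qcar B.Z"
      then obtain a where "a \<in> qcar A.Z" "?q a = pt b"
        using A.Zproj_surj qoperator_in[OF pt b] by (metis imageE)
      with b show "b \<in> snd ` qcar W"
        by (intro image_eqI[of _ _ "(a, b)"]) (auto simp: W_def)
    qed
  qed (auto simp: W_def)
  moreover have "qker W B.Z snd = (\<lambda>y. k (A.inc y)) ` qcar Y"
  proof -
    have "qker W B.Z snd = (\<lambda>a. (a, qzero B.Z)) ` qker A.Z E ?q"
      using vspace_zero[OF B.vs_Z] by (auto simp: qker_def W_def pt_zero)
    then show ?thesis
      by (simp add: A.Zproj_kernel image_image k_inc cong: image_cong)
  qed
  moreover have "qker Y W (\<lambda>y. k (A.inc y)) = {qzero Y}"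
    using vspace_zero[OF A.vs_Y] A.Zinc_eq_zero_iff by (auto simp: qker_def k_inc W_def)
  moreover have "snd (k e) = B.inc (?q e)" for e
    by (simp add: k_def)
  moreover have "exact4 Y X S"
    unfolding S_def by (rule splice4_exact[OF \<Phi> \<Psi>])
  ultimately have "arrow4 Y X S (extended4 X S W k snd)" "arrow4 Y X (zero4 Y X) (extended4 X S W k snd)"
    using W k \<rho> by (intro extended4_arrows; simp add: S)+
  moreover have "qcar W \<subseteq> qcar (E1 S) \<times> qcar (E2 S)"
    by (auto simp: W_def S)
  ultimately show ?thesis
    using that by blast
qed

section \<open>The space \<open>\<ell>\<^sub>2\<close>\<close>

lemma norm_add_square_le: "(norm (a + b :: 'a::real_normed_vector))\<^sup>2 \<le> 2 * ((norm a)\<^sup>2 + (norm b)\<^sup>2)"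
proof -
  have "(norm (a + b))\<^sup>2 \<le> (norm a + norm b)\<^sup>2"
    by (simp add: norm_triangle_ineq power_mono)
  also have "\<dots> \<le> 2 * ((norm a)\<^sup>2 + (norm b)\<^sup>2)"
    using zero_le_power2[of "norm a - norm b"] by (simp add: power2_eq_square algebra_simps)
  finally show ?thesis .
qed

text \<open>By \<open>A + B \<le> (sqrt A + sqrt B)^2\<close>. It lets quasinorm estimates on
  square-summable families be made on the squares.\<close>

lemma sqrt_le_quasi:
  assumes "0 \<le> A" "0 \<le> B" "0 \<le> c" "S \<le> c\<^sup>2 * (A + B)"
  shows "sqrt S \<le> c * (sqrt A + sqrt B)"
proof -
  have "A + B \<le> (sqrt A + sqrt B)\<^sup>2"
    using assms by (simp add: power2_sum)
  then have "c\<^sup>2 * (A + B) \<le> (c * (sqrt A + sqrt B))\<^sup>2"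
    by (simp add: power_mult_distrib mult_left_mono)
  with assms(4) have "S \<le> (c * (sqrt A + sqrt B))\<^sup>2"
    by simp
  then show ?thesis
    using assms by (intro real_le_lsqrt) auto
qed

lemma l2_summable_add:
  fixes x y :: "nat \<Rightarrow> 'k::real_normed_field"
  assumes "summable (\<lambda>n. (norm (x n))\<^sup>2)" "summable (\<lambda>n. (norm (y n))\<^sup>2)"
  shows "summable (\<lambda>n. (norm (x n + y n))\<^sup>2)"
    "(\<Sum>n. (norm (x n + y n))\<^sup>2) \<le> 2 * ((\<Sum>n. (norm (x n))\<^sup>2) + (\<Sum>n. (norm (y n))\<^sup>2))"
proof -
  let ?g = "\<lambda>n. 2 * ((norm (x n))\<^sup>2 + (norm (y n))\<^sup>2)"
  have s: "summable ?g"
    by (intro summable_mult summable_add assms)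
  show 1: "summable (\<lambda>n. (norm (x n + y n))\<^sup>2)"
    by (rule summable_comparison_test'[OF s, of 0]) (use norm_add_square_le in auto)
  have "(\<Sum>n. (norm (x n + y n))\<^sup>2) \<le> suminf ?g"
    by (intro suminf_le norm_add_square_le 1 s)
  also have "\<dots> = 2 * ((\<Sum>n. (norm (x n))\<^sup>2) + (\<Sum>n. (norm (y n))\<^sup>2))"
    by (simp only: suminf_mult[OF summable_add[OF assms]] suminf_add[OF assms])
  finally show "(\<Sum>n. (norm (x n + y n))\<^sup>2) \<le> 2 * ((\<Sum>n. (norm (x n))\<^sup>2) + (\<Sum>n. (norm (y n))\<^sup>2))" .
qed

lemma l2_quasinormed: "quasinormed (l2 :: ('k::real_normed_field, _) qspace)"
proof (rule quasinormedI)
  show "vspace (l2 :: ('k, _) qspace)"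
    unfolding vspace_def
    by (auto simp: l2_def qdiff_def l2_summable_add norm_mult power_mult_distrib summable_mult algebra_simps)
next
  fix x :: "nat \<Rightarrow> 'k"
  assume x: "x \<in> qcar l2"
  then have s: "summable (\<lambda>n. (norm (x n))\<^sup>2)"
    by (simp add: l2_def)
  show "0 \<le> qnorm l2 x"
    by (simp add: l2_def suminf_nonneg[OF s])
  show "x = qzero l2" if "qnorm l2 x = 0"
    using that suminf_eq_zero_iff[OF s] by (auto simp: l2_def suminf_nonneg[OF s])
  show "qnorm l2 (qsmul l2 c x) = norm c * qnorm l2 x" for c
    by (simp add: l2_def norm_mult power_mult_distrib suminf_mult[OF s] real_sqrt_mult)
  fix y :: "nat \<Rightarrow> 'k"
  assume "y \<in> qcar l2"
  then have t: "summable (\<lambda>n. (norm (y n))\<^sup>2)"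
    by (simp add: l2_def)
  \<comment> \<open>The factor 2 on squares is enlarged to a perfect square to fit
    \<open>sqrt_le_quasi\<close>; a quasinorm allows any constant.\<close>
  have "(\<Sum>n. (norm (x n + y n))\<^sup>2) \<le> 2\<^sup>2 * ((\<Sum>n. (norm (x n))\<^sup>2) + (\<Sum>n. (norm (y n))\<^sup>2))"
    using l2_summable_add(2)[OF s t] suminf_nonneg[OF s] suminf_nonneg[OF t] by simp
  then show "qnorm l2 (qadd l2 x y) \<le> 2 * (qnorm l2 x + qnorm l2 y)"
    unfolding l2_def qspace.simps by (intro sqrt_le_quasi suminf_nonneg s t) auto
qed

text \<open>Coordinatewise limits exist because the scalars are complete. The Cauchy estimate is
  carried to the limit on finite partial sums, with a bound independent of their length, and summed
  only afterwards.\<close>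

lemma l2_quasi_banach: "quasi_banach (l2 :: ('k::{real_normed_field, banach}, _) qspace)"
  unfolding quasi_banach_def
proof (intro conjI allI impI l2_quasinormed)
  fix s :: "nat \<Rightarrow> nat \<Rightarrow> 'k"
  assume s: "qCauchy l2 s"
  have s_in: "s n \<in> qcar l2" for n
    by (rule qCauchy_in[OF s])
  have diff_in: "summable (\<lambda>i. (norm (s m i - s n i))\<^sup>2)" for m n
    using vspace_diff[OF quasinormed_vspace[OF l2_quasinormed] s_in s_in, of m n] by (simp add: l2_def qdiff_def)
  have partial: "\<exists>N. \<forall>m\<ge>N. \<forall>n\<ge>N. \<forall>k. (\<Sum>i<k. (norm (s m i - s n i))\<^sup>2) \<le> e\<^sup>2" if "e > 0" for e
  proof -
    obtain N where N: "\<forall>m\<ge>N. \<forall>n\<ge>N. qnorm l2 (qdiff l2 (s m) (s n)) < e"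
      using s \<open>e > 0\<close> unfolding qCauchy_def by blast
    have "(\<Sum>i<k. (norm (s m i - s n i))\<^sup>2) \<le> e\<^sup>2" if "m \<ge> N" "n \<ge> N" for m n k
    proof -
      have "(\<Sum>i<k. (norm (s m i - s n i))\<^sup>2) \<le> (\<Sum>i. (norm (s m i - s n i))\<^sup>2)"
        by (intro sum_le_suminf diff_in) auto
      also have "sqrt \<dots> < e"
        using N that by (simp add: l2_def qdiff_def)
      then have "(\<Sum>i. (norm (s m i - s n i))\<^sup>2) \<le> e\<^sup>2"
        using suminf_nonneg[OF diff_in[of m n]] by (intro sqrt_le_D) auto
      finally show ?thesis .
    qed
    then show ?thesis
      by blast
  qed
  have "Cauchy (\<lambda>n. s n i)" for i
  proof (rule metric_CauchyI)
    fix e :: real assume "e > 0"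
    then obtain N where N: "\<forall>m\<ge>N. \<forall>n\<ge>N. \<forall>k. (\<Sum>i<k. (norm (s m i - s n i))\<^sup>2) \<le> (e / 2)\<^sup>2"
      using partial[of "e / 2"] by auto
    have "dist (s m i) (s n i) < e" if "m \<ge> N" "n \<ge> N" for m n
    proof -
      have "(norm (s m i - s n i))\<^sup>2 \<le> (\<Sum>i<Suc i. (norm (s m i - s n i))\<^sup>2)"
        by (simp add: sum_nonneg)
      also have "\<dots> \<le> (e / 2)\<^sup>2"
        using N that by blast
      finally show ?thesis
        using \<open>e > 0\<close> power2_le_imp_le[of "norm (s m i - s n i)" "e / 2"] by (simp add: dist_norm)
    qed
    then show "\<exists>N. \<forall>m\<ge>N. \<forall>n\<ge>N. dist (s m i) (s n i) < e"
      by blast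
  qed
  then have conv: "convergent (\<lambda>n. s n i)" for i
    by (rule Cauchy_convergent)
  define x where "x i = lim (\<lambda>n. s n i)" for i
  have x: "(\<lambda>n. s n i) \<longlonglongrightarrow> x i" for i
    using conv[of i] by (simp add: x_def convergent_LIMSEQ_iff)
  have limit: "\<exists>N. \<forall>m\<ge>N. \<forall>k. (\<Sum>i<k. (norm (s m i - x i))\<^sup>2) \<le> e\<^sup>2" if e: "e > 0" for e
  proof -
    obtain N where N: "\<forall>m\<ge>N. \<forall>n\<ge>N. \<forall>k. (\<Sum>i<k. (norm (s m i - s n i))\<^sup>2) \<le> e\<^sup>2"
      using partial[OF e] by blast
    have "(\<Sum>i<k. (norm (s m i - x i))\<^sup>2) \<le> e\<^sup>2" if "m \<ge> N" for m k
    proof (rule tendsto_upperbound)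
      show "(\<lambda>n. \<Sum>i<k. (norm (s m i - s n i))\<^sup>2) \<longlonglongrightarrow> (\<Sum>i<k. (norm (s m i - x i))\<^sup>2)"
        by (intro tendsto_intros x)
      show "\<forall>\<^sub>F n in sequentially. (\<Sum>i<k. (norm (s m i - s n i))\<^sup>2) \<le> e\<^sup>2"
        using N that by (auto simp: eventually_sequentially)
    qed simp
    then show ?thesis
      by blast
  qed
  have tail: "\<exists>N. \<forall>m\<ge>N. summable (\<lambda>i. (norm (s m i - x i))\<^sup>2) \<and> (\<Sum>i. (norm (s m i - x i))\<^sup>2) \<le> e\<^sup>2"
    if e: "e > 0" for e
  proof -
    obtain N where N: "\<forall>m\<ge>N. \<forall>k. (\<Sum>i<k. (norm (s m i - x i))\<^sup>2) \<le> e\<^sup>2"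
      using limit[OF e] by blast
    have "summable (\<lambda>i. (norm (s m i - x i))\<^sup>2)" if "m \<ge> N" for m
      using N that by (intro summableI_nonneg_bounded[of _ "e\<^sup>2"]) auto
    then show ?thesis
      using N by (meson suminf_le_const)
  qed
  obtain N where "summable (\<lambda>i. (norm (s N i - x i))\<^sup>2)"
    using tail[of 1] by auto
  \<comment> \<open>Prepares \<open>x = - (s N - x) + s N\<close>, which exhibits \<open>x\<close>
    as a sum of two square-summable sequences.\<close>
  then have "summable (\<lambda>i. (norm (- (s N i - x i)))\<^sup>2)"
    by (simp only: norm_minus_cancel)
  from l2_summable_add(1)[OF this, of "s N"] s_in[of N] have x_in: "x \<in> qcar l2"
    by (simp add: l2_def)
  moreover have "qlim l2 s x"
    unfolding qlim_def
  proof (rule LIMSEQ_I)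
    fix e :: real assume e: "e > 0"
    obtain N where N: "\<forall>m\<ge>N. (\<Sum>i. (norm (s m i - x i))\<^sup>2) \<le> (e / 2)\<^sup>2"
      using tail[of "e / 2"] e by auto
    have "qnorm l2 (qdiff l2 (s m) x) < e" if "m \<ge> N" for m
      using N that real_le_lsqrt[of "e / 2" "\<Sum>i. (norm (s m i - x i))\<^sup>2"] e
        real_sqrt_le_mono[of "\<Sum>i. (norm (s m i - x i))\<^sup>2" "(e / 2)\<^sup>2"]
      by (auto simp: l2_def qdiff_def)
    then show "\<exists>N. \<forall>m\<ge>N. norm (qnorm l2 (qdiff l2 (s m) x) - 0) < e"
      using qnorm_diff_nonneg[OF l2_quasinormed s_in x_in] by auto
  qed
  ultimately show "\<exists>x\<in>qcar l2. qlim l2 s x"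
    by blast
qed

section \<open>Finite-dimensional blocks\<close>

lemma fnorm_square: "(fnorm N v)\<^sup>2 = (\<Sum>i<N. (norm (v i))\<^sup>2)"
  by (simp add: fnorm_def L2_set_def sum_nonneg)

lemma fnorm_nonneg: "0 \<le> fnorm N v"
  by (simp add: fnorm_def)

lemma fnorm_add_le: "fnorm N (\<lambda>i. v i + w i) \<le> fnorm N v + fnorm N w"
  unfolding fnorm_def
  by (rule order_trans[OF L2_set_mono L2_set_triangle_ineq]) (auto simp: norm_triangle_ineq)

lemma fnorm_smul: "fnorm N (\<lambda>i. c * v i) = norm c * fnorm N v"
  by (simp add: fnorm_def norm_mult L2_set_right_distrib)

lemma fnorm_scaleR: "fnorm N (\<lambda>i. t *\<^sub>R v i) = \<bar>t\<bar> * fnorm N v"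
  by (simp add: fnorm_def L2_set_right_distrib)

lemma fnorm_add_square_le: "(fnorm N (\<lambda>i. v i + w i))\<^sup>2 \<le> 2 * ((fnorm N v)\<^sup>2 + (fnorm N w)\<^sup>2)"
  unfolding fnorm_square sum_distrib_left sum.distrib[symmetric] by (intro sum_mono norm_add_square_le)

lemma sum_three_blocks:
  fixes f :: "nat \<Rightarrow> 'a::comm_monoid_add"
  shows "sum f {..<3 * m} = (\<Sum>i<m. f i) + (\<Sum>i<m. f (m + i)) + (\<Sum>i<m. f (2 * m + i))"
proof -
  have *: "sum f {..<a + b} = sum f {..<a} + (\<Sum>i<b. f (a + i))" for a b
    by (induction b) (simp_all add: add.assoc)
  have three: "3 * m = m + m + m"
    by simp
  show ?thesis
    by (simp only: three mult_2 *)
qed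

lemma fnorm_blocks:
  "(fnorm (3 * m) v)\<^sup>2 = (fnorm m (block m 0 v))\<^sup>2 + (fnorm m (block m 1 v))\<^sup>2 + (fnorm m (block m 2 v))\<^sup>2"
  unfolding fnorm_square sum_three_blocks by (simp add: block_def)

lemma fnorm_triple:
  "(fnorm (3 * m) (triple m x y z))\<^sup>2 = (fnorm m x)\<^sup>2 + (fnorm m y)\<^sup>2 + (fnorm m z)\<^sup>2"
  unfolding fnorm_square sum_three_blocks by (simp add: triple_def)

lemma block_supp: "m \<le> i \<Longrightarrow> block m k v i = 0"
  by (simp add: block_def)

lemma block_triple:
  assumes "\<And>i. m \<le> i \<Longrightarrow> x i = 0" "\<And>i. m \<le> i \<Longrightarrow> y i = 0"
  shows "block m 0 (triple m x y z) = x" "block m 1 (triple m x y z) = y"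
  using assms by (auto simp: block_def triple_def fun_eq_iff not_less)

lemma block_add: "block m k (\<lambda>i. v i + w i) = (\<lambda>i. block m k v i + block m k w i :: 'k::monoid_add)"
  by (auto simp: block_def)

lemma block_smul: "block m k (\<lambda>i. c * v i) = (\<lambda>i. c * block m k v i :: 'k::mult_zero)"
  by (auto simp: block_def)

section \<open>The Enflo--Lindenstrauss--Pisier maps\<close>

text \<open>With \<open>P\<^sub>0\<close> and \<open>\<Gamma>\<^sub>0\<close> the identity of the scalars, the recursions hold from \<open>n = 0\<close> on.\<close>

lemma elp_P_Suc:
  "elp_P (Suc n) v = triple (3 ^ n) (elp_P n (block (3 ^ n) 0 v)) (elp_P n (block (3 ^ n) 1 v)) (\<lambda>_. 0)"
  by (cases n) (auto simp: Let_def triple_def block_def fun_eq_iff)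

text \<open>The second coordinate of the unit vector in the direction
  \<open>(fnorm m x, fnorm m y)\<close>, or 0 when both norms vanish. The defect estimate rests on
  this reading.\<close>

definition elp_ratio :: "nat \<Rightarrow> (nat \<Rightarrow> 'k::real_normed_field) \<Rightarrow> (nat \<Rightarrow> 'k) \<Rightarrow> real" where
  "elp_ratio m x y = fnorm m y / sqrt ((fnorm m x)\<^sup>2 + (fnorm m y)\<^sup>2)"

lemma elp_G_Suc:
  "elp_G (Suc n) v =
     triple (3 ^ n) (elp_G n (elp_P n (block (3 ^ n) 0 v))) (elp_G n (elp_P n (block (3 ^ n) 1 v)))
       (\<lambda>i. elp_ratio (3 ^ n) (elp_P n (block (3 ^ n) 0 v)) (elp_P n (block (3 ^ n) 1 v))
          *\<^sub>R elp_P n (block (3 ^ n) 0 v) i)"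
  by (cases n) (auto simp: Let_def triple_def block_def fun_eq_iff elp_ratio_def fnorm_def L2_set_def)

declare elp_P.simps(2,3) [simp del] elp_G.simps(2,3) [simp del]

lemma elp_P_supp: "(\<And>i. 3 ^ n \<le> i \<Longrightarrow> v i = 0) \<Longrightarrow> 3 ^ n \<le> i \<Longrightarrow> elp_P n v i = 0"
  by (cases n) (auto simp: elp_P_Suc triple_def)

lemma elp_G_supp: "(\<And>i. 3 ^ n \<le> i \<Longrightarrow> v i = 0) \<Longrightarrow> 3 ^ n \<le> i \<Longrightarrow> elp_G n v i = 0"
  by (cases n) (auto simp: elp_G_Suc triple_def)

lemma elp_P_block_supp: "3 ^ n \<le> i \<Longrightarrow> elp_P n (block (3 ^ n) k v) i = 0"
  by (rule elp_P_supp) (auto simp: block_supp)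

lemma elp_G_block_supp: "3 ^ n \<le> i \<Longrightarrow> elp_G n (elp_P n (block (3 ^ n) k v)) i = 0"
  by (rule elp_G_supp) (auto simp: elp_P_block_supp)

lemma elp_P_add: "elp_P n (\<lambda>i. v i + w i) = (\<lambda>i. elp_P n v i + elp_P n w i)"
  by (induction n arbitrary: v w) (auto simp: elp_P_Suc block_add triple_def fun_eq_iff)

lemma elp_P_smul: "elp_P n (\<lambda>i. c * v i) = (\<lambda>i. c * elp_P n v i)"
  by (induction n arbitrary: v) (auto simp: elp_P_Suc block_smul triple_def fun_eq_iff)

lemma elp_P_fnorm: "fnorm (3 ^ n) (elp_P n v) \<le> fnorm (3 ^ n) v"
proof (induction n arbitrary: v)
  case (Suc n)
  have "(fnorm (3 ^ n) (elp_P n (block (3 ^ n) k v)))\<^sup>2 \<le> (fnorm (3 ^ n) (block (3 ^ n) k v))\<^sup>2" for k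
    by (intro power_mono Suc fnorm_nonneg)
  from this[of 0] this[of 1] have "(fnorm (3 ^ Suc n) (elp_P (Suc n) v))\<^sup>2 \<le> (fnorm (3 ^ Suc n) v)\<^sup>2"
    unfolding elp_P_Suc power_Suc fnorm_triple fnorm_blocks[of _ v]
    by (simp add: fnorm_square[of _ "\<lambda>_. 0"] add_increasing2 add_mono)
  then show ?case
    by (rule power2_le_imp_le) (rule fnorm_nonneg)
qed simp

lemma elp_P_P: "elp_P n (elp_P n v) = elp_P n v"
proof (induction n arbitrary: v)
  case (Suc n)
  show ?case
    unfolding elp_P_Suc by (simp add: block_triple elp_P_block_supp Suc del: One_nat_def)
qed simp

lemma elp_G_P: "elp_G n (elp_P n v) = elp_G n v"
proof (cases n)
  case (Suc m)
  show ?thesis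
    unfolding Suc elp_G_Suc elp_P_Suc by (simp add: block_triple elp_P_block_supp elp_P_P del: One_nat_def)
qed simp

text \<open>The nonlinear term sits in the third block, which \<open>elp_P\<close> erases. On the
  other two blocks the induction hypothesis leaves \<open>elp_P\<close> applied twice, and it is
  idempotent.\<close>

lemma elp_P_G: "elp_P n (elp_G n v) = elp_P n v"
proof (induction n arbitrary: v)
  case (Suc n)
  show ?case
    unfolding elp_G_Suc elp_P_Suc by (simp add: block_triple elp_G_block_supp Suc elp_P_P del: One_nat_def)
qed simp

text \<open>At \<open>c = 0\<close> the left side is 0 whatever the right side is. Homogeneity of
  \<open>elp_G\<close> therefore treats that scalar separately, through
  \<open>elp_G_zero\<close>.\<close>

lemma elp_ratio_smul:
  assumes "c \<noteq> 0"
  shows "elp_ratio m (\<lambda>i. c * x i) (\<lambda>i. c * y i) = elp_ratio m x y"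
proof -
  have "(norm c * fnorm m x)\<^sup>2 + (norm c * fnorm m y)\<^sup>2 = (norm c)\<^sup>2 * ((fnorm m x)\<^sup>2 + (fnorm m y)\<^sup>2)"
    by (simp add: power_mult_distrib distrib_left)
  then show ?thesis
    using assms by (simp add: elp_ratio_def fnorm_smul real_sqrt_mult)
qed

lemma elp_P_zero: "elp_P n (\<lambda>_. 0) = (\<lambda>_. 0)"
  using elp_P_smul[of n 0 "\<lambda>_. 0"] by simp

lemma elp_G_zero: "elp_G n (\<lambda>_. 0) = (\<lambda>_. 0)"
proof (induction n)
  case (Suc n)
  have *: "block m k (\<lambda>_. 0) = (\<lambda>_. 0 :: 'a)" for m k
    by (simp add: block_def fun_eq_iff)
  show ?case
    by (simp add: elp_G_Suc * elp_P_zero Suc) (simp add: triple_def fun_eq_iff)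
qed simp

lemma elp_G_smul: "elp_G n (\<lambda>i. c * v i) = (\<lambda>i. c * elp_G n v i)"
proof (induction n arbitrary: v)
  case (Suc n)
  show ?case
  proof (cases "c = 0")
    case False
    then show ?thesis
      by (simp add: elp_G_Suc block_smul elp_P_smul Suc elp_ratio_smul triple_def fun_eq_iff)
  qed (simp add: elp_G_zero)
qed simp

text \<open>For \<open>u = (a, b) / r\<close> and \<open>u' = (a', b') / r'\<close>, the squared
  distance of \<open>u\<close> and \<open>u'\<close> times \<open>r r'\<close> equals
  \<open>2 (r r' - a a' - b b')\<close>. It dominates the squared gap of the second coordinates, and
  the ordering of the lengths gives \<open>a^2 \<le> r^2 \<le> r r'\<close>, which allows the
  coefficient \<open>a^2\<close> on the left.\<close>

lemma unit_vectors_gap: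
  fixes a b a' b' :: real
  defines "r \<equiv> sqrt (a\<^sup>2 + b\<^sup>2)" and "r' \<equiv> sqrt (a'\<^sup>2 + b'\<^sup>2)"
  assumes "r \<le> r'"
  shows "(b / r - b' / r')\<^sup>2 * a\<^sup>2 \<le> 2 * (r * r' - a * a' - b * b')"
proof (cases "r = 0")
  case True
  then have "a = 0" "b = 0"
    by (auto simp: r_def add_nonneg_eq_0_iff)
  then show ?thesis
    by (simp add: r_def)
next
  case False
  have sq: "r\<^sup>2 = a\<^sup>2 + b\<^sup>2" "r'\<^sup>2 = a'\<^sup>2 + b'\<^sup>2"
    by (simp_all add: r_def r'_def)
  have r: "0 < r" "0 < r'"
    using False assms(3) real_sqrt_ge_zero[of "a\<^sup>2 + b\<^sup>2", folded r_def] by auto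
  let ?q = "(a / r - a' / r')\<^sup>2 + (b / r - b' / r')\<^sup>2"
  have "?q * (r * r') * (r * r') = 2 * (r * r' - a * a' - b * b') * (r * r')"
  proof -
    have "?q * (r * r') * (r * r') = (a * r' - a' * r)\<^sup>2 + (b * r' - b' * r)\<^sup>2"
      using r by (simp add: field_simps power2_eq_square)
    also have "\<dots> = (a\<^sup>2 + b\<^sup>2) * r'\<^sup>2 + (a'\<^sup>2 + b'\<^sup>2) * r\<^sup>2 - 2 * (a * a' + b * b') * (r * r')"
      by (simp add: algebra_simps power2_eq_square)
    also have "\<dots> = 2 * (r * r' - a * a' - b * b') * (r * r')"
      unfolding sq[symmetric] by (simp add: algebra_simps power2_eq_square)
    finally show ?thesis .
  qed
  then have q: "?q * (r * r') = 2 * (r * r' - a * a' - b * b')"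
    using r by simp
  have "a\<^sup>2 \<le> r * r'"
  proof -
    have "a\<^sup>2 \<le> r\<^sup>2"
      by (simp add: sq)
    also have "\<dots> \<le> r * r'"
      using r assms(3) by (simp add: power2_eq_square)
    finally show ?thesis .
  qed
  then have "(b / r - b' / r')\<^sup>2 * a\<^sup>2 \<le> ?q * (r * r')"
    by (intro mult_mono) auto
  with q show ?thesis
    by simp
qed

text \<open>The key is to write the defect as a combination of the two vectors with the smaller values of \<open>r\<close>,
  since \<open>unit_vectors_gap\<close> only bounds the coefficient of the smaller vector of a pair.\<close>

lemma elp_ratio_defect:
  fixes x y x' y' :: "nat \<Rightarrow> 'k::real_normed_field" and m :: nat
  defines "a1 \<equiv> fnorm m x" and "b1 \<equiv> fnorm m y" and "a2 \<equiv> fnorm m x'" and "b2 \<equiv> fnorm m y'"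
    and "a3 \<equiv> fnorm m (\<lambda>i. x i + x' i)" and "b3 \<equiv> fnorm m (\<lambda>i. y i + y' i)"
  defines "r1 \<equiv> sqrt (a1\<^sup>2 + b1\<^sup>2)" and "r2 \<equiv> sqrt (a2\<^sup>2 + b2\<^sup>2)" and "r3 \<equiv> sqrt (a3\<^sup>2 + b3\<^sup>2)"
  shows "(fnorm m (\<lambda>i. elp_ratio m (\<lambda>i. x i + x' i) (\<lambda>i. y i + y' i) *\<^sub>R (x i + x' i)
             - elp_ratio m x y *\<^sub>R x i - elp_ratio m x' y' *\<^sub>R x' i))\<^sup>2
    \<le> 4 * (r1 * r2 + r1 * r3 + r2 * r3 - (a1 * a2 + a1 * a3 + a2 * a3) - (b1 * b2 + b1 * b3 + b2 * b3))"
proof -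
  define t1 t2 t3 where "t1 = b1 / r1" and "t2 = b2 / r2" and "t3 = b3 / r3"
  let ?D = "\<lambda>i. t3 *\<^sub>R (x i + x' i) - t1 *\<^sub>R x i - t2 *\<^sub>R x' i"
  have D_eq: "(\<lambda>i. elp_ratio m (\<lambda>i. x i + x' i) (\<lambda>i. y i + y' i) *\<^sub>R (x i + x' i)
             - elp_ratio m x y *\<^sub>R x i - elp_ratio m x' y' *\<^sub>R x' i) = ?D"
    by (simp add: elp_ratio_def t1_def t2_def t3_def r1_def r2_def r3_def a1_def a2_def a3_def
        b1_def b2_def b3_def)
  \<comment> \<open>This factor 2 and the one in \<open>unit_vectors_gap\<close> produce the
    constant 4.\<close>
  have two: "(fnorm m (\<lambda>i. c *\<^sub>R u i + d *\<^sub>R w i))\<^sup>2 \<le> 2 * (c\<^sup>2 * (fnorm m u)\<^sup>2 + d\<^sup>2 * (fnorm m w)\<^sup>2)"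
    for c d and u w :: "nat \<Rightarrow> 'k"
    using fnorm_add_square_le[of m "\<lambda>i. c *\<^sub>R u i" "\<lambda>i. d *\<^sub>R w i"]
    by (simp add: fnorm_scaleR power_mult_distrib)
  \<comment> \<open>Cauchy-Schwarz in the plane, read off from \<open>unit_vectors_gap\<close>,
    whose left side is nonnegative. It allows the pair of vectors left over in each case below to be
    added to the bound.\<close>
  have nonneg: "0 \<le> sqrt (a\<^sup>2 + b\<^sup>2) * sqrt (a'\<^sup>2 + b'\<^sup>2) - a * a' - b * b'" for a b a' b' :: real
  proof -
    have "0 \<le> 2 * (sqrt (a\<^sup>2 + b\<^sup>2) * sqrt (a'\<^sup>2 + b'\<^sup>2) - a * a' - b * b')"
      if "sqrt (a\<^sup>2 + b\<^sup>2) \<le> sqrt (a'\<^sup>2 + b'\<^sup>2)" for a b a' b' :: real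
      by (rule order_trans[OF _ unit_vectors_gap[OF that]]) simp
    from this[of a b a' b'] this[of a' b' a b] show ?thesis
      by (cases "sqrt (a\<^sup>2 + b\<^sup>2) \<le> sqrt (a'\<^sup>2 + b'\<^sup>2)") (simp_all add: mult.commute)
  qed
  have g: "0 \<le> r1 * r2 - a1 * a2 - b1 * b2" "0 \<le> r1 * r3 - a1 * a3 - b1 * b3" "0 \<le> r2 * r3 - a2 * a3 - b2 * b3"
    unfolding r1_def r2_def r3_def by (rule nonneg)+
  \<comment> \<open>The cases name a largest length. The first component belonging to it is
    eliminated through the linear relation between \<open>x\<close>, \<open>x'\<close> and
    \<open>x + x'\<close>; each remaining coefficient is then a difference of two ratios, one of
    them the ratio of the largest vector.\<close>
  consider "r1 \<le> r3" "r2 \<le> r3" | "r3 \<le> r1" "r2 \<le> r1" | "r3 \<le> r2" "r1 \<le> r2"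
    by linarith
  then have "(fnorm m ?D)\<^sup>2
    \<le> 4 * ((r1 * r2 - a1 * a2 - b1 * b2) + (r1 * r3 - a1 * a3 - b1 * b3) + (r2 * r3 - a2 * a3 - b2 * b3))"
  proof cases
    case 1
    have "?D = (\<lambda>i. (t3 - t1) *\<^sub>R x i + (t3 - t2) *\<^sub>R x' i)"
      by (simp add: fun_eq_iff algebra_simps)
    then have "(fnorm m ?D)\<^sup>2 \<le> 2 * ((t3 - t1)\<^sup>2 * a1\<^sup>2 + (t3 - t2)\<^sup>2 * a2\<^sup>2)"
      using two[of "t3 - t1" x "t3 - t2" x'] by (simp add: a1_def a2_def)
    moreover have "(t1 - t3)\<^sup>2 * a1\<^sup>2 \<le> 2 * (r1 * r3 - a1 * a3 - b1 * b3)"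
      "(t2 - t3)\<^sup>2 * a2\<^sup>2 \<le> 2 * (r2 * r3 - a2 * a3 - b2 * b3)"
      using 1 unfolding t1_def t2_def t3_def r1_def r2_def r3_def by (intro unit_vectors_gap; simp)+
    ultimately show ?thesis
      using g by (simp add: power2_commute[of t3])
  next
    case 2
    have "?D = (\<lambda>i. (t3 - t1) *\<^sub>R (x i + x' i) + (t1 - t2) *\<^sub>R x' i)"
      by (simp add: fun_eq_iff algebra_simps)
    then have "(fnorm m ?D)\<^sup>2 \<le> 2 * ((t3 - t1)\<^sup>2 * a3\<^sup>2 + (t1 - t2)\<^sup>2 * a2\<^sup>2)"
      using two[of "t3 - t1" "\<lambda>i. x i + x' i" "t1 - t2" x'] by (simp add: a3_def a2_def)
    moreover have "(t3 - t1)\<^sup>2 * a3\<^sup>2 \<le> 2 * (r3 * r1 - a3 * a1 - b3 * b1)"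
      "(t2 - t1)\<^sup>2 * a2\<^sup>2 \<le> 2 * (r2 * r1 - a2 * a1 - b2 * b1)"
      using 2 unfolding t1_def t2_def t3_def r1_def r2_def r3_def by (intro unit_vectors_gap; simp)+
    ultimately show ?thesis
      using g by (simp add: power2_commute[of t1 t2] mult.commute)
  next
    case 3
    have "?D = (\<lambda>i. (t3 - t2) *\<^sub>R (x i + x' i) + (t2 - t1) *\<^sub>R x i)"
      by (simp add: fun_eq_iff algebra_simps)
    then have "(fnorm m ?D)\<^sup>2 \<le> 2 * ((t3 - t2)\<^sup>2 * a3\<^sup>2 + (t2 - t1)\<^sup>2 * a1\<^sup>2)"
      using two[of "t3 - t2" "\<lambda>i. x i + x' i" "t2 - t1" x] by (simp add: a3_def a1_def)
    moreover have "(t3 - t2)\<^sup>2 * a3\<^sup>2 \<le> 2 * (r3 * r2 - a3 * a2 - b3 * b2)"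
      "(t1 - t2)\<^sup>2 * a1\<^sup>2 \<le> 2 * (r1 * r2 - a1 * a2 - b1 * b2)"
      using 3 unfolding t1_def t2_def t3_def r1_def r2_def r3_def by (intro unit_vectors_gap; simp)+
    ultimately show ?thesis
      using g by (simp add: power2_commute[of t2 t1] mult.commute)
  qed
  then show ?thesis
    unfolding D_eq by (simp add: algebra_simps)
qed

section \<open>The additive defect of the maps\<close>

definition elp_D :: "nat \<Rightarrow> (nat \<Rightarrow> 'k::real_normed_field) \<Rightarrow> (nat \<Rightarrow> 'k) \<Rightarrow> nat \<Rightarrow> 'k" where
  "elp_D n v w = (\<lambda>i. elp_G n (\<lambda>i. v i + w i) i - (elp_G n v i + elp_G n w i))"

lemma elp_D_bound:
  fixes v w :: "nat \<Rightarrow> 'k::real_normed_field"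
  shows "(fnorm (3 ^ n) (elp_D n v w))\<^sup>2
    \<le> 4 * (fnorm (3 ^ n) v * fnorm (3 ^ n) w + fnorm (3 ^ n) v * fnorm (3 ^ n) (\<lambda>i. v i + w i)
          + fnorm (3 ^ n) w * fnorm (3 ^ n) (\<lambda>i. v i + w i))"
proof (induction n arbitrary: v w)
  case 0
  \<comment> \<open>At level 0 the map is the identity, so the defect vanishes.\<close>
  have "fnorm (3 ^ 0) (elp_D 0 v w) = 0"
    by (simp add: elp_D_def fnorm_def L2_set_def)
  then show ?case
    by (simp add: fnorm_nonneg)
next
  case (Suc n)
  define m :: nat where "m = 3 ^ n"
  define x y where "x u = elp_P n (block m 0 u)" and "y u = elp_P n (block m 1 u)" for u :: "nat \<Rightarrow> 'k"
  define s where "s = (\<lambda>i. v i + w i)"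
  define r where "r u = sqrt ((fnorm m (x u))\<^sup>2 + (fnorm m (y u))\<^sup>2)" for u
  define \<Delta> where "\<Delta> = (\<lambda>i. elp_ratio m (x s) (y s) *\<^sub>R x s i - elp_ratio m (x v) (y v) *\<^sub>R x v i
      - elp_ratio m (x w) (y w) *\<^sub>R x w i)"
  have xs: "x s = (\<lambda>i. x v i + x w i)" and ys: "y s = (\<lambda>i. y v i + y w i)"
    by (simp_all add: x_def y_def s_def block_add elp_P_add)
  have G: "elp_G (Suc n) u = triple m (elp_G n (x u)) (elp_G n (y u)) (\<lambda>i. elp_ratio m (x u) (y u) *\<^sub>R x u i)" for u
    by (simp add: elp_G_Suc x_def y_def m_def)
  have \<Delta>_eq: "\<Delta> = (\<lambda>i. elp_ratio m (x s) (y s) *\<^sub>R (x v i + x w i) - elp_ratio m (x v) (y v) *\<^sub>R x v i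
      - elp_ratio m (x w) (y w) *\<^sub>R x w i)"
    by (simp add: \<Delta>_def xs)
  \<comment> \<open>\<open>r u\<close> is the norm of the projected vector
    \<open>elp_P (Suc n) u\<close>, and the projection is contractive.\<close>
  have r_le: "r u \<le> fnorm (3 ^ Suc n) u" for u
  proof -
    have "r u = fnorm (3 ^ Suc n) (elp_P (Suc n) u)"
      unfolding r_def
      by (rule real_sqrt_unique)
        (simp_all add: fnorm_nonneg elp_P_Suc fnorm_triple x_def y_def m_def fnorm_square[of _ "\<lambda>_. 0"])
    then show ?thesis
      by (simp add: elp_P_fnorm del: power_Suc)
  qed
  have r_nn: "0 \<le> r u" for u
    by (simp add: r_def)
  have "elp_D (Suc n) v w = triple m (elp_D n (x v) (x w)) (elp_D n (y v) (y w)) \<Delta>"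
    unfolding elp_D_def s_def[symmetric] G xs[symmetric] ys[symmetric] \<Delta>_def
    by (simp add: triple_def fun_eq_iff)
  then have "(fnorm (3 ^ Suc n) (elp_D (Suc n) v w))\<^sup>2
      = (fnorm m (elp_D n (x v) (x w)))\<^sup>2 + (fnorm m (elp_D n (y v) (y w)))\<^sup>2 + (fnorm m \<Delta>)\<^sup>2"
    by (simp add: fnorm_triple m_def)
  \<comment> \<open>The induction hypothesis on the two blocks produces exactly the terms that
    \<open>elp_ratio_defect\<close> subtracts. Only products of the lengths \<open>r\<close> remain,
    with the same constant.\<close>
  also have "\<dots> \<le> 4 * (fnorm m (x v) * fnorm m (x w) + fnorm m (x v) * fnorm m (x s) + fnorm m (x w) * fnorm m (x s))
      + 4 * (fnorm m (y v) * fnorm m (y w) + fnorm m (y v) * fnorm m (y s) + fnorm m (y w) * fnorm m (y s))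
      + 4 * (r v * r w + r v * r s + r w * r s
        - (fnorm m (x v) * fnorm m (x w) + fnorm m (x v) * fnorm m (x s) + fnorm m (x w) * fnorm m (x s))
        - (fnorm m (y v) * fnorm m (y w) + fnorm m (y v) * fnorm m (y s) + fnorm m (y w) * fnorm m (y s)))"
    using Suc[of "x v" "x w", folded m_def, folded xs] Suc[of "y v" "y w", folded m_def, folded ys]
      elp_ratio_defect[of m "x v" "x w" "y v" "y w", folded xs ys]
    unfolding \<Delta>_eq r_def by (intro add_mono)
  also have "\<dots> = 4 * (r v * r w + r v * r s + r w * r s)"
    by simp
  also have "\<dots> \<le> 4 * (fnorm (3 ^ Suc n) v * fnorm (3 ^ Suc n) w + fnorm (3 ^ Suc n) v * fnorm (3 ^ Suc n) s
      + fnorm (3 ^ Suc n) w * fnorm (3 ^ Suc n) s)"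
    by (intro mult_left_mono add_mono mult_mono r_le r_nn fnorm_nonneg) auto
  finally show ?case
    by (simp add: s_def)
qed

lemma elp_D_quasilinear:
  "(fnorm (3 ^ n) (elp_D n v w))\<^sup>2 \<le> 10 * ((fnorm (3 ^ n) v)\<^sup>2 + (fnorm (3 ^ n) w)\<^sup>2)"
proof -
  define a b c where "a = fnorm (3 ^ n) v" and "b = fnorm (3 ^ n) w" and "c = fnorm (3 ^ n) (\<lambda>i. v i + w i)"
  have nn: "0 \<le> a" "0 \<le> b" "c \<le> a + b"
    by (simp_all add: a_def b_def c_def fnorm_nonneg fnorm_add_le)
  have "(a + b) * c \<le> (a + b) * (a + b)"
    using nn by (intro mult_left_mono) auto
  moreover have "0 \<le> (a - b)\<^sup>2"
    by simp
  \<comment> \<open>With \<open>c \<le> a + b\<close> the left side is at most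
    \<open>4 a^2 + 12 a b + 4 b^2\<close>, and \<open>12 a b \<le> 6 (a^2 + b^2)\<close>.\<close>
  ultimately have "4 * (a * b + a * c + b * c) \<le> 10 * (a\<^sup>2 + b\<^sup>2)"
    by (simp add: power2_eq_square algebra_simps)
  with elp_D_bound[of n v w] show ?thesis
    by (simp add: a_def b_def c_def)
qed

section \<open>The sum space and the componentwise maps on it\<close>

lemma elp_space_simps [simp]:
  "qzero elp_space = (\<lambda>_ _. 0)" "qadd elp_space v w = (\<lambda>n i. v n i + w n i)"
  "qsmul elp_space c v = (\<lambda>n i. c * v n i)"
  "qdiff elp_space v w = (\<lambda>n i. v n i - w n i)"
  "qnorm elp_space v = sqrt (\<Sum>n. (fnorm (3 ^ n) (v n))\<^sup>2)"
  by (simp_all add: elp_space_def qdiff_def)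

lemma elp_space_in:
  "v \<in> qcar elp_space \<longleftrightarrow> (\<forall>i. v 0 i = 0) \<and> (\<forall>n i. 3 ^ n \<le> i \<longrightarrow> v n i = 0) \<and>
     summable (\<lambda>n. (fnorm (3 ^ n) (v n))\<^sup>2)"
  by (simp add: elp_space_def)

lemma elp_space_vspace: "vspace (elp_space :: ('k::real_normed_field, _) qspace)"
proof -
  have "summable (\<lambda>n. (fnorm (3 ^ n) (\<lambda>i. v n i + w n i))\<^sup>2)"
    if "summable (\<lambda>n. (fnorm (3 ^ n) (v n))\<^sup>2)" "summable (\<lambda>n. (fnorm (3 ^ n) (w n))\<^sup>2)"
    for v w :: "nat \<Rightarrow> nat \<Rightarrow> 'k"
    by (rule summable_comparison_test'[OF summable_mult[OF summable_add[OF that], of 2], of 0])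
      (use fnorm_add_square_le in auto)
  moreover have "fnorm N (\<lambda>_. 0 :: 'k) = 0" for N
    by (simp add: fnorm_def L2_set_def)
  ultimately show ?thesis
    unfolding vspace_def
    by (auto simp: elp_space_in fnorm_smul power_mult_distrib summable_mult algebra_simps)
qed

lemma elp_space0_in: "v \<in> elp_space0 \<Longrightarrow> v \<in> qcar elp_space"
  by (simp add: elp_space0_def)

lemma elp_space0_add:
  assumes "v \<in> elp_space0" "w \<in> elp_space0"
  shows "(\<lambda>n i. v n i + w n i) \<in> elp_space0"
proof -
  have "{n. (\<lambda>i. v n i + w n i) \<noteq> (\<lambda>_. 0)} \<subseteq> {n. v n \<noteq> (\<lambda>_. 0)} \<union> {n. w n \<noteq> (\<lambda>_. 0)}"
    by auto
  then have "finite {n. (\<lambda>i. v n i + w n i) \<noteq> (\<lambda>_. 0)}"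
    using assms by (auto simp: elp_space0_def intro: finite_subset)
  moreover have "(\<lambda>n i. v n i + w n i) \<in> qcar elp_space"
    using vspace_add[OF elp_space_vspace, of v w] assms by (simp add: elp_space0_def)
  ultimately show ?thesis
    by (simp add: elp_space0_def)
qed

text \<open>A componentwise map that sends 0 to 0 keeps finite support, and finite support gives
  summability without any norm estimate. The condition at index 0 is inherited in the same way,
  since component 0 of \<open>v\<close> is zero.\<close>

lemma elp_space0I:
  assumes v: "v \<in> elp_space0" and "\<And>n. v n = (\<lambda>_. 0) \<Longrightarrow> w n = (\<lambda>_. 0)"
    and "\<And>n i. 3 ^ n \<le> i \<Longrightarrow> w n i = 0"
  shows "w \<in> elp_space0"
proof -
  have "{n. w n \<noteq> (\<lambda>_. 0)} \<subseteq> {n. v n \<noteq> (\<lambda>_. 0)}"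
    using assms(2) by auto
  then have fin: "finite {n. w n \<noteq> (\<lambda>_. 0)}"
    using v by (auto simp: elp_space0_def intro: finite_subset)
  have "summable (\<lambda>n. (fnorm (3 ^ n) (w n))\<^sup>2)"
    by (rule summable_finite[OF fin]) (simp add: fnorm_def L2_set_def)
  moreover have "v 0 = (\<lambda>_. 0)"
    using v by (auto simp: elp_space0_def elp_space_in)
  ultimately show ?thesis
    using fin assms(2)[of 0] assms(3) by (simp add: elp_space0_def elp_space_in)
qed

lemma elp_space0_smul: "v \<in> elp_space0 \<Longrightarrow> qsmul elp_space c v \<in> elp_space0"
  by (rule elp_space0I[of v]) (auto simp: elp_space0_def elp_space_in)

lemma elp_map_in: "v \<in> elp_space0 \<Longrightarrow> elp_map v \<in> elp_space0"
  by (rule elp_space0I[of v])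
    (auto simp: elp_map_def elp_G_zero elp_space0_def elp_space_in intro: elp_G_supp)

definition elp_proj :: "(nat \<Rightarrow> nat \<Rightarrow> 'k) \<Rightarrow> nat \<Rightarrow> nat \<Rightarrow> 'k::real_normed_field" where
  "elp_proj v = (\<lambda>n. elp_P n (v n))"

lemma elp_proj_in0: "v \<in> elp_space0 \<Longrightarrow> elp_proj v \<in> elp_space0"
  by (rule elp_space0I[of v])
    (auto simp: elp_proj_def elp_P_zero elp_space0_def elp_space_in intro: elp_P_supp)

lemma
  assumes v: "v \<in> qcar elp_space"
  shows elp_proj_in: "elp_proj v \<in> qcar elp_space"
    and elp_proj_norm: "qnorm elp_space (elp_proj v) \<le> qnorm elp_space v"
proof -
  have le: "(fnorm (3 ^ n) (elp_P n (v n)))\<^sup>2 \<le> (fnorm (3 ^ n) (v n))\<^sup>2" for n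
    by (intro power_mono elp_P_fnorm fnorm_nonneg)
  have s: "summable (\<lambda>n. (fnorm (3 ^ n) (v n))\<^sup>2)"
    using v by (simp add: elp_space_in)
  have s': "summable (\<lambda>n. (fnorm (3 ^ n) (elp_P n (v n)))\<^sup>2)"
    by (rule summable_comparison_test'[OF s, of 0]) (use le in auto)
  with v show "elp_proj v \<in> qcar elp_space"
    by (auto simp: elp_space_in elp_proj_def intro: elp_P_supp)
  show "qnorm elp_space (elp_proj v) \<le> qnorm elp_space v"
    using suminf_le[OF le s' s] by (simp add: elp_proj_def)
qed

lemma elp_map_proj: "elp_map (elp_proj v) = elp_map v"
  by (simp add: elp_map_def elp_proj_def elp_G_P)

lemma elp_proj_map: "elp_proj (elp_map v) = elp_proj v"
  by (simp add: elp_map_def elp_proj_def elp_P_G)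

lemma elp_map_quasilinear:
  assumes v: "v \<in> qcar elp_space" and w: "w \<in> qcar elp_space"
  shows "qnorm elp_space (qdiff elp_space (elp_map (qadd elp_space v w)) (qadd elp_space (elp_map v) (elp_map w)))
    \<le> 4 * (qnorm elp_space v + qnorm elp_space w)"
proof -
  let ?f = "\<lambda>n. (fnorm (3 ^ n) (v n))\<^sup>2" and ?g = "\<lambda>n. (fnorm (3 ^ n) (w n))\<^sup>2"
  have f: "summable ?f" and g: "summable ?g"
    using v w by (simp_all add: elp_space_in)
  have nn: "0 \<le> suminf ?f" "0 \<le> suminf ?g"
    by (simp_all add: suminf_nonneg f g)
  have h: "summable (\<lambda>n. 10 * (?f n + ?g n))"
    by (intro summable_mult summable_add f g)
  have d: "summable (\<lambda>n. (fnorm (3 ^ n) (elp_D n (v n) (w n)))\<^sup>2)"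
    by (rule summable_comparison_test'[OF h, of 0]) (use elp_D_quasilinear in auto)
  have "(\<Sum>n. (fnorm (3 ^ n) (elp_D n (v n) (w n)))\<^sup>2) \<le> (\<Sum>n. 10 * (?f n + ?g n))"
    by (rule suminf_le[OF elp_D_quasilinear d h])
  also have "\<dots> = 10 * (suminf ?f + suminf ?g)"
    by (simp only: suminf_mult[OF summable_add[OF f g]] suminf_add[OF f g])
  \<comment> \<open>10 is rounded up to the square 16 to fit \<open>sqrt_le_quasi\<close>, which
    yields the constant 4.\<close>
  also have "\<dots> \<le> 4\<^sup>2 * (suminf ?f + suminf ?g)"
    using nn by simp
  finally have "sqrt (\<Sum>n. (fnorm (3 ^ n) (elp_D n (v n) (w n)))\<^sup>2) \<le> 4 * (sqrt (suminf ?f) + sqrt (suminf ?g))"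
    by (intro sqrt_le_quasi nn) auto
  then show ?thesis
    by (simp add: elp_map_def elp_D_def)
qed

text \<open>Truncations converge, since the squared distance is the tail of the series of squared
  block norms.\<close>

lemma elp_space0_dense:
  assumes v: "v \<in> qcar elp_space"
  shows "\<exists>s. range s \<subseteq> elp_space0 \<and> (\<lambda>N. qnorm elp_space (qdiff elp_space (s N) v)) \<longlonglongrightarrow> 0"
proof -
  let ?f = "\<lambda>n. (fnorm (3 ^ n) (v n))\<^sup>2"
  have f: "summable ?f"
    using v by (simp add: elp_space_in)
  define s where "s N n = (if n < N then v n else (\<lambda>_. 0))" for N n
  have norm0: "fnorm k (\<lambda>_. 0 :: 'a) = 0" for k
    by (simp add: fnorm_def L2_set_def)
  have "s N \<in> elp_space0" for N
  proof -
    have fin: "finite {n. s N n \<noteq> (\<lambda>_. 0)}"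
      by (rule finite_subset[of _ "{..<N}"]) (auto simp: s_def)
    moreover have "summable (\<lambda>n. (fnorm (3 ^ n) (s N n))\<^sup>2)"
      by (rule summable_finite[OF fin]) (simp add: norm0)
    ultimately show ?thesis
      using v by (simp add: elp_space0_def elp_space_in s_def)
  qed
  moreover have "qnorm elp_space (qdiff elp_space (s N) v) = sqrt (suminf ?f - sum ?f {..<N})" for N
  proof -
    have "fnorm (3 ^ n) (\<lambda>i. - v n i) = fnorm (3 ^ n) (v n)" for n
      by (simp add: fnorm_def)
    then have "(\<lambda>n. (fnorm (3 ^ n) (\<lambda>i. s N n i - v n i))\<^sup>2) = (\<lambda>n. ?f n - (if n \<in> {..<N} then ?f n else 0))"
      by (simp add: fun_eq_iff s_def norm0)
    moreover have "(\<lambda>n. ?f n - (if n \<in> {..<N} then ?f n else 0)) sums (suminf ?f - sum ?f {..<N})"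
      by (intro sums_diff summable_sums f sums_If_finite_set) simp
    ultimately show ?thesis
      by (simp add: sums_unique[symmetric])
  qed
  moreover have "(\<lambda>N. sqrt (suminf ?f - sum ?f {..<N})) \<longlonglongrightarrow> 0"
    using tendsto_real_sqrt[OF tendsto_diff[OF tendsto_const summable_LIMSEQ[OF f], of "suminf ?f"]] by simp
  ultimately show ?thesis
    by (intro exI[of _ s]) auto
qed

section \<open>The map read in \<open>\<ell>\<^sub>2\<close>\<close>

text \<open>The identification is arbitrary, so the result holds for each way of reading the sum
  space as \<open>l2\<close>.\<close>

locale elp_identification =
  fixes T :: "(nat \<Rightarrow> nat \<Rightarrow> 'k::{real_normed_field, banach}) \<Rightarrow> nat \<Rightarrow> 'k"
  assumes iso: "isometric_iso elp_space l2 T"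
begin

lemma T_bij: "bij_betw T (qcar elp_space) (qcar l2)" and T_linear: "qlinear elp_space l2 T"
  and T_norm: "v \<in> qcar elp_space \<Longrightarrow> qnorm l2 (T v) = qnorm elp_space v"
  using iso by (auto simp: isometric_iso_def)

lemmas T_in = qlinear_in[OF T_linear]

lemma T_inv: "v \<in> qcar elp_space \<Longrightarrow> inv_into (qcar elp_space) T (T v) = v"
  using T_bij by (simp add: bij_betw_def)

lemma T_surj: "x \<in> qcar l2 \<Longrightarrow> \<exists>v\<in>qcar elp_space. x = T v"
  using T_bij by (auto simp: bij_betw_def)

lemma elp_l2_T: "v \<in> qcar elp_space \<Longrightarrow> elp_l2 T (T v) = T (elp_map v)"
  by (simp add: elp_l2_def T_inv)

text \<open>Oriented so that rewriting collects all operations inside \<open>T\<close>, where they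
  become pointwise.\<close>

lemma T_add: "v \<in> qcar elp_space \<Longrightarrow> w \<in> qcar elp_space \<Longrightarrow> qadd l2 (T v) (T w) = T (qadd elp_space v w)"
  and T_smul: "v \<in> qcar elp_space \<Longrightarrow> qsmul l2 c (T v) = T (qsmul elp_space c v)"
  and T_diff: "v \<in> qcar elp_space \<Longrightarrow> w \<in> qcar elp_space \<Longrightarrow> qdiff l2 (T v) (T w) = T (qdiff elp_space v w)"
  by (simp_all only: qlinear_add[OF T_linear] qlinear_smul[OF T_linear] qlinear_diff[OF T_linear elp_space_vspace])

lemma elp_twisted_sum: "twisted_sum l2 l2 (elp_dom T) (elp_l2 T)"
proof
  note in0 = elp_space0_in
  have zero: "(\<lambda>_ _. 0) \<in> elp_space0"
    using vspace_zero[OF elp_space_vspace] by (simp add: elp_space0_def)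
  show "quasi_banach (l2 :: ('k, _) qspace)"
    by (rule l2_quasi_banach)
  show "elp_dom T \<subseteq> qcar l2"
    by (auto simp: elp_dom_def intro: T_in in0)
  show "qzero l2 \<in> elp_dom T"
    using qlinear_zero[OF T_linear elp_space_vspace quasinormed_vspace[OF l2_quasinormed]] zero
    by (auto simp: elp_dom_def image_iff intro!: bexI[of _ "\<lambda>_ _. 0"])
  show "qadd l2 x y \<in> elp_dom T" if "x \<in> elp_dom T" "y \<in> elp_dom T" for x y
    using that by (auto simp: elp_dom_def T_add in0 intro!: imageI elp_space0_add)
  show "qsmul l2 c x \<in> elp_dom T" if "x \<in> elp_dom T" for c x
    using that elp_space0_smul by (auto simp: elp_dom_def T_smul in0 intro!: imageI)
  show "\<exists>s. range s \<subseteq> elp_dom T \<and> qlim l2 s x" if "x \<in> qcar l2" for x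
  proof -
    obtain v where v: "v \<in> qcar elp_space" "x = T v"
      using T_surj[OF \<open>x \<in> qcar l2\<close>] by blast
    obtain s where s: "range s \<subseteq> elp_space0" "(\<lambda>N. qnorm elp_space (qdiff elp_space (s N) v)) \<longlonglongrightarrow> 0"
      using elp_space0_dense[OF v(1)] by blast
    have s_in: "s N \<in> qcar elp_space" for N
      using s(1) in0 by blast
    have "qlim l2 (\<lambda>N. T (s N)) x"
      using s(2) unfolding qlim_def v(2) T_diff[OF s_in v(1)]
        T_norm[OF vspace_diff[OF elp_space_vspace s_in v(1)]] .
    moreover have "range (\<lambda>N. T (s N)) \<subseteq> elp_dom T"
      using s(1) by (auto simp: elp_dom_def)
    ultimately show ?thesis
      by blast
  qed
  show "elp_l2 T x \<in> qcar l2" if "x \<in> elp_dom T" for x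
    using that by (auto simp: elp_dom_def elp_l2_T in0 elp_map_in intro!: T_in)
  show "elp_l2 T (qsmul l2 c x) = qsmul l2 c (elp_l2 T x)" if "x \<in> elp_dom T" for c x
  proof -
    obtain v where v: "v \<in> elp_space0" "x = T v"
      using \<open>x \<in> elp_dom T\<close> by (auto simp: elp_dom_def)
    have "elp_map (qsmul elp_space c v) = qsmul elp_space c (elp_map v)"
      by (simp add: elp_map_def elp_G_smul)
    then show ?thesis
      unfolding v(2) T_smul[OF in0[OF v(1)]] elp_l2_T[OF in0[OF elp_space0_smul[OF v(1)]]]
        elp_l2_T[OF in0[OF v(1)]] T_smul[OF in0[OF elp_map_in[OF v(1)]]] by simp
  qed
  show "\<exists>Q. \<forall>x\<in>elp_dom T. \<forall>y\<in>elp_dom T.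
      qnorm l2 (qdiff l2 (elp_l2 T (qadd l2 x y)) (qadd l2 (elp_l2 T x) (elp_l2 T y)))
        \<le> Q * (qnorm l2 x + qnorm l2 y)"
  proof (intro exI ballI)
    fix x y assume "x \<in> elp_dom T" "y \<in> elp_dom T"
    then obtain v w where v: "v \<in> elp_space0" "x = T v" and w: "w \<in> elp_space0" "y = T w"
      by (auto simp: elp_dom_def)
    have vw: "qadd elp_space v w \<in> elp_space0"
      using elp_space0_add[OF v(1) w(1)] by simp
    note i = in0[OF v(1)] in0[OF w(1)] in0[OF vw]
    note m = in0[OF elp_map_in[OF v(1)]] in0[OF elp_map_in[OF w(1)]] in0[OF elp_map_in[OF vw]]
    note e = elp_space_vspace
    show "qnorm l2 (qdiff l2 (elp_l2 T (qadd l2 x y)) (qadd l2 (elp_l2 T x) (elp_l2 T y)))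
        \<le> 4 * (qnorm l2 x + qnorm l2 y)"
      unfolding v(2) w(2) T_add[OF i(1,2)] elp_l2_T[OF i(1)] elp_l2_T[OF i(2)] elp_l2_T[OF i(3)]
        T_add[OF m(1,2)] T_diff[OF m(3) vspace_add[OF e m(1,2)]]
        T_norm[OF vspace_diff[OF e m(3) vspace_add[OF e m(1,2)]]] T_norm[OF i(1)] T_norm[OF i(2)]
      by (rule elp_map_quasilinear[OF i(1,2)])
  qed
qed

definition proj_l2 :: "(nat \<Rightarrow> 'k) \<Rightarrow> nat \<Rightarrow> 'k" where
  "proj_l2 x = T (elp_proj (inv_into (qcar elp_space) T x))"

lemma proj_l2_T: "v \<in> qcar elp_space \<Longrightarrow> proj_l2 (T v) = T (elp_proj v)"
  by (simp add: proj_l2_def T_inv)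

lemma proj_l2_qoperator: "qoperator l2 l2 proj_l2"
proof (rule qoperatorI)
  note e = elp_space_vspace
  fix x :: "nat \<Rightarrow> 'k" assume "x \<in> qcar l2"
  then obtain v where v: "v \<in> qcar elp_space" "x = T v"
    using T_surj by blast
  show "proj_l2 x \<in> qcar l2"
    using v by (simp add: proj_l2_T T_in elp_proj_in)
  show "qnorm l2 (proj_l2 x) \<le> 1 * qnorm l2 x"
    unfolding v(2) proj_l2_T[OF v(1)] T_norm[OF v(1)] T_norm[OF elp_proj_in[OF v(1)]]
    using elp_proj_norm[OF v(1)] by simp
  have "elp_proj (qsmul elp_space c v) = qsmul elp_space c (elp_proj v)" for c
    by (simp add: elp_proj_def elp_P_smul)
  then show "proj_l2 (qsmul l2 c x) = qsmul l2 c (proj_l2 x)" for c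
    unfolding v(2) T_smul[OF v(1)] proj_l2_T[OF vspace_smul[OF e v(1)]] proj_l2_T[OF v(1)]
      T_smul[OF elp_proj_in[OF v(1)]] by simp
  fix y :: "nat \<Rightarrow> 'k" assume "y \<in> qcar l2"
  then obtain w where w: "w \<in> qcar elp_space" "y = T w"
    using T_surj by blast
  have "elp_proj (qadd elp_space v w) = qadd elp_space (elp_proj v) (elp_proj w)"
    by (simp add: elp_proj_def elp_P_add)
  then show "proj_l2 (qadd l2 x y) = qadd l2 (proj_l2 x) (proj_l2 y)"
    unfolding v(2) w(2) T_add[OF v(1) w(1)] proj_l2_T[OF vspace_add[OF e v(1) w(1)]] proj_l2_T[OF v(1)]
      proj_l2_T[OF w(1)] T_add[OF elp_proj_in[OF v(1)] elp_proj_in[OF w(1)]] by simp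
qed

text \<open>The hypotheses of \<open>splice4_arrows\<close> when both maps are
  \<open>elp_l2 T\<close> and both operators are \<open>proj_l2\<close>.\<close>

lemma
  assumes "x \<in> elp_dom T"
  shows proj_l2_dom: "proj_l2 x \<in> elp_dom T"
    and elp_l2_proj: "elp_l2 T (proj_l2 x) = elp_l2 T x"
    and proj_elp_l2: "proj_l2 (elp_l2 T x) = proj_l2 x"
proof -
  obtain v where v: "v \<in> elp_space0" "x = T v"
    using assms by (auto simp: elp_dom_def)
  note i = elp_space0_in[OF v(1)]
  show "proj_l2 x \<in> elp_dom T" "elp_l2 T (proj_l2 x) = elp_l2 T x" "proj_l2 (elp_l2 T x) = proj_l2 x"
    using elp_proj_in0[OF v(1)]
    by (simp_all add: v(2) elp_dom_def proj_l2_T[OF i] elp_l2_T[OF i] elp_l2_T[OF elp_proj_in[OF i]]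
        proj_l2_T[OF elp_space0_in[OF elp_map_in[OF v(1)]]] elp_map_proj elp_proj_map)
qed

end

section \<open>Encodings\<close>

text \<open>Codes a pair of scalar sequences as one, because the universe is only known to contain
  scalar sequences.\<close>

definition interleave :: "(nat \<Rightarrow> 'k) \<times> (nat \<Rightarrow> 'k) \<Rightarrow> nat \<Rightarrow> 'k" where
  "interleave p n = (if even n then fst p (n div 2) else snd p (n div 2))"

lemma inj_interleave: "inj interleave"
proof (rule injI)
  fix p q :: "(nat \<Rightarrow> 'k) \<times> (nat \<Rightarrow> 'k)" assume eq: "interleave p = interleave q"
  have "fst p n = fst q n" "snd p n = snd q n" for n
    using fun_cong[OF eq, of "2 * n"] fun_cong[OF eq, of "2 * n + 1"] by (simp_all add: interleave_def)
  then show "p = q"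
    by (auto simp: prod_eq_iff)
qed

text \<open>Codes the representatives of elements of \<open>Z(\<Gamma>)\<close>, which are sequences
  of pairs of scalar sequences, by the pairing function on the naturals.\<close>

definition flatten :: "(nat \<Rightarrow> (nat \<Rightarrow> 'k) \<times> (nat \<Rightarrow> 'k)) \<Rightarrow> nat \<Rightarrow> 'k" where
  "flatten s n = interleave (s (fst (prod_decode n))) (snd (prod_decode n))"

lemma inj_flatten: "inj flatten"
proof (rule injI)
  fix s t :: "nat \<Rightarrow> (nat \<Rightarrow> 'k) \<times> (nat \<Rightarrow> 'k)" assume eq: "flatten s = flatten t"
  have "interleave (s m) = interleave (t m)" for m
    using fun_cong[OF eq, of "prod_encode (m, n)" for n] by (simp add: flatten_def fun_eq_iff)
  then show "s = t"
    using injD[OF inj_interleave] by blast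
qed

text \<open>A class is determined by any of its members. Replacing it by a chosen member lowers the
  type from sets of sequences to sequences.\<close>

lemma inj_on_crep: "quasinormed V \<Longrightarrow> inj_on crep (qcar (completion V))"
  by (rule inj_onI) (metis completion_mem(2) crep_in)

theorem proposition5p5:
  fixes T :: "(nat \<Rightarrow> nat \<Rightarrow> 'k::{real_normed_field, banach}) \<Rightarrow> nat \<Rightarrow> 'k"
    and j :: "(nat \<Rightarrow> 'k) \<Rightarrow> 'u"
  assumes identification: "isometric_iso elp_space l2 T"
    and universe: "inj j"
  shows "ext2_trivial TYPE('u) l2 l2
           (splice4 l2 l2 l2 (elp_dom T) (elp_l2 T) (elp_dom T) (elp_l2 T))"
proof -
  interpret elp_identification T
    by standard (rule identification)
  let ?S = "splice4 l2 l2 l2 (elp_dom T) (elp_l2 T) (elp_dom T) (elp_l2 T)"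
  let ?Z = "Zsp l2 l2 (elp_dom T) (elp_l2 T)"
  \<comment> \<open>Since \<open>P \<Gamma> = P\<close>, the bounded linear map required on the
    right is the projection itself.\<close>
  obtain W :: "('k, (nat \<Rightarrow> (nat \<Rightarrow> 'k) \<times> (nat \<Rightarrow> 'k)) set \<times> (nat \<Rightarrow> (nat \<Rightarrow> 'k) \<times> (nat \<Rightarrow> 'k)) set) qspace"
      and k \<rho>
    where W: "qcar W \<subseteq> qcar (E1 ?S) \<times> qcar (E2 ?S)"
      and arrows: "arrow4 l2 l2 ?S (extended4 l2 ?S W k \<rho>)" "arrow4 l2 l2 (zero4 l2 l2) (extended4 l2 ?S W k \<rho>)"
    by (rule splice4_arrows[OF elp_twisted_sum elp_twisted_sum proj_l2_qoperator proj_l2_dom elp_l2_proj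
          proj_l2_qoperator proj_elp_l2])
  \<comment> \<open>The code of an element of \<open>Z(\<Gamma>)\<close> as one scalar
    sequence.\<close>
  define h where "h A = flatten (crep A)" for A :: "(nat \<Rightarrow> (nat \<Rightarrow> 'k) \<times> (nat \<Rightarrow> 'k)) set"
  have S: "E1 ?S = ?Z" "E2 ?S = ?Z"
    by (simp_all add: splice4_def)
  have "inj_on crep (qcar ?Z)"
    unfolding Zsp_def by (rule inj_on_crep[OF twisted_sum.twisted_quasinormed[OF elp_twisted_sum]])
  then have h: "inj_on h (qcar ?Z)"
    using inj_flatten by (auto simp: h_def inj_on_def inj_def)
  note j = inj_eq[OF universe] and i = inj_eq[OF inj_interleave]
  show ?thesis
  proof (rule ext2_trivialI[OF arrows])
    show "inj_on (\<lambda>A. j (h A)) (qcar (E1 ?S))" "inj_on (\<lambda>A. j (h A)) (qcar (E2 ?S))"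
      using h by (simp_all add: S inj_on_def j)
    show "inj_on (\<lambda>p. j (interleave (h (fst p), h (snd p)))) (qcar (E1 (extended4 l2 ?S W k \<rho>)))"
    proof (rule inj_on_subset)
      show "inj_on (\<lambda>p. j (interleave (h (fst p), h (snd p)))) (qcar ?Z \<times> qcar ?Z)"
        by (auto simp: inj_on_def j i inj_on_eq_iff[OF h])
      show "qcar (E1 (extended4 l2 ?S W k \<rho>)) \<subseteq> qcar ?Z \<times> qcar ?Z"
        using W by (simp add: extended4_def S)
    qed
    \<comment> \<open>This space is the direct sum of \<open>Z(\<Gamma>)\<close> and
      \<open>l2\<close>, so its second coordinate is already a scalar sequence.\<close>
    show "inj_on (\<lambda>p. j (interleave (h (fst p), snd p))) (qcar (E2 (extended4 l2 ?S W k \<rho>)))"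
      by (auto simp: extended4_def S inj_on_def j i inj_on_eq_iff[OF h])
    show "inj_on j (qcar l2)" "inj_on j (qcar l2)"
      by (simp_all add: inj_on_def j)
  qed
qed

end
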